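(* Let $p(x)$ be a monic polynomial in $\mathbb{Z}[x]$, let $z\in[0,\omega)$, and let $P\in E(\mathbb{R})$ be the point with parameter $z$, i.e. $P=(\wp(z),\wp'(z))$ (with $P=O$ if $z=0$). Then the sequence $s_n=[p(n)]P$ is equidistributed with respect to $\mu(X)=\frac1\omega\int_{\wp(X)}\frac{dx}{y}$ if and only if $z\notin\omega\mathbb{Q}$.
   Context: Let $g_2,g_3\in\mathbb{R}$ with $g_2^3-27g_3^2\ne0$, let $\Lambda\subset\mathbb{C}$ be the lattice with invariants $g_2,g_3$, $\wp$ its Weierstrass function, $E:y^2=4x^3-g_2x-g_3$, and $\omega>0$ the smallest positive real element of $\Lambda$. The map $z\mapsto(\wp(z),\wp'(z))$, $0\mapsto O$, is a group isomorphism from $\mathbb{R}/\omega\mathbb{Z}$ onto the identity component of $E(\mathbb{R})$. For Borel $X\subseteq[0,\omega]$, $\mu(X)$ is the integral of $dx/|y|$ over the part $\{(\wp(t),\wp'(t)):t\in X\}$ of the curve (both branches $y>0$, $y<0$ counted), divided by $\omega$; equivalently, the normalized Lebesgue measure of $X$. A sequence of points of the identity component with parameters $s_n\in[0,\omega)$ is equidistributed with respect to $\mu$ if $\lim_{N\to\infty}\frac1N\#\{n\le N:s_n\in[a,b]\}=\mu([a,b])$ for every $[a,b]\subseteq[0,\omega]$.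
   Formalization: The monic polynomial p is assumed to be nonconstant; for p = 1 the sequence is constantly P and is never equidistributed, so the claim fails there for every z not in ωℚ. *)

theory Defs
  imports "HOL-Analysis.Analysis" "HOL-Computational_Algebra.Polynomial" "HOL-Algebra.Group"
begin

definition is_lattice :: "complex set \<Rightarrow> bool" where
  "is_lattice \<Lambda> \<longleftrightarrow>
     (\<exists>w1 w2. w1 \<noteq> 0 \<and> Im (w2 / w1) \<noteq> 0 \<and>
        \<Lambda> = {of_int m * w1 + of_int n * w2 | m n. True})"

definition lattice_g2 :: "complex set \<Rightarrow> complex" where
  "lattice_g2 \<Lambda> = 60 * (\<Sum>\<^sub>\<infinity>w\<in>\<Lambda> - {0}. 1 / w ^ 4)"

definition lattice_g3 :: "complex set \<Rightarrow> complex" where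
  "lattice_g3 \<Lambda> = 140 * (\<Sum>\<^sub>\<infinity>w\<in>\<Lambda> - {0}. 1 / w ^ 6)"

definition wp :: "complex set \<Rightarrow> complex \<Rightarrow> complex" where
  "wp \<Lambda> z = 1 / z\<^sup>2 + (\<Sum>\<^sub>\<infinity>w\<in>\<Lambda> - {0}. 1 / (z - w)\<^sup>2 - 1 / w\<^sup>2)"

datatype ec_point = Infinity | Affine real real

fun ec_neg :: "ec_point \<Rightarrow> ec_point" where
  "ec_neg Infinity = Infinity"
| "ec_neg (Affine x y) = Affine x (- y)"

(* Chord-tangent law on y^2 = 4 x^3 - g2 x - g3. A line of slope l meets the curve
   in three points whose x-coordinates sum to l^2 / 4. *)
fun ec_add :: "real \<Rightarrow> ec_point \<Rightarrow> ec_point \<Rightarrow> ec_point" where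
  "ec_add g2 Infinity Q = Q"
| "ec_add g2 P Infinity = P"
| "ec_add g2 (Affine x1 y1) (Affine x2 y2) =
     (if Affine x2 y2 = ec_neg (Affine x1 y1) then Infinity
      else let l = (if x1 = x2 then (12 * x1\<^sup>2 - g2) / (2 * y1)
                    else (y2 - y1) / (x2 - x1));
               x3 = l\<^sup>2 / 4 - x1 - x2
           in Affine x3 (- (y1 + l * (x3 - x1))))"

definition ec_carrier :: "real \<Rightarrow> real \<Rightarrow> ec_point set" where
  "ec_carrier g2 g3 =
     insert Infinity {Affine x y | x y. y\<^sup>2 = 4 * x ^ 3 - g2 * x - g3}"

(* The group E(R), written multiplicatively: [m]P is the integer power of P. *)
definition ec_group :: "real \<Rightarrow> real \<Rightarrow> ec_point monoid" where
  "ec_group g2 g3 = \<lparr>carrier = ec_carrier g2 g3, mult = ec_add g2, one = Infinity\<rparr>"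

(* has_parameter L t P: the point P is (wp t, wp' t), read as the point at infinity
   when t is a pole. *)
fun has_parameter :: "complex set \<Rightarrow> real \<Rightarrow> ec_point \<Rightarrow> bool" where
  "has_parameter \<Lambda> t Infinity \<longleftrightarrow> complex_of_real t \<in> \<Lambda>"
| "has_parameter \<Lambda> t (Affine x y) \<longleftrightarrow>
     complex_of_real t \<notin> \<Lambda> \<and>
     complex_of_real x = wp \<Lambda> (complex_of_real t) \<and>
     complex_of_real y = deriv (wp \<Lambda>) (complex_of_real t)"

(* The integral of dx / |y| over the part of the curve with parameters in X, one summand
   for each branch y > 0, y < 0 (the points with y = 0 form a null set), divided by \<omega>.
   On the curve |y| = sqrt (4 x^3 - g2 x - g3). *)
definition curve_measure ::
    "complex set \<Rightarrow> real \<Rightarrow> real \<Rightarrow> real \<Rightarrow> real set \<Rightarrow> real" where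
  "curve_measure \<Lambda> g2 g3 \<omega> X =
     ((LINT x : {x. \<exists>y>0. \<exists>t\<in>X. has_parameter \<Lambda> t (Affine x y)} | lborel.
         1 / sqrt (4 * x ^ 3 - g2 * x - g3)) +
      (LINT x : {x. \<exists>y<0. \<exists>t\<in>X. has_parameter \<Lambda> t (Affine x y)} | lborel.
         1 / sqrt (4 * x ^ 3 - g2 * x - g3))) / \<omega>"

definition curve_equidistributed ::
    "complex set \<Rightarrow> real \<Rightarrow> real \<Rightarrow> real \<Rightarrow> (nat \<Rightarrow> ec_point) \<Rightarrow> bool" where
  "curve_equidistributed \<Lambda> g2 g3 \<omega> Q \<longleftrightarrow>
     (\<exists>s. (\<forall>n. s n \<in> {0..<\<omega>} \<and> has_parameter \<Lambda> (s n) (Q n)) \<and>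
          (\<forall>a b. 0 \<le> a \<and> a \<le> b \<and> b \<le> \<omega> \<longrightarrow>
             (\<lambda>N. real (card {n \<in> {1..N}. s n \<in> {a..b}}) / real N)
               \<longlonglongrightarrow> curve_measure \<Lambda> g2 g3 \<omega> {a..b}))"

end

theory Submission
  imports Defs "HOL-Complex_Analysis.Complex_Analysis"
begin

text \<open>
  The differential equation of \<open>\<wp>\<close> and the addition theorem make
  \<open>t \<mapsto> (\<wp>(t), \<wp>'(t))\<close> additive, so that \<open>[p(n)]P\<close> has parameter \<open>p(n) z\<close> modulo \<open>\<omega>\<close>, while the
  substitution \<open>x = \<wp>(t)\<close>, \<open>dx = y dt\<close>, turns \<open>dx / |y|\<close> into Lebesgue measure on \<open>[0, \<omega>]\<close>.
  The claim is thereby reduced to Weyl's theorem on \<open>p(n) z / \<omega>\<close> modulo 1.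
  Both the injectivity of the parametrization and the reality of \<open>\<wp>\<close> on the real axis follow from
  uniqueness for \<open>\<wp>'' = 6 \<wp>\<^sup>2 - g\<^sub>2 / 2\<close>: the difference \<open>d\<close> of two solutions \<open>u\<close>, \<open>v\<close> satisfies a linear
  equation \<open>d'' = 6 (u + v) d\<close>, whose indicial equation excludes a zero of the order at hand.
\<close>

section \<open>Uniform distribution of polynomial sequences\<close>

text \<open>Behind both uses of uniqueness stands a comparison of exponents. At a regular point the
  exponents of z^2 d'' = q d are 0 and 1, so agreement of value and derivative leaves no order for
  d. At the pole q tends to 12, and n(n - 1) = 12 has the single positive root 4, whereas two
  functions with the same invariants already agree up to order six. Reality rests on the second
  comparison: conjugation turns \<Lambda> into a lattice with conjugate, hence equal, invariants.
  Invariance of \<Lambda> itself under conjugation is not among the hypotheses, so it is the two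
  functions that are compared. Monicity makes z / \<omega> the leading coefficient of p(n) z /
  \<omega>, which turns Weyl's condition into a condition on z alone. The exponential sums are
  handled by differencing until a geometric series remains. Multiples of P are followed through
  their parameters by induction on the exponent: each multiplication by P adds z.\<close>

definition average :: "(nat \<Rightarrow> 'a::real_normed_field) \<Rightarrow> nat \<Rightarrow> 'a" where
  "average u N = (\<Sum>n=1..N. u n) / of_nat N"

lemma average_add: "average (\<lambda>n. u n + v n) N = average u N + average v N"
  by (simp add: average_def sum.distrib add_divide_distrib)

lemma average_cmult: "average (\<lambda>n. c * u n) N = c * average u N"
  by (simp add: average_def sum_distrib_left)

lemma average_sum: "average (\<lambda>n. \<Sum>i\<in>I. u i n) N = (\<Sum>i\<in>I. average (u i) N)"
  unfolding average_def by (subst sum.swap) (simp add: sum_divide_distrib)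

text \<open>A shift by one only trades the first term of the sum for a new last one, so a shift by h
  changes the sum by at most 2h, whatever N is.\<close>

lemma average_shift_tendsto:
  fixes u :: "nat \<Rightarrow> 'a::real_normed_field"
  assumes "\<And>n. norm (u n) \<le> 1"
  shows "(\<lambda>N. average (\<lambda>n. u (n + h)) N - average u N) \<longlonglongrightarrow> 0"
proof (rule Lim_null_comparison)
  have "norm ((\<Sum>n=1..N. u (n + h)) - (\<Sum>n=1..N. u n)) \<le> 2 * real h" for N
  proof (induction h)
    case (Suc h)
    have "(\<Sum>n=1..N. u (n + Suc h)) - (\<Sum>n=1..N. u (n + h)) = u (Suc N + h) - u (Suc h)"
      by (induction N) (auto simp: algebra_simps)
    moreover have "norm (u (Suc N + h) - u (Suc h)) \<le> 2"
      using norm_triangle_ineq4[of "u (Suc N + h)" "u (Suc h)"] assms[of "Suc N + h"] assms[of "Suc h"]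
      by linarith
    ultimately have "norm ((\<Sum>n=1..N. u (n + Suc h)) - (\<Sum>n=1..N. u (n + h))) \<le> 2" by metis
    then have "norm ((\<Sum>n=1..N. u (n + Suc h)) - (\<Sum>n=1..N. u n)) \<le> 2 + 2 * real h"
      using Suc by (rule norm_diff_triangle_le)
    then show ?case by simp
  qed simp
  then show "\<forall>\<^sub>F N in sequentially.
      norm (average (\<lambda>n. u (n + h)) N - average u N) \<le> 2 * real h / real N"
    unfolding average_def diff_divide_distrib[symmetric] norm_divide norm_of_nat
    by (intro always_eventually allI divide_right_mono) auto
  show "(\<lambda>N. 2 * real h / real N) \<longlonglongrightarrow> 0" by real_asymp
qed

lemma norm_average_square_le: "(norm (average u N))\<^sup>2 \<le> average (\<lambda>n. (norm (u n))\<^sup>2) N"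
proof (cases "N = 0")
  case False
  have "(norm (\<Sum>n=1..N. u n))\<^sup>2 \<le> (\<Sum>n=1..N. norm (u n))\<^sup>2"
    by (intro power_mono norm_sum) auto
  also have "\<dots> \<le> real (card {1..N}) * (\<Sum>n=1..N. (norm (u n))\<^sup>2)"
    by (subst mult.commute) (rule sum_squared_le_sum_of_squares)
  finally have *: "(norm (\<Sum>n=1..N. u n))\<^sup>2 \<le> real N * (\<Sum>n=1..N. (norm (u n))\<^sup>2)" by simp
  show ?thesis
    using False divide_right_mono[OF *, of "(real N)\<^sup>2"]
    by (simp add: average_def norm_divide power_divide power2_eq_square)
qed (simp add: average_def)

text \<open>The average of u is asymptotically that of the window means w of H consecutive terms. By
  Cauchy-Schwarz its square is at most the average of |w|^2, and expanding |w|^2 gives H^2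
  correlations of which only the H diagonal ones survive: the limit is H / H^2 = 1 / H.\<close>

lemma van_der_Corput:
  fixes u :: "nat \<Rightarrow> complex"
  assumes norm_u: "\<And>n. norm (u n) = 1"
    and corr: "\<And>h. h \<ge> 1 \<Longrightarrow> average (\<lambda>n. u (n + h) * cnj (u n)) \<longlonglongrightarrow> 0"
  shows "average u \<longlonglongrightarrow> 0"
proof (rule LIMSEQ_I)
  fix e :: real assume "e > 0"
  \<comment> \<open>Chosen so that the limit 1 / H lies below (e / 2)^2; the other e / 2 pays for
    replacing u by w.\<close>
  obtain H :: nat where H: "4 / e\<^sup>2 < real H" using reals_Archimedean2 by blast
  have "0 < 4 / e\<^sup>2" using \<open>e > 0\<close> by simp
  then have "real H > 0" using H by linarith
  then have "H > 0" by simp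
  define w where "w = (\<lambda>n. (1 / of_nat H) * (\<Sum>h<H. u (n + h)))"
  have "(\<lambda>N. (1 / of_nat H) * (\<Sum>h<H. average (\<lambda>n. u (n + h)) N - average u N)) \<longlonglongrightarrow>
          (1 / of_nat H) * (\<Sum>h<H. 0)"
    by (intro tendsto_intros average_shift_tendsto) (simp add: norm_u)
  moreover have "(1 / of_nat H) * (\<Sum>h<H. average (\<lambda>n. u (n + h)) N - average u N)
      = average w N - average u N" for N
    using \<open>H > 0\<close> unfolding w_def average_cmult average_sum by (simp add: sum_subtractf right_diff_distrib)
  ultimately have diff: "(\<lambda>N. average w N - average u N) \<longlonglongrightarrow> 0" by simp
  \<comment> \<open>The hypothesis treats only a positive lag against lag 0. A common shift by k
    reaches every pair k < h, and conjugation exchanges the two indices.\<close>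
  have corr2: "average (\<lambda>n. u (n + h) * cnj (u (n + k))) \<longlonglongrightarrow> (if h = k then 1 else 0)" for h k
  proof -
    have less: "average (\<lambda>n. u (n + h) * cnj (u (n + k))) \<longlonglongrightarrow> 0" if "k < h" for h k
    proof -
      let ?v = "\<lambda>n. u (n + (h - k)) * cnj (u n)"
      have "(\<lambda>N. (average (\<lambda>n. ?v (n + k)) N - average ?v N) + average ?v N) \<longlonglongrightarrow> 0 + 0"
        using that by (intro tendsto_add average_shift_tendsto corr) (auto simp: norm_mult norm_u)
      then show ?thesis using that by simp
    qed
    consider "h = k" | "k < h" | "h < k" by linarith
    then show ?thesis
    proof cases
      case 1
      have "\<forall>\<^sub>F N in sequentially. average (\<lambda>n. u (n + h) * cnj (u (n + k))) N = 1"
        using eventually_gt_at_top[of 0]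
        by eventually_elim (use 1 in \<open>simp add: average_def norm_u complex_norm_square [symmetric]\<close>)
      then show ?thesis using 1 by (simp add: tendsto_eventually)
    next
      case 3
      have "(\<lambda>N. cnj (average (\<lambda>n. u (n + k) * cnj (u (n + h))) N)) \<longlonglongrightarrow> cnj 0"
        by (intro tendsto_cnj less 3)
      moreover have "(\<lambda>N. cnj (average (\<lambda>n. u (n + k) * cnj (u (n + h))) N)) =
          average (\<lambda>n. u (n + h) * cnj (u (n + k)))"
        by (rule ext) (simp add: average_def mult.commute)
      ultimately show ?thesis using 3 by simp
    qed (use less in auto)
  qed
  have w2: "of_real ((norm (w n))\<^sup>2) =
      (1 / of_nat H ^ 2) * (\<Sum>h<H. \<Sum>k<H. u (n + h) * cnj (u (n + k)))" for n
  proof -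
    define S T where "S = (\<Sum>h<H. u (n + h))" and "T = (\<Sum>k<H. cnj (u (n + k)))"
    have "w n = (1 / of_nat H) * S" "cnj (w n) = (1 / of_nat H) * T"
      by (simp_all add: w_def S_def T_def)
    then have "of_real ((norm (w n))\<^sup>2) = (1 / of_nat H)\<^sup>2 * (S * T)"
      by (subst complex_norm_square) (simp only: power2_eq_square mult.assoc mult.left_commute)
    then have "of_real ((norm (w n))\<^sup>2) = (1 / of_nat H ^ 2) * (S * T)"
      by (simp only: power_one_over)
    then show ?thesis unfolding S_def T_def sum_product .
  qed
  have c: "(1 / of_nat H ^ 2) * (\<Sum>h<H. \<Sum>k<H. (if h = k then 1 else 0)) =
      complex_of_real (1 / real H)"
    using \<open>H > 0\<close> by (simp add: power2_eq_square)
  have av: "average (\<lambda>n. complex_of_real ((norm (w n))\<^sup>2)) =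
      (\<lambda>N. complex_of_real (average (\<lambda>n. (norm (w n))\<^sup>2) N))"
    by (rule ext) (simp add: average_def)
  have "average (\<lambda>n. complex_of_real ((norm (w n))\<^sup>2)) \<longlonglongrightarrow>
      (1 / of_nat H ^ 2) * (\<Sum>h<H. \<Sum>k<H. (if h = k then 1 else 0))"
    unfolding w2 average_cmult average_sum by (intro tendsto_intros corr2)
  then have lim: "average (\<lambda>n. (norm (w n))\<^sup>2) \<longlonglongrightarrow> 1 / real H"
    unfolding c av
    by (simp only: tendsto_of_real_iff)
  have "1 / real H < (e / 2)\<^sup>2"
    using H \<open>H > 0\<close> \<open>e > 0\<close> by (simp add: field_simps power2_eq_square)
  with lim have ev1: "\<forall>\<^sub>F N in sequentially. average (\<lambda>n. (norm (w n))\<^sup>2) N < (e / 2)\<^sup>2"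
    by (rule order_tendstoD)
  have ev2: "\<forall>\<^sub>F N in sequentially. norm (average w N - average u N) < e / 2"
    using tendstoD[OF diff, of "e / 2"] \<open>e > 0\<close> by (simp add: dist_norm)
  have "\<forall>\<^sub>F N in sequentially. norm (average u N - 0) < e"
    using ev1 ev2
  proof eventually_elim
    case (elim N)
    have "(norm (average w N))\<^sup>2 < (e / 2)\<^sup>2"
      using norm_average_square_le elim(1) by (rule le_less_trans)
    then have "norm (average w N) < e / 2"
      using \<open>e > 0\<close> by (rule_tac power_less_imp_less_base) simp_all
    then show ?case
      using elim(2) norm_triangle_ineq4[of "average w N" "average w N - average u N"] by simp
  qed
  then show "\<exists>no. \<forall>n\<ge>no. norm (average u n - 0) < e"
    by (simp add: eventually_sequentially)
qed

text \<open>Differencing cancels the top term, and the binomial theorem gives the next one. Since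
  the new coefficient is a nonzero integer multiple of the old one when h is a positive integer,
  irrationality survives. Bounding the degree instead of fixing it is what suits the induction over
  coefficients.\<close>

lemma coeff_pcompose_shift_diff:
  fixes p :: "'a::idom poly"
  assumes "degree p \<le> Suc n"
  shows "degree (pcompose p [:h, 1:] - p) \<le> n \<and>
    coeff (pcompose p [:h, 1:] - p) n = of_nat (Suc n) * h * coeff p (Suc n)"
  using assms
proof (induction p arbitrary: n)
  case (pCons a q)
  let ?q = "pcompose q [:h, 1:]"
  \<comment> \<open>With p = a + x q: p(x + h) - p(x) = h q(x + h) + x (q(x + h) - q(x)).\<close>
  have eq: "pcompose (pCons a q) [:h, 1:] - pCons a q = smult h ?q + pCons 0 (?q - q)"
    by (simp add: pcompose_pCons algebra_simps)
  have dq: "degree q \<le> n"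
    using pCons(3) by (cases "q = 0") (auto simp: degree_pCons_eq)
  have d1: "degree (smult h ?q) \<le> n"
    using dq degree_smult_le[of h ?q] by (simp add: degree_pcompose)
  have "coeff ?q n = coeff q n \<and> degree (pCons 0 (?q - q)) \<le> n \<and>
       coeff (pCons 0 (?q - q)) n = of_nat n * h * coeff q n"
  proof (cases n)
    case 0
    then obtain c where "q = [:c:]" using dq degree_eq_zeroE by auto
    then show ?thesis using 0 by simp
  next
    case (Suc m)
    have "degree (?q - q) \<le> m" "coeff (?q - q) m = of_nat (Suc m) * h * coeff q (Suc m)"
      using pCons(2)[of m] dq Suc by auto
    moreover from this have "coeff (?q - q) n = 0"
      using Suc by (intro coeff_eq_0) auto
    ultimately show ?thesis
      using Suc by (auto simp: degree_pCons_eq_if)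
  qed
  then show "degree (pcompose (pCons a q) [:h, 1:] - pCons a q) \<le> n \<and>
      coeff (pcompose (pCons a q) [:h, 1:] - pCons a q) n
      = of_nat (Suc n) * h * coeff (pCons a q) (Suc n)"
    using d1 unfolding eq by (auto intro!: degree_add_le simp: algebra_simps)
qed auto

lemma cis_eq_1_imp_int: "cis (2 * pi * x) = 1 \<Longrightarrow> x \<in> \<int>"
proof -
  assume "cis (2 * pi * x) = 1"
  then have "cos (2 * pi * x) = 1" by (metis Re_complex_of_real cis.simps(1) of_real_1)
  then obtain k :: int where "2 * pi * x = real_of_int k * 2 * pi"
    by (auto simp: cos_one_2pi_int)
  then have "x = of_int k" by simp
  then show ?thesis by simp
qed

text \<open>A geometric series with ratio r \<noteq> 1 on the unit circle has partial sums bounded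
  by 2 / |1 - r|.\<close>

lemma average_cis_linear:
  assumes "\<alpha> \<notin> \<int>"
  shows "average (\<lambda>n. cis (2 * pi * (c + \<alpha> * real n))) \<longlonglongrightarrow> 0"
proof (rule Lim_null_comparison)
  define r where "r = cis (2 * pi * \<alpha>)"
  have r1: "r \<noteq> 1" using assms cis_eq_1_imp_int unfolding r_def by blast
  have eq: "cis (2 * pi * (c + \<alpha> * real n)) = cis (2 * pi * c) * r ^ n" for n
    by (simp add: r_def cis_mult Complex.DeMoivre algebra_simps)
  have "norm (\<Sum>n=1..N. cis (2 * pi * (c + \<alpha> * real n))) \<le> 2 / norm (1 - r)" for N
  proof -
    have "(1 - r) * (\<Sum>n=1..N. r ^ n) = r - r ^ Suc N"
    proof (induction N)
      case (Suc N)
      then show ?case by (simp add: distrib_left) (simp add: algebra_simps)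
    qed simp
    moreover have "norm (r - r ^ Suc N) \<le> 2"
      using norm_triangle_ineq4[of r "r ^ Suc N"] by (simp add: r_def norm_power norm_mult)
    ultimately have "norm (1 - r) * norm (\<Sum>n=1..N. r ^ n) \<le> 2"
      by (metis norm_mult)
    then show ?thesis
      using r1 unfolding eq sum_distrib_left[symmetric]
      by (simp add: norm_mult pos_le_divide_eq mult.commute)
  qed
  then show "\<forall>\<^sub>F N in sequentially. norm (average (\<lambda>n. cis (2 * pi * (c + \<alpha> * real n))) N)
      \<le> 2 / norm (1 - r) / real N"
    unfolding average_def norm_divide norm_of_nat
    by (intro always_eventually allI divide_right_mono) auto
  show "(\<lambda>N. 2 / norm (1 - r) / real N) \<longlonglongrightarrow> 0" by real_asymp
qed

text \<open>The lag-h correlation of the exponentials is the exponential of p(x + h) - p(x), of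
  smaller degree and still with irrational top coefficient, so van der Corput's inequality carries
  the induction down to the linear case.\<close>

lemma average_cis_poly:
  fixes f :: "real poly"
  assumes "degree f \<le> Suc d" "coeff f (Suc d) \<notin> \<rat>"
  shows "average (\<lambda>n. cis (2 * pi * poly f (real n))) \<longlonglongrightarrow> 0"
  using assms
proof (induction d arbitrary: f)
  case 0
  obtain a q where q: "f = pCons a q" by (cases f)
  then have "degree q = 0" using 0(1) by (cases "q = 0") (auto simp: degree_pCons_eq)
  then obtain b where f: "f = [:a, b:]" using q by (metis degree_eq_zeroE)
  then have "b \<notin> \<int>" using 0(2) Ints_subset_Rats by auto
  then show ?case using average_cis_linear[of b a] f by (simp add: mult.commute)
next
  case (Suc d)
  show ?case
  proof (rule van_der_Corput)
    fix h :: nat assume "h \<ge> 1"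
    let ?g = "pcompose f [:real h, 1:] - f"
    have g: "degree ?g \<le> Suc d" "coeff ?g (Suc d) = real (Suc (Suc d)) * real h * coeff f (Suc (Suc d))"
      using coeff_pcompose_shift_diff[OF Suc.prems(1), of "real h"] by auto
    have "coeff ?g (Suc d) \<notin> \<rat>"
    proof
      assume "coeff ?g (Suc d) \<in> \<rat>"
      then have "coeff ?g (Suc d) / (real (Suc (Suc d)) * real h) \<in> \<rat>"
        by (intro Rats_divide Rats_mult Rats_of_nat)
      then show False using Suc.prems(2) \<open>h \<ge> 1\<close> unfolding g(2) by simp
    qed
    then have "average (\<lambda>n. cis (2 * pi * poly ?g (real n))) \<longlonglongrightarrow> 0"
      using Suc.IH g(1) by blast
    moreover have "cis (2 * pi * poly ?g (real n)) = cis (2 * pi * poly f (real (n + h))) *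
        cnj (cis (2 * pi * poly f (real n)))" for n
      by (simp add: cis_cnj cis_mult poly_pcompose algebra_simps)
    ultimately show "average (\<lambda>n. cis (2 * pi * poly f (real (n + h))) *
        cnj (cis (2 * pi * poly f (real n)))) \<longlonglongrightarrow> 0" by simp
  qed simp
qed

section \<open>Weyl's criterion by trigonometric approximation\<close>

inductive trig_poly :: "(real \<Rightarrow> complex) \<Rightarrow> bool" where
  monom: "trig_poly (\<lambda>t. c * cis (2 * pi * of_int k * t))"
| add: "trig_poly f \<Longrightarrow> trig_poly g \<Longrightarrow> trig_poly (\<lambda>t. f t + g t)"

lemma trig_poly_const: "trig_poly (\<lambda>_. c)"
  using trig_poly.monom[of c 0] by simp

lemma trig_poly_mult:
  assumes "trig_poly f" "trig_poly g"
  shows "trig_poly (\<lambda>t. f t * g t)"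
  using assms
proof (induction f rule: trig_poly.induct)
  case (monom c k)
  from monom.prems show ?case
  proof (induction g rule: trig_poly.induct)
    case (monom d l)
    have "(\<lambda>t. c * cis (2 * pi * of_int k * t) * (d * cis (2 * pi * of_int l * t))) =
        (\<lambda>t. (c * d) * cis (2 * pi * of_int (k + l) * t))"
      by (rule ext) (simp add: cis_mult[symmetric] distrib_left distrib_right)
    then show ?case using trig_poly.monom[of "c * d" "k + l"] by simp
  next
    case (add f g)
    then show ?case using trig_poly.add by (simp add: distrib_left)
  qed
next
  case (add f g)
  then show ?case using trig_poly.add by (simp add: distrib_right)
qed

text \<open>A real linear form on the plane, restricted to the unit circle, combines cos and sin and
  so has only the frequencies 1 and -1; products and sums do the rest. This converts the
  approximants of Stone-Weierstrass into trigonometric polynomials.\<close>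

lemma trig_poly_real_polynomial:
  assumes "real_polynomial_function g"
  shows "trig_poly (\<lambda>t. of_real (g (cis (2 * pi * t))))"
  using assms
proof (induction g rule: real_polynomial_function.induct)
  case (linear f)
  interpret bounded_linear f by fact
  have "f (cis x) = cos x * f 1 + sin x * f \<i>" for x
  proof -
    have "cis x = cos x *\<^sub>R 1 + sin x *\<^sub>R \<i>" by (simp add: complex_eq_iff)
    then show ?thesis by (metis add scale real_scaleR_def)
  qed
  then have "complex_of_real (f (cis (2 * pi * t))) =
      (of_real (f 1) / 2 + of_real (f \<i>) / (2 * \<i>)) * cis (2 * pi * of_int 1 * t) +
      (of_real (f 1) / 2 - of_real (f \<i>) / (2 * \<i>)) * cis (2 * pi * of_int (-1) * t)" for t
    by (simp add: complex_eq_iff field_simps)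
  then show ?case by (simp only: trig_poly.intros)
qed (auto intro: trig_poly_const trig_poly.add trig_poly_mult)

lemma cis_period_integral:
  assumes "k \<noteq> 0"
  shows "((\<lambda>t. cis (2 * pi * of_int k * t)) has_integral 0) {0..1}"
proof -
  let ?F = "\<lambda>t. cis (2 * pi * of_int k * t) / (\<i> * (2 * pi * of_int k))"
  have "(?F has_vector_derivative cis (2 * pi * of_int k * t)) (at t within {0..1})" for t
    using assms
    by (auto intro!: derivative_eq_intros simp: has_vector_derivative_def has_derivative_cis field_simps scaleR_conv_of_real)
  then have "((\<lambda>t. cis (2 * pi * of_int k * t)) has_integral (?F 1 - ?F 0)) {0..1}"
    by (intro fundamental_theorem_of_calculus) auto
  moreover have "cis (2 * pi * of_int k * 1) = 1"
    using cis_multiple_2pi[of "of_int k"] by (simp add: mult.assoc)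
  ultimately show ?thesis by simp
qed

text \<open>Only the constant term counts: every other frequency has integral 0, and average tending
  to 0 by hypothesis.\<close>

lemma average_trig_poly:
  fixes x :: "nat \<Rightarrow> real"
  assumes weyl: "\<And>k. k \<noteq> 0 \<Longrightarrow> average (\<lambda>n. cis (2 * pi * of_int k * x n)) \<longlonglongrightarrow> 0"
    and "trig_poly f"
  shows "f integrable_on {0..1} \<and> average (\<lambda>n. f (x n)) \<longlonglongrightarrow> integral {0..1} f"
  using assms(2)
proof (induction f rule: trig_poly.induct)
  case (monom c k)
  show ?case
  proof (cases "k = 0")
    case True
    have "\<forall>\<^sub>F N in sequentially. average (\<lambda>n. c) N = c"
      using eventually_gt_at_top[of 0] by eventually_elim (simp add: average_def)
    then show ?thesis
      using True by (simp add: tendsto_eventually integrable_const_ivl)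
  next
    case False
    then have "((\<lambda>t. c * cis (2 * pi * of_int k * t)) has_integral c * 0) {0..1}"
      by (intro has_integral_mult_right cis_period_integral)
    moreover have "average (\<lambda>n. c * cis (2 * pi * of_int k * x n)) \<longlonglongrightarrow> c * 0"
      unfolding average_cmult by (intro tendsto_intros weyl False)
    ultimately show ?thesis by (metis has_integral_integrable integral_unique)
  qed
next
  case (add f g)
  then show ?case
    unfolding average_add by (auto intro: integrable_add tendsto_add simp: integral_add)
qed

lemma average_mono: "(\<And>n. u n \<le> v n) \<Longrightarrow> average u N \<le> (average v N :: real)"
  by (auto simp: average_def intro!: divide_right_mono sum_mono)

text \<open>Only an upper bound is needed here: applied to the complementary arcs it also
  yields the lower bound.\<close>
lemma weyl_upper_bound:
  fixes x :: "nat \<Rightarrow> real"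
  assumes weyl: "\<And>k. k \<noteq> 0 \<Longrightarrow> average (\<lambda>n. cis (2 * pi * of_int k * x n)) \<longlonglongrightarrow> 0"
    and ab: "0 \<le> a" "a \<le> b" "b \<le> 1" and "e > 0"
  shows "\<forall>\<^sub>F N in sequentially. average (\<lambda>n. indicator {a..b} (frac (x n))) N < b - a + e"
proof -
  define A where "A = (\<lambda>t. cis (2 * pi * t)) ` {a..b}"
  have "compact A" "A \<noteq> {}"
    unfolding A_def using ab by (auto intro!: compact_continuous_image continuous_intros)
  then have "closed A" by (simp add: compact_imp_closed)
  \<comment> \<open>A plateau of height 1 on the arc with slopes of steepness m. Measuring the
    distance in the plane, on the circle, builds in periodicity.\<close>
  define g where "g = (\<lambda>m z. max 0 (1 - real m * infdist z A))"
  define G where "G = (\<lambda>m t. g m (cis (2 * pi * t)))"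
  have contG: "continuous_on S (G m)" for m S
    unfolding G_def g_def by (intro continuous_intros)
  have g0: "g m z = 1" if "z \<in> A" for m z using that by (simp add: g_def)
  have g_bounds: "0 \<le> g m z" "g m z \<le> 1" for m z
    by (auto simp: g_def infdist_nonneg)
  \<comment> \<open>The endpoints 0 and 1 are one point of the circle, so an arc touching one of
    them contains the other. Keeping t strictly inside forces |t - s| < 1; hence the open interval
    in the limit below.\<close>
  have in_A: "t \<in> {a..b}" if t: "cis (2 * pi * t) \<in> A" "0 < t" "t < 1" for t
  proof -
    obtain s where s: "s \<in> {a..b}" "cis (2 * pi * t) = cis (2 * pi * s)"
      using t(1) unfolding A_def by blast
    have "cis (2 * pi * (t - s)) = 1"
      using s(2) by (simp add: right_diff_distrib flip: cis_divide)
    then have "t - s \<in> \<int>" by (rule cis_eq_1_imp_int)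
    moreover have "\<bar>t - s\<bar> < 1" using s ab t by auto
    ultimately have "t - s = 0" by (metis Ints_cases of_int_0 of_int_abs of_int_less_1_iff zabs_less_one_iff)
    then show ?thesis using s by simp
  qed
  have ind: "((\<lambda>t. indicator {a..b} t) has_integral (b - a)) {0..1::real}"
  proof -
    have "((\<lambda>t. 1) has_integral (b - a)) {a..b}"
      using has_integral_const_real[of "1::real" a b] ab by simp
    then have "((\<lambda>t. if t \<in> {a..b} then 1 else 0) has_integral (b - a)) {0..1::real}"
      using ab by (subst has_integral_restrict) auto
    then show ?thesis by (simp add: indicator_def of_bool_def)
  qed
  have lim: "(\<lambda>m. integral {0<..<1} (G m)) \<longlonglongrightarrow> integral {0<..<1::real} (indicator {a..b})"
  proof (rule dominated_convergence(2))
    show "G m integrable_on {0<..<1}" for m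
    proof -
      have "G m integrable_on {0..1}" by (rule integrable_continuous_interval[OF contG])
      then show ?thesis by (simp add: integrable_on_Icc_iff_Ioo)
    qed
    show "(\<lambda>_. 1::real) integrable_on {0<..<1::real}"
      using integrable_const_ivl[of "1::real" "0::real" 1] by (simp add: integrable_on_Icc_iff_Ioo)
    show "norm (G m t) \<le> 1" for m t using g_bounds by (simp add: G_def)
    show "(\<lambda>m. G m t) \<longlonglongrightarrow> indicator {a..b} t" if "t \<in> {0<..<1}" for t
    proof (cases "t \<in> {a..b}")
      case True
      then show ?thesis by (simp add: G_def g0 A_def)
    next
      case False
      then have "cis (2 * pi * t) \<notin> A" using in_A that by auto
      then have "infdist (cis (2 * pi * t)) A > 0"
        using \<open>closed A\<close> \<open>A \<noteq> {}\<close> infdist_nonneg in_closed_iff_infdist_zero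
        by (metis less_eq_real_def)
      then have "(\<lambda>m. G m t) \<longlonglongrightarrow> 0"
        unfolding G_def g_def by real_asymp
      then show ?thesis using False by simp
    qed
  qed
  have "integral {0<..<1::real} (indicator {a..b}) = b - a"
    using ind by (metis integral_open_interval_real integral_unique)
  with lim have "\<forall>\<^sub>F m in sequentially. integral {0<..<1} (G m) < b - a + e / 4"
    using \<open>e > 0\<close> by (intro order_tendstoD(2)) auto
  then obtain m where "integral {0<..<1} (G m) < b - a + e / 4"
    by (auto simp: eventually_sequentially)
  then have m: "integral {0..1} (G m) < b - a + e / 4"
    by (metis integral_open_interval_real)
  have "continuous_on (sphere 0 1) (g m)"
    unfolding g_def by (intro continuous_intros)
  then obtain h where h: "real_polynomial_function h"
      "\<And>z. z \<in> sphere 0 1 \<Longrightarrow> \<bar>g m z - h z\<bar> < e / 4"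
    using Stone_Weierstrass_real_polynomial_function[of "sphere 0 1" "g m" "e / 4"] \<open>e > 0\<close> by auto
  define H where "H = (\<lambda>t. h (cis (2 * pi * t)))"
  have GH: "\<bar>G m t - H t\<bar> < e / 4" for t
    unfolding G_def H_def by (rule h(2)) simp
  have "trig_poly (\<lambda>t. of_real (H t))"
    unfolding H_def by (rule trig_poly_real_polynomial) fact
  then have H1: "(\<lambda>t. complex_of_real (H t)) integrable_on {0..1}"
    and H2: "average (\<lambda>n. complex_of_real (H (x n))) \<longlonglongrightarrow> integral {0..1} (\<lambda>t. complex_of_real (H t))"
    using average_trig_poly[OF weyl] by auto
  have contH: "continuous_on {0..1} H"
  proof -
    have "continuous_on UNIV h"
      using h(1) by (simp add: continuous_at_imp_continuous_on continuous_real_polymonial_function)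
    then show ?thesis
      unfolding H_def by (rule continuous_on_compose2) (auto intro!: continuous_intros)
  qed
  then have Hint: "H integrable_on {0..1}" by (rule integrable_continuous_interval)
  then have "((\<lambda>t. complex_of_real (H t)) has_integral of_real (integral {0..1} H)) {0..1}"
    by (intro has_integral_of_real integrable_integral)
  then have intH: "integral {0..1} (\<lambda>t. complex_of_real (H t)) = of_real (integral {0..1} H)"
    by (rule integral_unique)
  have H3: "(\<lambda>N. complex_of_real (average (\<lambda>n. H (x n)) N)) \<longlonglongrightarrow> complex_of_real (integral {0..1} H)"
  proof -
    have "average (\<lambda>n. complex_of_real (H (x n))) = (\<lambda>N. complex_of_real (average (\<lambda>n. H (x n)) N))"
      by (rule ext) (simp add: average_def)
    then show ?thesis using H2 intH by simp
  qed
  then have "(\<lambda>N. average (\<lambda>n. H (x n)) N) \<longlonglongrightarrow> integral {0..1} H"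
    by (simp only: tendsto_of_real_iff)
  moreover have "integral {0..1} H \<le> integral {0..1} (\<lambda>t. G m t + e / 4)"
  proof (rule integral_le[OF Hint])
    show "(\<lambda>t. G m t + e / 4) integrable_on {0..1}"
      by (intro integrable_continuous_interval continuous_intros contG)
    show "H t \<le> G m t + e / 4" for t using GH[of t] by linarith
  qed
  moreover have "integral {0..1} (\<lambda>t. G m t + e / 4) = integral {0..1} (G m) + e / 4"
    by (subst integral_add) (auto intro!: integrable_continuous_interval contG)
  \<comment> \<open>Error budget: e / 4 from the choice of m and e / 4 from H \<le> G + e / 4 stay
    below 3 e / 4; the last e / 4 is spent on bounding the indicator by H.\<close>
  ultimately have "\<forall>\<^sub>F N in sequentially. average (\<lambda>n. H (x n)) N < b - a + 3 * e / 4"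
    using m \<open>e > 0\<close> by (intro order_tendstoD(2)[where y = "integral {0..1} H"]) auto
  then show ?thesis
    using eventually_gt_at_top[of 0]
  proof eventually_elim
    case (elim N)
    have "indicator {a..b} (frac (x n)) \<le> H (x n) + e / 4" for n
    proof -
      have "cis (2 * pi * frac (x n)) = cis (2 * pi * x n)"
        using cis_multiple_2pi[of "of_int \<lfloor>x n\<rfloor>"]
        by (simp add: frac_def right_diff_distrib flip: cis_divide)
      then have "frac (x n) \<in> {a..b} \<Longrightarrow> G m (x n) = 1"
        unfolding G_def by (metis A_def g0 imageI)
      then have "indicator {a..b} (frac (x n)) \<le> G m (x n)"
        using g_bounds(1) by (auto simp: G_def indicator_def)
      then show ?thesis using GH[of "x n"] by linarith
    qed
    then have "average (\<lambda>n. indicator {a..b} (frac (x n))) N \<le> average (\<lambda>n. H (x n) + e / 4) N"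
      by (rule average_mono)
    also have "\<dots> = average (\<lambda>n. H (x n)) N + e / 4"
      unfolding average_add using elim(2) by (simp add: average_def)
    finally show ?case using elim(1) by linarith
  qed
qed

theorem weyl_criterion:
  fixes x :: "nat \<Rightarrow> real"
  assumes weyl: "\<And>k. k \<noteq> 0 \<Longrightarrow> average (\<lambda>n. cis (2 * pi * of_int k * x n)) \<longlonglongrightarrow> 0"
    and ab: "0 \<le> a" "a \<le> b" "b \<le> 1"
  shows "average (\<lambda>n. indicator {a..b} (frac (x n))) \<longlonglongrightarrow> b - a"
proof (rule LIMSEQ_I)
  fix e :: real assume "e > 0"
  let ?I = "\<lambda>a b. average (\<lambda>n. indicator {a..b} (frac (x n)))"
  have "\<forall>\<^sub>F N in sequentially. norm (?I a b N - (b - a)) < e"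
  proof -
    have "\<forall>\<^sub>F N in sequentially. ?I a b N < b - a + e"
      "\<forall>\<^sub>F N in sequentially. ?I 0 a N < a - 0 + e / 2"
      "\<forall>\<^sub>F N in sequentially. ?I b 1 N < 1 - b + e / 2"
      by (intro weyl_upper_bound weyl; use ab \<open>e > 0\<close> in simp)+
    then show ?thesis using eventually_gt_at_top[of 0]
    proof (eventually_elim)
      case (elim N)
      \<comment> \<open>Only an inequality, because neighbouring closed arcs share the endpoints a
        and b.\<close>
      have "1 \<le> indicator {0..a} (frac (x n)) + indicator {a..b} (frac (x n)) +
          (indicator {b..1} (frac (x n)) :: real)" for n
        using frac_ge_0[of "x n"] frac_lt_1[of "x n"] by (auto simp: indicator_def)
      then have "average (\<lambda>n. 1) N \<le> average (\<lambda>n. indicator {0..a} (frac (x n)) +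
          indicator {a..b} (frac (x n)) + indicator {b..1} (frac (x n)) :: real) N"
        by (rule average_mono)
      then have "(1::real) \<le> ?I 0 a N + ?I a b N + ?I b 1 N"
        unfolding average_add using elim by (simp add: average_def)
      then show ?case using elim by (simp add: abs_less_iff)
    qed
  qed
  then show "\<exists>no. \<forall>n\<ge>no. norm (?I a b n - (b - a)) < e"
    by (simp add: eventually_sequentially)
qed

theorem weyl_polynomial_equidistribution:
  fixes f :: "real poly"
  assumes "degree f > 0" "lead_coeff f \<notin> \<rat>" and ab: "0 \<le> a" "a \<le> b" "b \<le> 1"
  shows "(\<lambda>N. real (card {n \<in> {1..N}. frac (poly f (real n)) \<in> {a..b}}) / real N) \<longlonglongrightarrow> b - a"
proof -
  have "average (\<lambda>n. cis (2 * pi * of_int k * poly f (real n))) \<longlonglongrightarrow> 0" if "k \<noteq> 0" for k :: int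
  proof -
    have "of_int k * lead_coeff f \<notin> \<rat>"
    proof
      assume "of_int k * lead_coeff f \<in> \<rat>"
      then have "of_int k * lead_coeff f / of_int k \<in> \<rat>" by (intro Rats_divide Rats_of_int)
      then show False using assms(2) that by simp
    qed
    then have "average (\<lambda>n. cis (2 * pi * poly (smult (of_int k) f) (real n))) \<longlonglongrightarrow> 0"
      using assms(1) that by (intro average_cis_poly[of _ "degree f - 1"]) auto
    then show ?thesis by (simp add: mult.assoc)
  qed
  then have "average (\<lambda>n. indicator {a..b} (frac (poly f (real n)))) \<longlonglongrightarrow> b - a"
    by (intro weyl_criterion ab)
  moreover have "average (\<lambda>n. indicator {a..b} (frac (poly f (real n)))) =
      (\<lambda>N. real (card {n \<in> {1..N}. frac (poly f (real n)) \<in> {a..b}}) / real N)"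
    by (rule ext) (auto simp: average_def indicator_def sum.If_cases Int_def)
  ultimately show ?thesis by simp
qed

lemma poly_map_poly_of_int: "poly (map_poly real_of_int p) (of_int x) = of_int (poly p x)"
  by (induction p) (simp_all add: map_poly_pCons)

section \<open>Lattices and the Weierstrass function\<close>

text \<open>The M-test makes the net of finite partial sums converge uniformly, and uniform limits
  on closed balls preserve holomorphy.\<close>

lemma holomorphic_on_infsum:
  fixes f :: "'a \<Rightarrow> complex \<Rightarrow> complex"
  assumes holo: "\<And>w. w \<in> A \<Longrightarrow> f w holomorphic_on S" and "open S"
    and le: "\<And>w z. w \<in> A \<Longrightarrow> z \<in> S \<Longrightarrow> norm (f w z) \<le> M w" and M: "M summable_on A"
  shows "(\<lambda>z. \<Sum>\<^sub>\<infinity>w\<in>A. f w z) holomorphic_on S"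
proof -
  have lim: "uniform_limit S (\<lambda>X z. \<Sum>w\<in>X. f w z) (\<lambda>z. \<Sum>\<^sub>\<infinity>w\<in>A. f w z) (finite_subsets_at_top A)"
    by (rule Weierstrass_m_test_general[where f = f and X = A and Y = S and M = M, OF le M])
  have hol: "(\<lambda>z. \<Sum>w\<in>X. f w z) holomorphic_on S" if "X \<subseteq> A" for X
    by (rule holomorphic_on_sum) (use that holo in blast)
  have "(\<lambda>z. \<Sum>\<^sub>\<infinity>w\<in>A. f w z) field_differentiable (at z)" if z: "z \<in> S" for z
  proof -
    obtain r where r: "r > 0" "cball z r \<subseteq> S" using \<open>open S\<close> z open_contains_cball by blast
    have ev: "\<forall>\<^sub>F X in finite_subsets_at_top A. continuous_on (cball z r) (\<lambda>z. \<Sum>w\<in>X. f w z) \<and>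
        (\<lambda>z. \<Sum>w\<in>X. f w z) holomorphic_on ball z r"
    proof (rule eventually_finite_subsets_at_top_weakI)
      fix X assume "X \<subseteq> A"
      have "(\<lambda>z. \<Sum>w\<in>X. f w z) holomorphic_on cball z r"
        by (rule holomorphic_on_subset[OF hol[OF \<open>X \<subseteq> A\<close>] r(2)])
      then show "continuous_on (cball z r) (\<lambda>z. \<Sum>w\<in>X. f w z) \<and>
          (\<lambda>z. \<Sum>w\<in>X. f w z) holomorphic_on ball z r"
        by (meson ball_subset_cball holomorphic_on_imp_continuous_on holomorphic_on_subset)
    qed
    have "(\<lambda>z. \<Sum>\<^sub>\<infinity>w\<in>A. f w z) holomorphic_on ball z r"
      by (rule holomorphic_uniform_limit[OF ev uniform_limit_on_subset[OF lim r(2)]]) auto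
    then show ?thesis
      using r(1) by (auto intro: holomorphic_on_imp_differentiable_at)
  qed
  then show ?thesis using \<open>open S\<close>
    by (simp add: holomorphic_on_def field_differentiable_at_within)
qed

section \<open>Geometry of a lattice: discreteness, covering radius, convergence exponent\<close>

locale complex_lattice =
  fixes \<Lambda> :: "complex set"
  assumes lattice: "is_lattice \<Lambda>"
begin

text \<open>The locale fixes only the set \<Lambda>; one basis is chosen once and for all to have
  coordinates for the estimates.\<close>

definition basis :: "complex \<times> complex" where
  "basis = (SOME w. fst w \<noteq> 0 \<and> Im (snd w / fst w) \<noteq> 0 \<and>
     \<Lambda> = {of_int m * fst w + of_int n * snd w | m n. True})"

definition comb :: "int \<times> int \<Rightarrow> complex" where
  "comb = (\<lambda>(m, n). of_int m * fst basis + of_int n * snd basis)"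

lemma basis: "fst basis \<noteq> 0" "Im (snd basis / fst basis) \<noteq> 0"
  and mem_iff: "w \<in> \<Lambda> \<longleftrightarrow> (\<exists>m n. w = comb (m, n))"
proof -
  have "\<exists>w. fst w \<noteq> 0 \<and> Im (snd w / fst w) \<noteq> 0 \<and>
     \<Lambda> = {of_int m * fst w + of_int n * snd w | m n. True}"
  proof -
    from lattice obtain w1 w2 where "w1 \<noteq> 0" "Im (w2 / w1) \<noteq> 0"
      "\<Lambda> = {of_int m * w1 + of_int n * w2 | m n. True}"
      unfolding is_lattice_def by blast
    then show ?thesis by (intro exI[of _ "(w1, w2)"]) simp
  qed
  then have "fst basis \<noteq> 0 \<and> Im (snd basis / fst basis) \<noteq> 0 \<and>
     \<Lambda> = {of_int m * fst basis + of_int n * snd basis | m n. True}"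
    unfolding basis_def by (rule someI_ex)
  then show "fst basis \<noteq> 0" "Im (snd basis / fst basis) \<noteq> 0"
    and "w \<in> \<Lambda> \<longleftrightarrow> (\<exists>m n. w = comb (m, n))" for w
    by (auto simp: comb_def)
qed

lemma range_comb: "range comb = \<Lambda>"
proof (rule Set.set_eqI)
  show "w \<in> range comb \<longleftrightarrow> w \<in> \<Lambda>" for w
    using mem_iff[of w] by (auto simp: image_iff)
qed

lemma comb_add: "comb (m + m', n + n') = comb (m, n) + comb (m', n')"
  by (simp add: comb_def algebra_simps)

lemma comb_minus: "comb (- m, - n) = - comb (m, n)"
  by (simp add: comb_def)

lemma zero_mem [simp]: "0 \<in> \<Lambda>"
  unfolding mem_iff by (rule exI[of _ 0], rule exI[of _ 0]) (simp add: comb_def)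

lemma add_mem: "v \<in> \<Lambda> \<Longrightarrow> w \<in> \<Lambda> \<Longrightarrow> v + w \<in> \<Lambda>"
  unfolding mem_iff by (metis comb_add)

lemma minus_mem: "w \<in> \<Lambda> \<Longrightarrow> - w \<in> \<Lambda>"
  unfolding mem_iff by (metis comb_minus)

lemma minus_mem_iff [simp]: "- w \<in> \<Lambda> \<longleftrightarrow> w \<in> \<Lambda>"
  using minus_mem[of w] minus_mem[of "- w"] by auto

lemma diff_mem: "v \<in> \<Lambda> \<Longrightarrow> w \<in> \<Lambda> \<Longrightarrow> v - w \<in> \<Lambda>"
  using add_mem[of v "- w"] by simp

lemma add_mem_iff: "w \<in> \<Lambda> \<Longrightarrow> z + w \<in> \<Lambda> \<longleftrightarrow> z \<in> \<Lambda>"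
  using add_mem[of z w] diff_mem[of "z + w" w] by auto

lemma of_int_mult_mem: "w \<in> \<Lambda> \<Longrightarrow> of_int k * w \<in> \<Lambda>"
proof (induction k rule: int_induct[of _ 0])
  case (step1 i)
  then show ?case using add_mem[of "of_int i * w" w] by (simp add: distrib_right)
next
  case (step2 i)
  then show ?case using diff_mem[of "of_int i * w" w] by (simp add: left_diff_distrib)
qed simp

text \<open>After division by the first basis vector the imaginary part controls n, and then the
  triangle inequality controls m. Unique coordinates, discreteness and the convergence of the
  lattice sums all come from this bound.\<close>

lemma comb_lower_bound:
  "\<exists>c>0. \<forall>m n. c * real_of_int (max \<bar>m\<bar> \<bar>n\<bar>) \<le> norm (comb (m, n))"
proof -
  define \<tau> where "\<tau> = snd basis / fst basis"
  have \<tau>: "Im \<tau> \<noteq> 0" using basis(2) by (simp add: \<tau>_def)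
  define b where "b = \<bar>Im \<tau>\<bar>"
  \<comment> \<open>From |m| \<le> |t| + |n| |\<tau>| and |n| \<le> |t| / b it follows that |m|
    \<le> k |t|.\<close>
  define k where "k = 1 + norm \<tau> / b"
  define c where "c = norm (fst basis) * min b (1 / k)"
  have "b > 0" using \<tau> by (simp add: b_def)
  then have "k \<ge> 1" by (simp add: k_def)
  then have "c > 0" using \<open>b > 0\<close> basis(1) by (simp add: c_def)
  moreover have "c * real_of_int (max \<bar>m\<bar> \<bar>n\<bar>) \<le> norm (comb (m, n))" for m n
  proof -
    define t where "t = of_int m + of_int n * \<tau>"
    have comb: "comb (m, n) = fst basis * t"
      using basis(1) by (simp add: comb_def t_def \<tau>_def field_simps)
    have "\<bar>Im t\<bar> = \<bar>real_of_int n\<bar> * b" by (simp add: t_def b_def abs_mult)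
    then have n: "b * \<bar>real_of_int n\<bar> \<le> norm t" using abs_Im_le_cmod[of t] by (simp add: mult.commute)
    have "\<bar>real_of_int m\<bar> = norm (t - of_int n * \<tau>)" by (simp add: t_def)
    also have "\<dots> \<le> norm t + \<bar>real_of_int n\<bar> * norm \<tau>"
      using norm_triangle_ineq4[of t "of_int n * \<tau>"] by (simp add: norm_mult)
    also have "\<bar>real_of_int n\<bar> \<le> norm t / b" using n \<open>b > 0\<close> by (simp add: field_simps)
    finally have "\<bar>real_of_int m\<bar> \<le> norm t + norm t / b * norm \<tau>"
      by (simp add: mult_right_mono)
    then have "\<bar>real_of_int m\<bar> \<le> k * norm t" by (simp add: k_def algebra_simps)
    then have m: "1 / k * \<bar>real_of_int m\<bar> \<le> norm t" using \<open>k \<ge> 1\<close> by (simp add: field_simps)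
    have "min b (1 / k) * \<bar>real_of_int m\<bar> \<le> norm t"
      using m by (meson abs_ge_zero min.cobounded2 mult_right_mono order_trans)
    moreover have "min b (1 / k) * \<bar>real_of_int n\<bar> \<le> norm t"
      using n by (meson abs_ge_zero min.cobounded1 mult_right_mono order_trans)
    ultimately have "min b (1 / k) * real_of_int (max \<bar>m\<bar> \<bar>n\<bar>) \<le> norm t"
      by (auto simp: max_def)
    then have "norm (fst basis) * (min b (1 / k) * real_of_int (max \<bar>m\<bar> \<bar>n\<bar>)) \<le> norm (fst basis) * norm t"
      by (rule mult_left_mono) simp
    then show ?thesis
      unfolding comb by (simp only: c_def norm_mult mult.assoc)
  qed
  ultimately show ?thesis by blast
qed

lemma inj_comb: "inj comb"
proof (rule injI)
  fix p q assume "comb p = comb q"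
  obtain m n m' n' where pq: "p = (m, n)" "q = (m', n')" by (cases p, cases q)
  obtain c where c: "c > 0" "\<And>m n. c * real_of_int (max \<bar>m\<bar> \<bar>n\<bar>) \<le> norm (comb (m, n))"
    using comb_lower_bound by blast
  have "comb (m - m', n - n') = 0"
    using \<open>comb p = comb q\<close> pq by (simp add: comb_def algebra_simps)
  then have "c * real_of_int (max \<bar>m - m'\<bar> \<bar>n - n'\<bar>) \<le> 0" using c(2) by (metis norm_zero)
  then have "max \<bar>m - m'\<bar> \<bar>n - n'\<bar> \<le> 0" using c(1) by (simp add: mult_le_0_iff)
  then show "p = q" using pq by auto
qed

lemma finite_inter_cball: "finite (\<Lambda> \<inter> cball 0 R)"
proof -
  obtain c where c: "c > 0" "\<And>m n. c * real_of_int (max \<bar>m\<bar> \<bar>n\<bar>) \<le> norm (comb (m, n))"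
    using comb_lower_bound by blast
  define k where "k = \<lfloor>R / c\<rfloor>"
  have "\<Lambda> \<inter> cball 0 R \<subseteq> comb ` ({-k..k} \<times> {-k..k})"
  proof
    fix w assume w: "w \<in> \<Lambda> \<inter> cball 0 R"
    then obtain m n where mn: "w = comb (m, n)" using mem_iff by blast
    have "c * real_of_int (max \<bar>m\<bar> \<bar>n\<bar>) \<le> R" using c(2)[of m n] w mn by simp
    then have "max \<bar>m\<bar> \<bar>n\<bar> \<le> k"
      using c(1) unfolding k_def by (simp add: le_floor_iff field_simps del: of_int_max)
    then show "w \<in> comb ` ({-k..k} \<times> {-k..k})"
      unfolding mn by (intro imageI) auto
  qed
  then show ?thesis by (rule finite_subset) simp
qed

lemma countable_lattice: "countable \<Lambda>"
  using range_comb by (metis countable_image countableI_type)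

lemma not_islimpt: "\<not> v islimpt \<Lambda>"
proof
  assume "v islimpt \<Lambda>"
  then have "infinite (ball 0 (norm v + 1) \<inter> \<Lambda>)"
    unfolding islimpt_eq_acc_point by simp
  moreover have "ball 0 (norm v + 1) \<inter> \<Lambda> \<subseteq> \<Lambda> \<inter> cball 0 (norm v + 1)" by auto
  ultimately show False using finite_inter_cball finite_subset by blast
qed

lemma closed_lattice: "closed \<Lambda>"
  using not_islimpt by (simp add: closed_limpt)

lemma eventually_not_lattice: "\<forall>\<^sub>F z in at v. z \<notin> \<Lambda>"
  using not_islimpt by (simp add: islimpt_iff_eventually)

lemma open_compl: "open (- \<Lambda>)"
  using closed_lattice by (simp add: open_Compl)

text \<open>The factor 2 is there so that |z| < r gives |z - w| \<ge> |w| / 2 for every nonzero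
  lattice point w.\<close>

lemma isolated: "\<exists>r>0. \<forall>w\<in>\<Lambda> - {0}. 2 * r \<le> norm w"
proof -
  have "finite (\<Lambda> \<inter> cball 0 1 - {0})" using finite_inter_cball by simp
  then obtain d where d: "d > 0" "\<And>w. w \<in> \<Lambda> \<inter> cball 0 1 - {0} \<Longrightarrow> d \<le> dist 0 w"
    using finite_set_avoid[of "\<Lambda> \<inter> cball 0 1 - {0}" 0] by auto
  have "\<forall>w\<in>\<Lambda> - {0}. 2 * (min d 1 / 2) \<le> norm w"
  proof
    fix w assume "w \<in> \<Lambda> - {0}"
    then show "2 * (min d 1 / 2) \<le> norm w" using d(2)[of w] by (cases "norm w \<le> 1") auto
  qed
  moreover have "min d 1 / 2 > 0" using d(1) by simp
  ultimately show ?thesis by blast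
qed

text \<open>Rounding down the two real coordinates of z leaves a remainder in the fundamental
  parallelogram. A periodic function therefore takes all its values on one compact ball.\<close>

lemma cobounded: "\<exists>B. \<forall>z. \<exists>w\<in>\<Lambda>. norm (z - w) \<le> B"
proof (intro exI allI)
  fix z
  define \<tau> where "\<tau> = snd basis / fst basis"
  have \<tau>: "Im \<tau> \<noteq> 0" using basis(2) by (simp add: \<tau>_def)
  define t where "t = Im (z / fst basis) / Im \<tau>"
  define s where "s = Re (z / fst basis) - t * Re \<tau>"
  have "z / fst basis = of_real s + of_real t * \<tau>"
    using \<tau> by (simp add: complex_eq_iff s_def t_def)
  then have z: "z = of_real s * fst basis + of_real t * snd basis"
    using basis(1) by (simp add: \<tau>_def field_simps)
  have "norm (z - comb (\<lfloor>s\<rfloor>, \<lfloor>t\<rfloor>)) = norm (of_real (frac s) * fst basis + of_real (frac t) * snd basis)"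
    unfolding z comb_def frac_def by (simp add: algebra_simps)
  also have "\<dots> \<le> norm (fst basis) + norm (snd basis)"
    using frac_lt_1[of s] frac_lt_1[of t] frac_ge_0[of s] frac_ge_0[of t]
    by (intro order_trans[OF norm_triangle_ineq] add_mono) (auto simp: norm_mult mult_left_le_one_le)
  finally show "\<exists>w\<in>\<Lambda>. norm (z - w) \<le> norm (fst basis) + norm (snd basis)"
    by (rule bexI) (auto simp: mem_iff)
qed

text \<open>The cube is shared between the coordinates: with M = max(|m|, |n|), M^(-3) is the
  product of two factors M^(-3/2), each bounded by a one-variable term of exponent 3/2 > 1. So the
  double series is dominated by a product of convergent series.\<close>

lemma summable_inverse_cube: "(\<lambda>w. 1 / norm w ^ 3) summable_on (\<Lambda> - {0})"
proof -
  obtain c where c: "c > 0" "\<And>m n. c * real_of_int (max \<bar>m\<bar> \<bar>n\<bar>) \<le> norm (comb (m, n))"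
    using comb_lower_bound by blast
  \<comment> \<open>The summand 1 keeps the base positive at k = 0, and 1 + |k| \<le> 2 M away from
    the origin; the factor 2 returns as 8 = 2^3.\<close>
  define a where "a = (\<lambda>k::int. (1 + \<bar>real_of_int k\<bar>) powr (- 3 / 2))"
  have nat: "(\<lambda>n. a (int n)) summable_on UNIV"
  proof -
    have "summable (\<lambda>n. real (Suc n) powr (- 3 / 2))"
      by (subst summable_Suc_iff) (simp add: summable_real_powr_iff)
    then show ?thesis
      by (intro summable_nonneg_imp_summable_on) (simp_all add: a_def)
  qed
  have 1: "a summable_on range int"
    using nat by (subst summable_on_reindex) (auto simp: o_def)
  have 2: "a summable_on range (\<lambda>n. - int n)"
    using nat by (subst summable_on_reindex) (auto simp: o_def a_def inj_on_def)
  have "range int \<union> range (\<lambda>n. - int n) = UNIV"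
    by (auto simp: image_iff) (metis int_cases2)
  then have a: "a summable_on UNIV"
    using summable_on_union[OF 1 2] by simp
  have "(\<lambda>(m, n). a m * a n) summable_on (UNIV \<times> UNIV)"
  proof (rule summable_on_SigmaI)
    show "((\<lambda>n. case (m, n) of (m, n) \<Rightarrow> a m * a n) has_sum a m * infsum a UNIV) UNIV" for m
      using a by (auto intro!: has_sum_cmult_right has_sum_infsum)
    show "(\<lambda>m. a m * infsum a UNIV) summable_on UNIV"
      by (rule summable_on_cmult_left[OF a])
  qed (auto simp: a_def)
  then have "(\<lambda>(m, n). a m * a n) summable_on (UNIV - {(0, 0)})"
    by (rule summable_on_subset_banach) auto
  then have "(\<lambda>p. 8 / c ^ 3 * (case p of (m, n) \<Rightarrow> a m * a n)) summable_on (UNIV - {(0, 0)})"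
    by (rule summable_on_cmult_right)
  then have "(\<lambda>p. 1 / norm (comb p) ^ 3) summable_on (UNIV - {(0, 0)})"
  proof (rule summable_on_comparison_test)
    fix p :: "int \<times> int" assume p: "p \<in> UNIV - {(0, 0)}"
    obtain m n where mn: "p = (m, n)" by (cases p)
    define M where "M = real_of_int (max \<bar>m\<bar> \<bar>n\<bar>)"
    have "max \<bar>m\<bar> \<bar>n\<bar> \<ge> 1" using p mn by auto
    then have M: "M \<ge> 1" unfolding M_def by linarith
    have am: "(2 * M) powr (- 3 / 2) \<le> a k" if "\<bar>k\<bar> \<le> max \<bar>m\<bar> \<bar>n\<bar>" for k
    proof -
      have "\<bar>real_of_int k\<bar> \<le> M" unfolding M_def using that by linarith
      then show ?thesis unfolding a_def using M by (intro powr_mono2') auto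
    qed
    have cM: "0 < (c * M) ^ 3" using c(1) M by simp
    have le: "(c * M) ^ 3 \<le> norm (comb p) ^ 3"
      using c M unfolding M_def mn by (intro power_mono) auto
    then have "1 / norm (comb p) ^ 3 \<le> 1 / (c * M) ^ 3"
      using cM by (intro divide_left_mono mult_pos_pos less_le_trans[OF cM le]) auto
    also have "\<dots> = 8 / c ^ 3 * ((2 * M) powr (- 3 / 2) * (2 * M) powr (- 3 / 2))"
    proof -
      have "(2 * M) powr (- 3 / 2) * (2 * M) powr (- 3 / 2) = (2 * M) powr (- real 3)"
        by (simp flip: powr_add)
      also have "\<dots> = 1 / (2 * M) powr real 3" by (rule powr_minus_divide)
      also have "(2 * M) powr real 3 = (2 * M) ^ 3" using M by (intro powr_realpow) simp
      finally have e: "(2 * M) powr (- 3 / 2) * (2 * M) powr (- 3 / 2) = 1 / (2 * M) ^ 3" .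
      show ?thesis unfolding e power_mult_distrib by simp
    qed
    also have "\<dots> \<le> 8 / c ^ 3 * (a m * a n)"
      using c(1) by (intro mult_left_mono mult_mono am) (auto simp: a_def)
    finally show "1 / norm (comb p) ^ 3 \<le> 8 / c ^ 3 * (case p of (m, n) \<Rightarrow> a m * a n)"
      by (simp add: mn)
  qed auto
  then have "(\<lambda>w. 1 / norm w ^ 3) summable_on comb ` (UNIV - {(0, 0)})"
    using inj_comb by (subst summable_on_reindex) (auto simp: o_def inj_on_def)
  moreover have "comb ` (UNIV - {(0, 0)}) = \<Lambda> - {0}"
    unfolding image_set_diff[OF inj_comb] range_comb by (simp add: comb_def)
  ultimately show ?thesis by simp
qed

section \<open>The Weierstrass series: convergence, parity, periodicity, holomorphy\<close>

abbreviation wp_term :: "complex \<Rightarrow> complex \<Rightarrow> complex" where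
  "wp_term z w \<equiv> 1 / (z - w)\<^sup>2 - 1 / w\<^sup>2"

text \<open>Subtracting 1 / w^2 gains one power of w: the difference is z (2 w - z) / (w^2 (z -
  w)^2). Here |2 w - z| \<le> 5/2 |w| and |z - w| \<ge> |w| / 2, whence 10 = 5/2 * 4.\<close>

lemma norm_wp_term_le:
  assumes "w \<noteq> 0" "2 * R \<le> norm w" "norm z < R"
  shows "norm (wp_term z w) \<le> 10 * R * (1 / norm w ^ 3)"
proof -
  have zw: "norm w / 2 \<le> norm (z - w)"
    using assms norm_triangle_ineq2[of w z] by (simp add: norm_minus_commute)
  then have "z \<noteq> w" using assms(1) by auto
  have 2: "norm (2 * w - z) \<le> 5 / 2 * norm w"
    using norm_triangle_ineq4[of "2 * w" z] assms by (simp add: norm_mult)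
  have "wp_term z w = z * (2 * w - z) / (w\<^sup>2 * (z - w)\<^sup>2)"
    using \<open>z \<noteq> w\<close> assms(1) by (simp add: divide_simps) (simp add: algebra_simps power2_eq_square)
  then have "norm (wp_term z w) = norm z * norm (2 * w - z) / ((norm w)\<^sup>2 * (norm (z - w))\<^sup>2)"
    by (simp add: norm_mult norm_divide norm_power)
  also have "\<dots> \<le> R * (5 / 2 * norm w) / ((norm w)\<^sup>2 * (norm w / 2)\<^sup>2)"
    using assms zw 2 le_less_trans[OF norm_ge_zero assms(3)]
    by (intro frac_le mult_mono mult_nonneg_nonneg mult_pos_pos power_mono) auto
  also have "\<dots> = 10 * R * (1 / norm w ^ 3)"
    using assms(1) by (simp add: field_simps power2_eq_square power3_eq_cube)
  finally show ?thesis .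
qed

lemma near_finite: "finite {w \<in> \<Lambda> - {0}. norm w < r}"
  by (rule finite_subset[OF _ finite_inter_cball[of r]]) auto

lemma far_summable: "(\<lambda>w. C * (1 / norm w ^ 3)) summable_on {w \<in> \<Lambda> - {0}. r \<le> norm w}"
  by (intro summable_on_cmult_right summable_on_subset_banach[OF summable_inverse_cube]) auto

lemma wp_term_summable: "wp_term z summable_on (\<Lambda> - {0})"
proof -
  define R where "R = norm z + 1"
  have "(\<lambda>w. norm (wp_term z w)) summable_on {w \<in> \<Lambda> - {0}. 2 * R \<le> norm w}"
    by (rule Infinite_Sum.abs_summable_on_comparison_test'[OF far_summable[of "10 * R"]])
       (rule norm_wp_term_le; simp add: R_def)
  then have 1: "wp_term z summable_on {w \<in> \<Lambda> - {0}. 2 * R \<le> norm w}"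
    by (rule abs_summable_summable)
  have 2: "wp_term z summable_on {w \<in> \<Lambda> - {0}. norm w < 2 * R}"
    by (intro summable_on_finite near_finite)
  have "{w \<in> \<Lambda> - {0}. 2 * R \<le> norm w} \<union> {w \<in> \<Lambda> - {0}. norm w < 2 * R} = \<Lambda> - {0}" by auto
  then show ?thesis using summable_on_union[OF 1 2] by simp
qed

text \<open>With \<open>1 / 0 = 0\<close>, the principal part \<open>1 / z\<^sup>2\<close> is the summand for \<open>w = 0\<close>.\<close>
lemma wp_term_summable_all: "wp_term z summable_on \<Lambda>"
  using wp_term_summable[of z] summable_on_insert_iff[of "wp_term z" 0 "\<Lambda> - {0}"]
  by (simp add: insert_absorb)

lemma wp_eq_infsum: "wp \<Lambda> z = (\<Sum>\<^sub>\<infinity>w\<in>\<Lambda>. wp_term z w)"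
proof -
  have "(\<Sum>\<^sub>\<infinity>w\<in>insert 0 (\<Lambda> - {0}). wp_term z w) = wp_term z 0 + (\<Sum>\<^sub>\<infinity>w\<in>\<Lambda> - {0}. wp_term z w)"
    by (rule infsum_insert) (use wp_term_summable in auto)
  then show ?thesis by (simp add: wp_def insert_absorb)
qed

lemma bij_minus: "bij_betw uminus \<Lambda> \<Lambda>"
  by (rule bij_betwI[of _ _ _ uminus]) auto

lemma bij_minus_nonzero: "bij_betw uminus (\<Lambda> - {0}) (\<Lambda> - {0})"
  by (rule bij_betwI[of _ _ _ uminus]) auto

lemma wp_minus: "wp \<Lambda> (- z) = wp \<Lambda> z"
proof -
  have "(- z + w)\<^sup>2 = (z - w)\<^sup>2" for w by (simp add: power2_commute)
  then have "wp \<Lambda> z = (\<Sum>\<^sub>\<infinity>w\<in>\<Lambda>. wp_term (- z) (- w))"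
    unfolding wp_eq_infsum by simp
  also have "\<dots> = wp \<Lambda> (- z)"
    unfolding wp_eq_infsum by (rule infsum_reindex_bij_betw[OF bij_minus])
  finally show ?thesis by simp
qed

text \<open>In a difference of two values the corrections 1 / w^2 cancel. What remains is a sum over
  all of \<Lambda> of a function of z - w and c - w, which a translation of the summation index
  absorbs.\<close>

lemma wp_diff_shift:
  assumes "v \<in> \<Lambda>"
  shows "wp \<Lambda> (z + v) - wp \<Lambda> (c + v) = wp \<Lambda> z - wp \<Lambda> c"
proof -
  have diff: "wp \<Lambda> z - wp \<Lambda> c = (\<Sum>\<^sub>\<infinity>w\<in>\<Lambda>. 1 / (z - w)\<^sup>2 - 1 / (c - w)\<^sup>2)" for z c
  proof -
    have "wp \<Lambda> z - wp \<Lambda> c = (\<Sum>\<^sub>\<infinity>w\<in>\<Lambda>. wp_term z w - wp_term c w)"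
    proof -
      have "((\<lambda>w. - wp_term c w) has_sum - infsum (wp_term c) \<Lambda>) \<Lambda>"
        unfolding has_sum_uminus using wp_term_summable_all by simp
      then have "((\<lambda>w. wp_term z w + - wp_term c w) has_sum
          (infsum (wp_term z) \<Lambda> + - infsum (wp_term c) \<Lambda>)) \<Lambda>"
        by (intro has_sum_add has_sum_infsum wp_term_summable_all)
      then show ?thesis unfolding wp_eq_infsum by (simp add: infsumI)
    qed
    then show ?thesis by simp
  qed
  have "bij_betw (\<lambda>w. w - v) \<Lambda> \<Lambda>"
    by (rule bij_betwI[of _ _ _ "\<lambda>w. w + v"]) (use assms add_mem diff_mem in auto)
  then have "(\<Sum>\<^sub>\<infinity>w\<in>\<Lambda>. 1 / (z - (w - v))\<^sup>2 - 1 / (c - (w - v))\<^sup>2) =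
      (\<Sum>\<^sub>\<infinity>w\<in>\<Lambda>. 1 / (z - w)\<^sup>2 - 1 / (c - w)\<^sup>2)"
    by (rule infsum_reindex_bij_betw)
  then show ?thesis unfolding diff by (simp add: algebra_simps)
qed

text \<open>The increment \<open>\<wp>(z + v) - \<wp>(z)\<close> does not depend on \<open>z\<close>; comparing \<open>z = 0\<close> with
  \<open>z = -v\<close>, evenness shows that it vanishes.\<close>
lemma wp_periodic:
  assumes "v \<in> \<Lambda>"
  shows "wp \<Lambda> (z + v) = wp \<Lambda> z"
  using wp_diff_shift[OF assms, of 0 "- v"] wp_diff_shift[OF assms, of z 0] wp_minus[of v] by simp

lemma deriv_wp_periodic:
  assumes "v \<in> \<Lambda>"
  shows "deriv (wp \<Lambda>) (z + v) = deriv (wp \<Lambda>) z"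
proof -
  have "(\<lambda>z. wp \<Lambda> (z + v)) = wp \<Lambda>" using wp_periodic[OF assms] by auto
  then show ?thesis unfolding deriv_def DERIV_shift by simp
qed

text \<open>In a ball of radius R only the finitely many terms with |w| < 2 R can have poles; beyond
  that radius the cubic bound is uniform in z.\<close>

lemma wp_decomp:
  assumes "R > 0"
  obtains F h where "finite F" "F \<subseteq> \<Lambda> - {0}" "h holomorphic_on ball 0 R"
    "\<And>z. wp \<Lambda> z = 1 / z\<^sup>2 + (\<Sum>w\<in>F. wp_term z w) + h z"
proof -
  let ?F = "{w \<in> \<Lambda> - {0}. norm w < 2 * R}" and ?A = "{w \<in> \<Lambda> - {0}. 2 * R \<le> norm w}"
  define h where "h = (\<lambda>z. \<Sum>\<^sub>\<infinity>w\<in>?A. wp_term z w)"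
  have "h holomorphic_on ball 0 R"
    unfolding h_def
  proof (rule holomorphic_on_infsum)
    show "(\<lambda>z. wp_term z w) holomorphic_on ball 0 R" if "w \<in> ?A" for w
      using that assms by (intro holomorphic_intros) auto
    show "norm (wp_term z w) \<le> 10 * R * (1 / norm w ^ 3)" if "w \<in> ?A" "z \<in> ball 0 R" for w z
      using that by (intro norm_wp_term_le) auto
    show "(\<lambda>w. 10 * R * (1 / norm w ^ 3)) summable_on ?A" by (rule far_summable)
  qed auto
  moreover have "wp \<Lambda> z = 1 / z\<^sup>2 + (\<Sum>w\<in>?F. wp_term z w) + h z" for z
  proof -
    have "(\<Sum>\<^sub>\<infinity>w\<in>?F \<union> ?A. wp_term z w) = (\<Sum>\<^sub>\<infinity>w\<in>?F. wp_term z w) + (\<Sum>\<^sub>\<infinity>w\<in>?A. wp_term z w)"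
      by (rule infsum_Un_disjoint)
         (auto intro!: summable_on_finite near_finite summable_on_subset_banach[OF wp_term_summable])
    moreover have "?F \<union> ?A = \<Lambda> - {0}" by auto
    ultimately show ?thesis
      using near_finite[of "2 * R"] by (simp add: wp_def h_def)
  qed
  ultimately show ?thesis using that[of ?F h] near_finite by blast
qed

lemma wp_holomorphic: "wp \<Lambda> holomorphic_on - \<Lambda>"
proof -
  have "wp \<Lambda> field_differentiable (at z)" if z: "z \<notin> \<Lambda>" for z
  proof -
    obtain F h where Fh: "finite F" "F \<subseteq> \<Lambda> - {0}" "h holomorphic_on ball 0 (norm z + 1)"
      "\<And>z. wp \<Lambda> z = 1 / z\<^sup>2 + (\<Sum>w\<in>F. wp_term z w) + h z"
      by (rule wp_decomp[of "norm z + 1"]) (auto simp: add_nonneg_pos)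
    let ?S = "ball 0 (norm z + 1) - \<Lambda>"
    have "(\<lambda>z. 1 / z\<^sup>2 + (\<Sum>w\<in>F. wp_term z w) + h z) holomorphic_on ?S"
      using Fh(1,2) by (intro holomorphic_intros holomorphic_on_subset[OF Fh(3)]) auto
    then have "wp \<Lambda> holomorphic_on ?S" unfolding Fh(4)[symmetric] .
    moreover have "open ?S" using closed_lattice by (intro open_Diff) auto
    ultimately show ?thesis using z by (auto intro: holomorphic_on_imp_differentiable_at)
  qed
  then show ?thesis
    by (auto simp: holomorphic_on_def intro: field_differentiable_at_within)
qed

lemma wp_has_deriv:
  "z \<notin> \<Lambda> \<Longrightarrow> (wp \<Lambda> has_field_derivative deriv (wp \<Lambda>) z) (at z)"
  using wp_holomorphic open_compl by (intro holomorphic_derivI[of _ "- \<Lambda>"]) auto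

lemma deriv_wp_minus:
  assumes "z \<notin> \<Lambda>"
  shows "deriv (wp \<Lambda>) (- z) = - deriv (wp \<Lambda>) z"
proof -
  have "((\<lambda>x. wp \<Lambda> (- x)) has_field_derivative deriv (wp \<Lambda>) (- z) * - 1) (at z)"
    using assms by (intro DERIV_chain2[where g = uminus] wp_has_deriv) (auto intro!: derivative_eq_intros)
  then show ?thesis
    using wp_has_deriv[OF assms] DERIV_unique by (fastforce simp: wp_minus)
qed

section \<open>Expansion at the origin and the differential equations\<close>

lemma summable_inverse_power:
  assumes "k \<ge> 3"
  shows "(\<lambda>w. 1 / w ^ k) summable_on (\<Lambda> - {0})"
proof -
  obtain r where r: "r > 0" "\<And>w. w \<in> \<Lambda> - {0} \<Longrightarrow> 2 * r \<le> norm w" using isolated by blast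
  have "(\<lambda>w. norm (1 / w ^ k)) summable_on (\<Lambda> - {0})"
  proof (rule Infinite_Sum.abs_summable_on_comparison_test'[OF summable_on_cmult_right[OF summable_inverse_cube, of "1 / (2 * r) ^ (k - 3)"]])
    fix w assume w: "w \<in> \<Lambda> - {0}"
    have "norm w ^ 3 * (2 * r) ^ (k - 3) \<le> norm w ^ 3 * norm w ^ (k - 3)"
      using r w by (intro mult_left_mono power_mono) auto
    also have "\<dots> = norm w ^ k" using assms by (simp flip: power_add)
    finally show "norm (1 / w ^ k) \<le> 1 / (2 * r) ^ (k - 3) * (1 / norm w ^ 3)"
      using r(1) w by (auto simp: norm_divide norm_power mult.commute intro!: divide_left_mono)
  qed
  then show ?thesis by (rule abs_summable_summable)
qed

text \<open>The Eisenstein sums; the invariants are 60 \<open>G 4\<close> and 140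
  \<open>G 6\<close>.\<close>

definition G :: "nat \<Rightarrow> complex" where
  "G k = (\<Sum>\<^sub>\<infinity>w\<in>\<Lambda> - {0}. 1 / w ^ k)"

lemma G_odd:
  assumes "odd k"
  shows "G k = 0"
proof -
  have "G k = (\<Sum>\<^sub>\<infinity>w\<in>\<Lambda> - {0}. 1 / (- w) ^ k)"
    unfolding G_def by (rule infsum_reindex_bij_betw[OF bij_minus_nonzero, symmetric])
  also have "\<dots> = (\<Sum>\<^sub>\<infinity>w\<in>\<Lambda> - {0}. - (1 / w ^ k))"
    using assms by (simp add: power_minus_odd)
  also have "\<dots> = - G k" unfolding G_def by (rule infsum_uminus)
  finally show ?thesis by simp
qed

text \<open>Each term is expanded in z as the series of (k + 1) z^k / w^(k + 2) and cut off after
  z^5. Odd Eisenstein sums vanish, and 3 \<open>G 4\<close> and 5 \<open>G 6\<close> become g2 / 20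
  and g3 / 28. Stopping at order six means that equal invariants give agreement up to z^6.\<close>

lemma wp_expansion:
  obtains r \<psi> where "r > 0" "\<psi> holomorphic_on ball 0 r"
    "\<And>z. z \<in> ball 0 r \<Longrightarrow> z \<noteq> 0 \<Longrightarrow> z \<notin> \<Lambda>"
    "\<And>z. z \<in> ball 0 r \<Longrightarrow>
       wp \<Lambda> z = 1 / z\<^sup>2 + lattice_g2 \<Lambda> / 20 * z\<^sup>2 + lattice_g3 \<Lambda> / 28 * z ^ 4 + z ^ 6 * \<psi> z"
proof -
  obtain r where r: "r > 0" "\<And>w. w \<in> \<Lambda> - {0} \<Longrightarrow> 2 * r \<le> norm w" using isolated by blast
  \<comment> \<open>Closed form of the tail of that series after removal of z^6; at z = 0 it equals
    7 / w^8.\<close>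
  define f :: "complex \<Rightarrow> complex \<Rightarrow> complex"
    where "f = (\<lambda>w z. (7 * w - 6 * z) / (w ^ 7 * (z - w)\<^sup>2))"
  define \<psi> where "\<psi> = (\<lambda>z. \<Sum>\<^sub>\<infinity>w\<in>\<Lambda> - {0}. f w z)"
  have le: "norm (f w z) \<le> 40 / (2 * r) ^ 5 * (1 / norm w ^ 3)"
    if w: "w \<in> \<Lambda> - {0}" and z: "z \<in> ball 0 r" for w z
  proof -
    have rw: "2 * r \<le> norm w" using r(2) w by blast
    have zw: "norm w / 2 \<le> norm (z - w)"
      using rw z norm_triangle_ineq2[of w z] by (simp add: norm_minus_commute)
    have 2: "norm (7 * w - 6 * z) \<le> 10 * norm w"
      using norm_triangle_ineq4[of "7 * w" "6 * z"] rw z by (simp add: norm_mult)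
    have "norm (f w z) = norm (7 * w - 6 * z) / (norm w ^ 7 * (norm (z - w))\<^sup>2)"
      by (simp add: f_def norm_mult norm_divide norm_power)
    also have "\<dots> \<le> 10 * norm w / (norm w ^ 7 * (norm w / 2)\<^sup>2)"
      using w zw 2
      by (intro frac_le mult_left_mono mult_pos_pos power_mono) auto
    also have "\<dots> = 40 / (norm w ^ 5 * norm w ^ 3)"
      using w by (simp add: field_simps eval_nat_numeral)
    also have "\<dots> \<le> 40 / ((2 * r) ^ 5 * norm w ^ 3)"
      using w rw r(1) by (intro divide_left_mono mult_right_mono power_mono mult_pos_pos) auto
    finally show ?thesis by simp
  qed
  have summable: "f2 summable_on (\<Lambda> - {0})" if "f2 = (\<lambda>w. f w z)" "z \<in> ball 0 r" for f2 z
    unfolding that(1)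
    by (rule abs_summable_summable, rule Infinite_Sum.abs_summable_on_comparison_test'[OF summable_on_cmult_right[OF summable_inverse_cube]])
       (rule le[OF _ that(2)])
  have "\<psi> holomorphic_on ball 0 r"
    unfolding \<psi>_def
  proof (rule holomorphic_on_infsum)
    show "f w holomorphic_on ball 0 r" if "w \<in> \<Lambda> - {0}" for w
      unfolding f_def using r(2)[OF that] that r(1) by (intro holomorphic_intros) auto
    show "(\<lambda>w. 40 / (2 * r) ^ 5 * (1 / norm w ^ 3)) summable_on (\<Lambda> - {0})"
      by (intro summable_on_cmult_right summable_inverse_cube)
  qed (use le in auto)
  moreover have "z \<notin> \<Lambda>" if "z \<in> ball 0 r" "z \<noteq> 0" for z
    using r(2)[of z] that r(1) by auto
  moreover have "wp \<Lambda> z = 1 / z\<^sup>2 + lattice_g2 \<Lambda> / 20 * z\<^sup>2 + lattice_g3 \<Lambda> / 28 * z ^ 4 + z ^ 6 * \<psi> z"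
    if z: "z \<in> ball 0 r" for z
  proof -
    have term_eq: "wp_term z w = 2 * z * (1 / w ^ 3) + 3 * z\<^sup>2 * (1 / w ^ 4) + 4 * z ^ 3 * (1 / w ^ 5) +
        5 * z ^ 4 * (1 / w ^ 6) + 6 * z ^ 5 * (1 / w ^ 7) + z ^ 6 * f w z" if w: "w \<in> \<Lambda> - {0}" for w
    proof -
      have "z \<noteq> w" "w \<noteq> 0" using r(2)[OF w] w z r(1) by auto
      then show ?thesis
        unfolding f_def by (simp add: divide_simps) (simp add: algebra_simps eval_nat_numeral)
    qed
    have has_G: "((\<lambda>w. 1 / w ^ k) has_sum G k) (\<Lambda> - {0})" if "k \<ge> 3" for k
      unfolding G_def by (intro has_sum_infsum summable_inverse_power that)
    have "((\<lambda>w. 2 * z * (1 / w ^ 3) + 3 * z\<^sup>2 * (1 / w ^ 4) + 4 * z ^ 3 * (1 / w ^ 5) +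
        5 * z ^ 4 * (1 / w ^ 6) + 6 * z ^ 5 * (1 / w ^ 7) + z ^ 6 * f w z) has_sum
        (2 * z * G 3 + 3 * z\<^sup>2 * G 4 + 4 * z ^ 3 * G 5 +
        5 * z ^ 4 * G 6 + 6 * z ^ 5 * G 7 + z ^ 6 * \<psi> z)) (\<Lambda> - {0})"
      unfolding \<psi>_def
      by (intro has_sum_add has_sum_cmult_right has_G has_sum_infsum summable[OF refl z]) auto
    then have "(wp_term z has_sum (2 * z * G 3 + 3 * z\<^sup>2 * G 4 + 4 * z ^ 3 * G 5 +
        5 * z ^ 4 * G 6 + 6 * z ^ 5 * G 7 + z ^ 6 * \<psi> z)) (\<Lambda> - {0})"
      by (subst has_sum_cong[OF term_eq]) auto
    then have "infsum (wp_term z) (\<Lambda> - {0}) = 3 * z\<^sup>2 * G 4 + 5 * z ^ 4 * G 6 + z ^ 6 * \<psi> z"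
      by (subst infsumI) (simp_all add: G_odd)
    moreover have "lattice_g2 \<Lambda> = 60 * G 4" "lattice_g3 \<Lambda> = 140 * G 6"
      by (simp_all add: lattice_g2_def lattice_g3_def G_def)
    ultimately show ?thesis by (simp add: wp_def)
  qed
  ultimately show ?thesis using that r(1) by blast
qed

abbreviation "wp' \<equiv> deriv (wp \<Lambda>)"
abbreviation "g2 \<equiv> lattice_g2 \<Lambda>"
abbreviation "g3 \<equiv> lattice_g3 \<Lambda>"

text \<open>A vanishing limit at the origin makes all the singularities removable, so that
  Liouville's theorem applies.\<close>
lemma elliptic_eq_0:
  assumes holo: "F holomorphic_on - \<Lambda>"
    and per: "\<And>z v. v \<in> \<Lambda> \<Longrightarrow> z \<notin> \<Lambda> \<Longrightarrow> F (z + v) = F z"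
    and lim: "F \<midarrow>0\<rightarrow> 0" and z: "z \<notin> \<Lambda>"
  shows "F z = 0"
proof -
  \<comment> \<open>Setting H to 0 on \<Lambda> replaces the default values of F there by the limit
    and makes H periodic without exception.\<close>
  define H where "H = (\<lambda>z. if z \<in> \<Lambda> then 0 else F z)"
  have perH: "H (z + v) = H z" if "v \<in> \<Lambda>" for z v
    using per[OF that] add_mem_iff[OF that] by (simp add: H_def)
  have holoH: "H holomorphic_on - \<Lambda>"
    using holo by (rule holomorphic_transform) (simp add: H_def)
  have H0: "H \<midarrow>0\<rightarrow> 0"
    by (rule Lim_transform_eventually[OF lim])
       (use eventually_not_lattice[of 0] in eventually_elim, simp add: H_def)
  have "isCont H u" for u
  proof (cases "u \<in> \<Lambda>")
    case True
    have "(\<lambda>x. H (x + (- u))) \<midarrow>0 - (- u)\<rightarrow> 0" using H0 by (rule LIM_offset)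
    moreover have "H (x + (- u)) = H x" for x using perH minus_mem[OF True] by blast
    ultimately show ?thesis using True by (simp add: isCont_def H_def)
  next
    case False
    then show ?thesis
      using holoH open_compl by (metis ComplI continuous_on_eq_continuous_at holomorphic_on_imp_continuous_on)
  qed
  then have contH: "continuous_on S H" for S by (simp add: continuous_at_imp_continuous_on)
  have "H holomorphic_on ball 0 R" for R
  proof (rule no_isolated_singularity[OF contH])
    show "H holomorphic_on ball 0 R - (\<Lambda> \<inter> cball 0 R)"
      by (rule holomorphic_on_subset[OF holoH]) auto
  qed (use finite_inter_cball in auto)
  then have "H field_differentiable at u" for u
    by (rule holomorphic_on_imp_differentiable_at[of _ "ball 0 (norm u + 1)"]) auto
  then have "H holomorphic_on UNIV" by (simp add: holomorphic_on_def)
  moreover have "bounded (range H)"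
  proof -
    obtain B where B: "\<And>z. \<exists>w\<in>\<Lambda>. norm (z - w) \<le> B" using cobounded by blast
    have "range H \<subseteq> H ` cball 0 B"
    proof (rule image_subsetI)
      fix u
      obtain w where w: "w \<in> \<Lambda>" "norm (u - w) \<le> B" using B by blast
      have "H u = H (u - w)" using perH[OF w(1), of "u - w"] by simp
      then show "H u \<in> H ` cball 0 B" using w(2) by auto
    qed
    moreover have "compact (H ` cball 0 B)" by (intro compact_continuous_image contH) simp
    ultimately show ?thesis using bounded_subset compact_imp_bounded by blast
  qed
  ultimately have "H constant_on UNIV" by (rule Liouville_theorem)
  then have "H z = H 0" by (metis UNIV_I constant_on_def)
  then show ?thesis using z by (simp add: H_def)
qed

lemma wp'_holomorphic: "wp' holomorphic_on - \<Lambda>"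
  by (rule holomorphic_deriv[OF wp_holomorphic open_compl])

lemma wp'_has_deriv:
  "z \<notin> \<Lambda> \<Longrightarrow> (wp' has_field_derivative deriv wp' z) (at z)"
  using wp'_holomorphic open_compl by (intro holomorphic_derivI[of _ "- \<Lambda>"]) auto

lemma deriv_wp'_periodic:
  assumes "v \<in> \<Lambda>"
  shows "deriv wp' (z + v) = deriv wp' z"
proof -
  have "(\<lambda>z. wp' (z + v)) = wp'" using deriv_wp_periodic[OF assms] by auto
  then show ?thesis unfolding deriv_def[of wp'] DERIV_shift by simp
qed

text \<open>The remainder stays hidden in \<open>\<psi>\<close>, so the derivatives bring in only
  \<open>\<psi>\<close> and its derivatives, which are continuous at 0.\<close>

lemma wp_expansions:
  obtains r \<psi> where "r > 0" "\<psi> holomorphic_on ball 0 r"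
    "\<And>z. z \<in> ball 0 r - {0} \<Longrightarrow> z \<notin> \<Lambda>"
    "\<And>z. z \<in> ball 0 r - {0} \<Longrightarrow>
       wp \<Lambda> z = 1 / z\<^sup>2 + g2 / 20 * z\<^sup>2 + g3 / 28 * z ^ 4 + z ^ 6 * \<psi> z"
    "\<And>z. z \<in> ball 0 r - {0} \<Longrightarrow>
       wp' z = - 2 / z ^ 3 + g2 / 10 * z + g3 / 7 * z ^ 3 + 6 * z ^ 5 * \<psi> z + z ^ 6 * deriv \<psi> z"
    "\<And>z. z \<in> ball 0 r - {0} \<Longrightarrow>
       deriv wp' z = 6 / z ^ 4 + g2 / 10 + 3 * g3 / 7 * z\<^sup>2 + 30 * z ^ 4 * \<psi> z
         + 12 * z ^ 5 * deriv \<psi> z + z ^ 6 * deriv (deriv \<psi>) z"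
proof -
  obtain r \<psi> where r: "r > 0" and \<psi>: "\<psi> holomorphic_on ball 0 r"
    and notin: "\<And>z. z \<in> ball 0 r \<Longrightarrow> z \<noteq> 0 \<Longrightarrow> z \<notin> \<Lambda>"
    and wp: "\<And>z. z \<in> ball 0 r \<Longrightarrow> wp \<Lambda> z = 1 / z\<^sup>2 + g2 / 20 * z\<^sup>2 + g3 / 28 * z ^ 4 + z ^ 6 * \<psi> z"
    by (rule wp_expansion) blast
  let ?S = "ball 0 r - {0 :: complex}"
  have S: "open ?S" by auto
  have d\<psi>: "(\<psi> has_field_derivative deriv \<psi> z) (at z)"
    and d\<psi>': "(deriv \<psi> has_field_derivative deriv (deriv \<psi>) z) (at z)" if "z \<in> ?S" for z
    using that \<psi> holomorphic_deriv[OF \<psi>] by (auto intro: holomorphic_derivI[of _ "ball 0 r"])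
  have wp': "wp' z = - 2 / z ^ 3 + g2 / 10 * z + g3 / 7 * z ^ 3 + 6 * z ^ 5 * \<psi> z + z ^ 6 * deriv \<psi> z"
    if z: "z \<in> ?S" for z
  proof -
    have "((\<lambda>z. 1 / z\<^sup>2 + g2 / 20 * z\<^sup>2 + g3 / 28 * z ^ 4 + z ^ 6 * \<psi> z) has_field_derivative
       - 2 / z ^ 3 + g2 / 10 * z + g3 / 7 * z ^ 3 + 6 * z ^ 5 * \<psi> z + z ^ 6 * deriv \<psi> z) (at z)"
      using z by (auto intro!: derivative_eq_intros d\<psi>) (auto simp: divide_simps eval_nat_numeral)
    then have "(wp \<Lambda> has_field_derivative
       - 2 / z ^ 3 + g2 / 10 * z + g3 / 7 * z ^ 3 + 6 * z ^ 5 * \<psi> z + z ^ 6 * deriv \<psi> z) (at z)"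
      by (rule has_field_derivative_transform_within_open[OF _ S z]) (use wp in simp)
    then show ?thesis by (rule DERIV_imp_deriv)
  qed
  have wp'': "deriv wp' z = 6 / z ^ 4 + g2 / 10 + 3 * g3 / 7 * z\<^sup>2 + 30 * z ^ 4 * \<psi> z
         + 12 * z ^ 5 * deriv \<psi> z + z ^ 6 * deriv (deriv \<psi>) z"
    if z: "z \<in> ?S" for z
  proof -
    have "((\<lambda>z. - 2 / z ^ 3 + g2 / 10 * z + g3 / 7 * z ^ 3 + 6 * z ^ 5 * \<psi> z + z ^ 6 * deriv \<psi> z)
       has_field_derivative 6 / z ^ 4 + g2 / 10 + 3 * g3 / 7 * z\<^sup>2 + 30 * z ^ 4 * \<psi> z
         + 12 * z ^ 5 * deriv \<psi> z + z ^ 6 * deriv (deriv \<psi>) z) (at z)"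
      using z by (auto intro!: derivative_eq_intros d\<psi> d\<psi>') (auto simp: divide_simps eval_nat_numeral)
    then have "(wp' has_field_derivative 6 / z ^ 4 + g2 / 10 + 3 * g3 / 7 * z\<^sup>2 + 30 * z ^ 4 * \<psi> z
         + 12 * z ^ 5 * deriv \<psi> z + z ^ 6 * deriv (deriv \<psi>) z) (at z)"
      by (rule has_field_derivative_transform_within_open[OF _ S z]) (use wp' in simp)
    then show ?thesis by (rule DERIV_imp_deriv)
  qed
  show ?thesis
    by (rule that[OF r \<psi>]) (use notin wp wp' wp'' in auto)
qed

text \<open>For each equation the difference of the two sides is periodic and holomorphic off
  \<Lambda>. The expansion shows that its poles at 0 cancel and that its limit there is 0, so it
  vanishes identically.\<close>

lemma
  shows wp_ode: "z \<notin> \<Lambda> \<Longrightarrow> (wp' z)\<^sup>2 = 4 * wp \<Lambda> z ^ 3 - g2 * wp \<Lambda> z - g3"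
    and wp_ode2: "z \<notin> \<Lambda> \<Longrightarrow> deriv wp' z = 6 * (wp \<Lambda> z)\<^sup>2 - g2 / 2"
    and wp_lim: "(\<lambda>z. z\<^sup>2 * wp \<Lambda> z) \<midarrow>0\<rightarrow> 1"
    and wp'_lim: "(\<lambda>z. z ^ 3 * wp' z) \<midarrow>0\<rightarrow> - 2"
proof -
  obtain r \<psi> where r: "r > 0" and \<psi>: "\<psi> holomorphic_on ball 0 r"
    and notin: "\<And>z. z \<in> ball 0 r - {0} \<Longrightarrow> z \<notin> \<Lambda>"
    and wp: "\<And>z. z \<in> ball 0 r - {0} \<Longrightarrow>
       wp \<Lambda> z = 1 / z\<^sup>2 + g2 / 20 * z\<^sup>2 + g3 / 28 * z ^ 4 + z ^ 6 * \<psi> z"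
    and wp': "\<And>z. z \<in> ball 0 r - {0} \<Longrightarrow>
       wp' z = - 2 / z ^ 3 + g2 / 10 * z + g3 / 7 * z ^ 3 + 6 * z ^ 5 * \<psi> z + z ^ 6 * deriv \<psi> z"
    and wp'': "\<And>z. z \<in> ball 0 r - {0} \<Longrightarrow>
       deriv wp' z = 6 / z ^ 4 + g2 / 10 + 3 * g3 / 7 * z\<^sup>2 + 30 * z ^ 4 * \<psi> z
         + 12 * z ^ 5 * deriv \<psi> z + z ^ 6 * deriv (deriv \<psi>) z"
    by (rule wp_expansions) blast
  have ev: "\<forall>\<^sub>F z in at 0. z \<in> ball 0 r - {0}"
    using r by (intro eventually_at_in_open) auto
  have cont: "isCont h 0" if "h holomorphic_on ball 0 r" for h
    using that r by (metis centre_in_ball continuous_on_eq_continuous_at holomorphic_on_imp_continuous_on open_ball)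
  have c: "isCont \<psi> 0" "isCont (deriv \<psi>) 0" "isCont (deriv (deriv \<psi>)) 0"
    using \<psi> by (auto intro!: cont holomorphic_deriv)
  define a b where "a = g2 / 20" and "b = g3 / 28"
  have g: "g2 = 20 * a" "g3 = 28 * b" by (simp_all add: a_def b_def)
  \<comment> \<open>Normalised remainders: z^2 \<open>wp\<close> = 1 + z^4 u and z^3
    \<open>wp'\<close> = -2 + z^4 v. Clearing the poles in this way turns the cancellation into
    polynomial algebra.\<close>
  define u v where "u = (\<lambda>z. a + b * z\<^sup>2 + z ^ 4 * \<psi> z)"
    and "v = (\<lambda>z. 2 * a + 4 * b * z\<^sup>2 + 6 * z ^ 4 * \<psi> z + z ^ 5 * deriv \<psi> z)"
  have uv: "isCont u 0" "isCont v 0" unfolding u_def v_def by (intro continuous_intros c)+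
  have X: "z\<^sup>2 * wp \<Lambda> z = 1 + z ^ 4 * u z" if "z \<in> ball 0 r - {0}" for z
    using that wp[OF that] by (simp add: u_def g divide_simps) (simp add: algebra_simps eval_nat_numeral)
  have Y: "z ^ 3 * wp' z = - 2 + z ^ 4 * v z" if "z \<in> ball 0 r - {0}" for z
    using that wp'[OF that] by (simp add: v_def g divide_simps) (simp add: algebra_simps eval_nat_numeral)
  have limI: "h \<midarrow>0\<rightarrow> k 0" if "\<And>z. z \<in> ball 0 r - {0} \<Longrightarrow> h z = k z" "isCont k 0" for h k :: "complex \<Rightarrow> complex"
    by (rule Lim_transform_eventually[OF that(2)[unfolded isCont_def]])
       (use ev in eventually_elim, simp add: that(1))
  show "(\<lambda>z. z\<^sup>2 * wp \<Lambda> z) \<midarrow>0\<rightarrow> 1"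
    using limI[of "\<lambda>z. z\<^sup>2 * wp \<Lambda> z" "\<lambda>z. 1 + z ^ 4 * u z", OF X] uv by (simp add: continuous_intros)
  show "(\<lambda>z. z ^ 3 * wp' z) \<midarrow>0\<rightarrow> - 2"
    using limI[of "\<lambda>z. z ^ 3 * wp' z" "\<lambda>z. - 2 + z ^ 4 * v z", OF Y] uv by (simp add: continuous_intros)
  show "(wp' z)\<^sup>2 = 4 * wp \<Lambda> z ^ 3 - g2 * wp \<Lambda> z - g3" if z: "z \<notin> \<Lambda>"
  proof -
    define F where "F = (\<lambda>z. (wp' z)\<^sup>2 - 4 * wp \<Lambda> z ^ 3 + g2 * wp \<Lambda> z + g3)"
    \<comment> \<open>What is left of F once z^6 has been divided out; the choices g2 = 20 a and g3
      = 28 b cancel every lower order, and the factor z^2 gives the limit 0.\<close>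
    define k where "k = (\<lambda>z. z\<^sup>2 * (- 36 * \<psi> z - 4 * z * deriv \<psi> z + (v z)\<^sup>2 - 12 * (u z)\<^sup>2
       - 4 * z ^ 4 * u z ^ 3 + 20 * a * u z))"
    have "F z = k z" if z: "z \<in> ball 0 r - {0}" for z
    proof -
      have "z ^ 6 * F z = (z ^ 3 * wp' z)\<^sup>2 - 4 * (z\<^sup>2 * wp \<Lambda> z) ^ 3
          + g2 * z ^ 4 * (z\<^sup>2 * wp \<Lambda> z) + g3 * z ^ 6"
        unfolding F_def by (simp add: algebra_simps eval_nat_numeral)
      also have "\<dots> = z ^ 6 * k z"
        unfolding X[OF z] Y[OF z] k_def g u_def v_def by (simp add: algebra_simps eval_nat_numeral)
      finally show ?thesis using z by simp
    qed
    moreover have "isCont k 0" unfolding k_def by (intro continuous_intros c uv)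
    ultimately have "F \<midarrow>0\<rightarrow> k 0" by (rule limI)
    then have "F \<midarrow>0\<rightarrow> 0" by (simp add: k_def)
    moreover have "F holomorphic_on - \<Lambda>"
      unfolding F_def by (intro holomorphic_intros wp_holomorphic wp'_holomorphic)
    ultimately have "F z = 0"
      by (intro elliptic_eq_0[OF _ _ _ z]) (simp_all add: F_def wp_periodic deriv_wp_periodic)
    then show ?thesis by (simp add: F_def algebra_simps)
  qed
  show "deriv wp' z = 6 * (wp \<Lambda> z)\<^sup>2 - g2 / 2" if z: "z \<notin> \<Lambda>"
  proof -
    define F where "F = (\<lambda>z. deriv wp' z - 6 * (wp \<Lambda> z)\<^sup>2 + g2 / 2)"
    define k where "k = (\<lambda>z. 18 * z ^ 4 * \<psi> z + 12 * z ^ 5 * deriv \<psi> z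
       + z ^ 6 * deriv (deriv \<psi>) z - 6 * z ^ 4 * (u z)\<^sup>2)"
    have "F z = k z" if z: "z \<in> ball 0 r - {0}" for z
    proof -
      have "z ^ 4 * deriv wp' z = 6 + z ^ 4 * (2 * a + 12 * b * z\<^sup>2 + 30 * z ^ 4 * \<psi> z
         + 12 * z ^ 5 * deriv \<psi> z + z ^ 6 * deriv (deriv \<psi>) z)"
        unfolding wp''[OF z] g using z by (simp add: field_simps)
      moreover have "z ^ 4 * F z = z ^ 4 * deriv wp' z - 6 * (z\<^sup>2 * wp \<Lambda> z)\<^sup>2 + z ^ 4 * (g2 / 2)"
        unfolding F_def by (simp add: algebra_simps eval_nat_numeral)
      ultimately have "z ^ 4 * F z = z ^ 4 * k z"
        unfolding X[OF z] k_def g u_def by (simp add: algebra_simps eval_nat_numeral)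
      then show ?thesis using z by simp
    qed
    moreover have "isCont k 0" unfolding k_def by (intro continuous_intros c uv)
    ultimately have "F \<midarrow>0\<rightarrow> k 0" by (rule limI)
    then have "F \<midarrow>0\<rightarrow> 0" by (simp add: k_def)
    moreover have "F holomorphic_on - \<Lambda>"
      unfolding F_def by (intro holomorphic_intros wp_holomorphic wp'_holomorphic holomorphic_deriv open_compl)
    ultimately have "F z = 0"
      by (intro elliptic_eq_0[OF _ _ _ z]) (simp_all add: F_def wp_periodic deriv_wp'_periodic)
    then show ?thesis by (simp add: F_def algebra_simps)
  qed
qed

end

section \<open>Orders of zeros of solutions of a linear equation, and uniqueness\<close>

lemma euler_operator_factor:
  fixes d g :: "complex \<Rightarrow> complex"
  assumes g: "g holomorphic_on ball 0 r" and d: "\<And>z. z \<in> ball 0 r \<Longrightarrow> d z = z ^ n * g z"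
    and z: "z \<in> ball 0 r"
  shows "z * deriv d z = z ^ n * (of_nat n * g z + z * deriv g z)"
proof -
  have "((\<lambda>z. z ^ n * g z) has_field_derivative of_nat n * z ^ (n - 1) * g z + z ^ n * deriv g z) (at z)"
    using holomorphic_derivI[OF g open_ball z]
    by (auto intro!: derivative_eq_intros simp: algebra_simps)
  then have "(d has_field_derivative of_nat n * z ^ (n - 1) * g z + z ^ n * deriv g z) (at z)"
    by (rule has_field_derivative_transform_within_open[OF _ open_ball z]) (simp add: d)
  then have "deriv d z = of_nat n * z ^ (n - 1) * g z + z ^ n * deriv g z"
    by (rule DERIV_imp_deriv)
  then show ?thesis by (cases n) (simp_all add: algebra_simps)
qed

lemma connected_Compl_countable:
  fixes K :: "complex set"
  assumes "countable K"
  shows "connected (- K)"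
  using connected_open_diff_countable[of UNIV K] assms
  by (simp add: Compl_eq_Diff_UNIV connected_UNIV)

text \<open>The indicial equation of \<open>z\<^sup>2 d'' = q d\<close>.\<close>
lemma ode_order_of_zero:
  fixes d :: "complex \<Rightarrow> complex"
  assumes d: "d holomorphic_on ball 0 r" and "r > 0" "d 0 = 0"
    and ode: "\<And>z. z \<in> ball 0 r - {0} \<Longrightarrow> z\<^sup>2 * deriv (deriv d) z = q z * d z"
    and q: "q \<midarrow>0\<rightarrow> q0" and nz: "s \<in> ball 0 r" "d s \<noteq> 0"
  obtains n g \<rho> where "n > 0" "0 < \<rho>" "ball (0 :: complex) \<rho> \<subseteq> ball 0 r" "g holomorphic_on ball 0 \<rho>"
    "\<And>z. z \<in> ball 0 \<rho> \<Longrightarrow> d z = z ^ n * g z" "g 0 \<noteq> 0" "of_nat n * (of_nat n - 1) = q0"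
proof -
  have "0 \<in> ball 0 r" using \<open>r > 0\<close> by simp
  moreover have "\<not> d constant_on ball 0 r"
    using nz \<open>d 0 = 0\<close> \<open>r > 0\<close> unfolding constant_on_def by (metis centre_in_ball)
  ultimately show ?thesis
  proof (rule holomorphic_factor_zero_nonconstant[where \<xi> = 0, OF d open_ball connected_ball _ \<open>d 0 = 0\<close>])
    fix g \<rho> n
    assume g: "0 < n" "0 < \<rho>" "ball (0 :: complex) \<rho> \<subseteq> ball 0 r" "g holomorphic_on ball 0 \<rho>"
        "\<And>z. z \<in> ball 0 \<rho> \<Longrightarrow> d z = (z - 0) ^ n * g z"
        "\<And>z. z \<in> ball 0 \<rho> \<Longrightarrow> g z \<noteq> 0"
    have dg: "\<And>z. z \<in> ball 0 \<rho> \<Longrightarrow> d z = z ^ n * g z" using g(5) by simp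
    define g1 where "g1 = (\<lambda>z. of_nat n * g z + z * deriv g z)"
    have g1: "g1 holomorphic_on ball 0 \<rho>"
      unfolding g1_def by (intro holomorphic_intros g(4) holomorphic_deriv) auto
    have e1: "z * deriv d z = z ^ n * g1 z" if "z \<in> ball 0 \<rho>" for z
      unfolding g1_def by (rule euler_operator_factor[OF g(4) dg that])
    \<comment> \<open>With \<theta> = z d/dz one has z^2 d'' = \<theta>(\<theta> - 1) d, and
      \<theta> acts on z^n g as z^n (n + \<theta>) g. Cancelling z^n leaves an identity whose value
      at 0 is q0 g(0) = n (n - 1) g(0).\<close>
    have eq: "q z * g z = (of_nat n - 1) * g1 z + z * deriv g1 z" if z: "z \<in> ball 0 \<rho> - {0}" for z
    proof -
      have zr: "z \<in> ball 0 r - {0}" using z g(3) by blast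
      have "z * deriv (\<lambda>z. z * deriv d z) z = z ^ n * (of_nat n * g1 z + z * deriv g1 z)"
        using z by (intro euler_operator_factor[OF g1 e1]) auto
      moreover have "(deriv d has_field_derivative deriv (deriv d) z) (at z)"
        using zr holomorphic_deriv[OF d open_ball] by (intro holomorphic_derivI[of _ "ball 0 r"]) auto
      then have "((\<lambda>z. z * deriv d z) has_field_derivative deriv d z + z * deriv (deriv d) z) (at z)"
        by (auto intro!: derivative_eq_intros)
      then have "deriv (\<lambda>z. z * deriv d z) z = deriv d z + z * deriv (deriv d) z"
        by (rule DERIV_imp_deriv)
      ultimately have "z * deriv d z + z\<^sup>2 * deriv (deriv d) z = z ^ n * (of_nat n * g1 z + z * deriv g1 z)"
        by (simp add: algebra_simps power2_eq_square)
      then have "z ^ n * (q z * g z) = z ^ n * ((of_nat n - 1) * g1 z + z * deriv g1 z)"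
        using ode[OF zr] e1[of z] dg[of z] z by (simp add: algebra_simps)
      then show ?thesis using z by simp
    qed
    have cont: "h \<midarrow>0\<rightarrow> h 0" if "h holomorphic_on ball 0 \<rho>" for h
      using that g(2) by (metis centre_in_ball continuous_on_eq_continuous_at holomorphic_on_imp_continuous_on open_ball isCont_def)
    have "(\<lambda>z. q z * g z) \<midarrow>0\<rightarrow> q0 * g 0" by (intro tendsto_intros q cont g(4))
    moreover have "(\<lambda>z. q z * g z) \<midarrow>0\<rightarrow> (of_nat n - 1) * g1 0 + 0 * deriv g1 0"
    proof (rule Lim_transform_eventually)
      show "(\<lambda>z. (of_nat n - 1) * g1 z + z * deriv g1 z) \<midarrow>0\<rightarrow> (of_nat n - 1) * g1 0 + 0 * deriv g1 0"
        by (intro tendsto_intros cont g1 holomorphic_deriv) auto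
      have "\<forall>\<^sub>F z in at 0. z \<in> ball 0 \<rho> - {0}" using g(2) by (intro eventually_at_in_open) auto
      then show "\<forall>\<^sub>F z in at 0. (of_nat n - 1) * g1 z + z * deriv g1 z = q z * g z"
        by eventually_elim (simp add: eq)
    qed
    ultimately have "q0 * g 0 = (of_nat n - 1) * g1 0 + 0 * deriv g1 0"
      by (rule LIM_unique)
    then have "g 0 * (of_nat n * (of_nat n - 1)) = g 0 * q0" by (simp add: g1_def algebra_simps)
    moreover have g0: "g 0 \<noteq> 0" using g(2,6) by simp
    ultimately have n: "of_nat n * (of_nat n - 1) = q0" using mult_left_cancel by blast
    show ?thesis by (rule that[OF g(1-4) _ g0 n]) (rule dg)
  qed
qed

context complex_lattice
begin

text \<open>The translates of \<open>wp\<close> to a and b agree near 0 by the exponent argument, so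
  a - b behaves like a period wherever both sides are regular. If a - b were not in \<Lambda>, the
  pole of \<open>wp\<close> at 0 would be carried to a regular point.\<close>

lemma wp_unique:
  assumes a: "a \<notin> \<Lambda>" and b: "b \<notin> \<Lambda>" and eq: "wp \<Lambda> a = wp \<Lambda> b" "wp' a = wp' b"
  shows "a - b \<in> \<Lambda>"
proof -
  obtain ra where ra: "ra > 0" "ball a ra \<subseteq> - \<Lambda>" using open_compl a open_contains_ball by blast
  obtain rb where rb: "rb > 0" "ball b rb \<subseteq> - \<Lambda>" using open_compl b open_contains_ball by blast
  define r where "r = min ra rb"
  have r: "r > 0" using ra rb by (simp add: r_def)
  have inb: "a + s \<notin> \<Lambda>" "b + s \<notin> \<Lambda>" if "s \<in> ball 0 r" for s
  proof -
    have "a + s \<in> ball a ra" "b + s \<in> ball b rb" using that by (auto simp: r_def dist_norm)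
    then show "a + s \<notin> \<Lambda>" "b + s \<notin> \<Lambda>" using ra rb by auto
  qed
  define d where "d = (\<lambda>s. wp \<Lambda> (a + s) - wp \<Lambda> (b + s))"
  have d1: "(d has_field_derivative wp' (a + s) - wp' (b + s)) (at s)" if "s \<in> ball 0 r" for s
    unfolding d_def using inb[OF that]
    by (auto intro!: derivative_eq_intros DERIV_chain2[OF wp_has_deriv])
  have deriv_d: "deriv d s = wp' (a + s) - wp' (b + s)" if "s \<in> ball 0 r" for s
    using d1[OF that] by (rule DERIV_imp_deriv)
  have d2: "deriv (deriv d) s = 6 * (wp \<Lambda> (a + s) + wp \<Lambda> (b + s)) * d s" if s: "s \<in> ball 0 r" for s
  proof -
    have "((\<lambda>s. wp' (a + s) - wp' (b + s)) has_field_derivative deriv wp' (a + s) - deriv wp' (b + s)) (at s)"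
      using inb[OF s] by (auto intro!: derivative_eq_intros DERIV_chain2[OF wp'_has_deriv])
    then have "(deriv d has_field_derivative deriv wp' (a + s) - deriv wp' (b + s)) (at s)"
      by (rule has_field_derivative_transform_within_open[OF _ open_ball s]) (simp add: deriv_d)
    then have "deriv (deriv d) s = deriv wp' (a + s) - deriv wp' (b + s)" by (rule DERIV_imp_deriv)
    then show ?thesis using inb[OF s] by (simp add: wp_ode2 d_def algebra_simps power2_eq_square)
  qed
  have hd: "d holomorphic_on ball 0 r"
    using d1 unfolding holomorphic_on_open[OF open_ball] by blast
  have d0: "d s = 0" if s: "s \<in> ball 0 r" for s
  proof (rule ccontr)
    assume "d s \<noteq> 0"
    have cont: "isCont (\<lambda>s. wp \<Lambda> (e + s)) 0" if "e \<notin> \<Lambda>" for e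
    proof (rule isCont_o2[of 0 "\<lambda>s. e + s"])
      show "isCont (wp \<Lambda>) (e + 0)" using DERIV_isCont[OF wp_has_deriv[OF that]] by simp
    qed auto
    show False
    proof (rule ode_order_of_zero[OF hd r _ _ _ s \<open>d s \<noteq> 0\<close>])
      show "z\<^sup>2 * deriv (deriv d) z = (z\<^sup>2 * (6 * (wp \<Lambda> (a + z) + wp \<Lambda> (b + z)))) * d z"
        if "z \<in> ball 0 r - {0}" for z using d2 that by simp
      have "isCont (\<lambda>z. z\<^sup>2 * (6 * (wp \<Lambda> (a + z) + wp \<Lambda> (b + z)))) 0"
        by (intro continuous_intros cont a b)
      then show "(\<lambda>z. z\<^sup>2 * (6 * (wp \<Lambda> (a + z) + wp \<Lambda> (b + z)))) \<midarrow>0\<rightarrow> 0"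
        by (simp add: isCont_def)
      show "d 0 = 0" by (simp add: d_def eq)
      fix n g \<rho>
      assume n: "n > 0" "0 < \<rho>" "ball (0 :: complex) \<rho> \<subseteq> ball 0 r" "g holomorphic_on ball 0 \<rho>"
        "\<And>z. z \<in> ball 0 \<rho> \<Longrightarrow> d z = z ^ n * g z" "g 0 \<noteq> 0" "of_nat n * (of_nat n - 1) = (0::complex)"
      \<comment> \<open>The coefficient of the equation is regular, so q0 = 0 and n (n - 1) = 0. The
        zero would be simple, against d'(0) = 0.\<close>
      have "(of_nat n :: complex) = 1" using n(1,7) by simp
      then have "n = 1" by (metis of_nat_1 of_nat_eq_iff)
      have "((\<lambda>z. z * g z) has_field_derivative g 0) (at 0)"
        using holomorphic_derivI[OF n(4) open_ball, of 0] n(2) by (auto intro!: derivative_eq_intros)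
      then have "(d has_field_derivative g 0) (at 0)"
        by (rule has_field_derivative_transform_within_open[OF _ open_ball[of 0 \<rho>]])
           (use n \<open>n = 1\<close> in auto)
      then have "deriv d 0 = g 0" by (rule DERIV_imp_deriv)
      then show False using deriv_d[of 0] r n(6) eq by simp
    qed
  qed
  define c where "c = a - b"
  \<comment> \<open>The poles of either function; being countable, K has a connected complement on
    which analytic continuation is possible.\<close>
  define K where "K = \<Lambda> \<union> (\<lambda>w. w - c) ` \<Lambda>"
  have K: "z \<notin> K \<longleftrightarrow> z \<notin> \<Lambda> \<and> z + c \<notin> \<Lambda>" for z
    unfolding K_def by (auto simp: image_iff)
  have eq0: "wp \<Lambda> (z + c) - wp \<Lambda> z = 0" if "z \<notin> K" for z
  proof (rule analytic_continuation[of "\<lambda>z. wp \<Lambda> (z + c) - wp \<Lambda> z" "- K" "ball b r" b])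
    have "(\<lambda>z. wp \<Lambda> (z + c)) holomorphic_on - K"
      by (rule holomorphic_on_compose_gen[OF _ wp_holomorphic, unfolded o_def])
         (use K in \<open>auto intro!: holomorphic_intros\<close>)
    moreover have "wp \<Lambda> holomorphic_on - K"
      by (rule holomorphic_on_subset[OF wp_holomorphic]) (use K in auto)
    ultimately show "(\<lambda>z. wp \<Lambda> (z + c) - wp \<Lambda> z) holomorphic_on - K"
      by (intro holomorphic_intros)
    show "open (- K)"
      unfolding K_def using closed_lattice closed_translation_subtract by (intro open_Compl closed_Un) auto
    show "connected (- K)"
      by (intro connected_Compl_countable) (simp add: K_def countable_lattice)
    show bK: "ball b r \<subseteq> - K"
    proof
      fix z assume "z \<in> ball b r"
      then have "z - b \<in> ball 0 r" by (simp add: dist_norm norm_minus_commute)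
      then show "z \<in> - K" using inb[of "z - b"] K[of z] by (simp add: c_def algebra_simps)
    qed
    show "b \<in> - K" using subsetD[OF bK, of b] r by simp
    show "b islimpt ball b r" using r by (simp add: islimpt_ball)
    show "wp \<Lambda> (z + c) - wp \<Lambda> z = 0" if "z \<in> ball b r" for z
    proof -
      have "z - b \<in> ball 0 r" using that by (simp add: dist_norm norm_minus_commute)
      then show ?thesis using d0[of "z - b"] by (simp add: d_def c_def algebra_simps)
    qed
    show "z \<in> - K" using that by simp
  qed
  show ?thesis
  proof (rule ccontr)
    assume "a - b \<notin> \<Lambda>"
    then have c: "c \<notin> \<Lambda>" by (simp add: c_def)
    have contc: "isCont (\<lambda>z. wp \<Lambda> (z + c)) 0"
    proof (rule isCont_o2[of 0 "\<lambda>z. z + c"])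
      show "isCont (wp \<Lambda>) (0 + c)" using DERIV_isCont[OF wp_has_deriv[OF c]] by simp
    qed auto
    have "open ((\<lambda>z. z + c) -` (- \<Lambda>))"
      by (intro open_vimage open_compl continuous_intros)
    then have "\<forall>\<^sub>F z in at 0. z \<in> (\<lambda>z. z + c) -` (- \<Lambda>) - {0}"
      by (rule eventually_at_in_open) (simp add: c)
    \<comment> \<open>Multiplied by z^2, the shifted function tends to 0 at the origin and the
      original one to 1.\<close>
    then have ev: "\<forall>\<^sub>F z in at 0. z\<^sup>2 * wp \<Lambda> (z + c) = z\<^sup>2 * wp \<Lambda> z"
      using eventually_not_lattice[of 0]
    proof eventually_elim
      case (elim z)
      then show ?case using eq0[of z] K[of z] by simp
    qed
    have "(\<lambda>z. z\<^sup>2 * wp \<Lambda> (z + c)) \<midarrow>0\<rightarrow> 0\<^sup>2 * wp \<Lambda> (0 + c)"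
      using contc by (intro tendsto_intros) (simp add: isCont_def)
    then have "(\<lambda>z. z\<^sup>2 * wp \<Lambda> z) \<midarrow>0\<rightarrow> 0\<^sup>2 * wp \<Lambda> (0 + c)"
      using ev by (rule Lim_transform_eventually)
    then show False using LIM_unique[OF wp_lim] by fastforce
  qed
qed

section \<open>The addition theorem\<close>

lemma wp_eq_imp:
  assumes "a \<notin> \<Lambda>" "b \<notin> \<Lambda>" "wp \<Lambda> a = wp \<Lambda> b"
  shows "(wp' a = wp' b \<and> a - b \<in> \<Lambda>) \<or> (wp' a = - wp' b \<and> a + b \<in> \<Lambda>)"
proof -
  have "(wp' a)\<^sup>2 = (wp' b)\<^sup>2" using assms by (simp add: wp_ode)
  then consider "wp' a = wp' b" | "wp' a = - wp' b" by (auto simp: power2_eq_iff)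
  then show ?thesis
  proof cases
    case 1
    then show ?thesis using wp_unique[OF assms(1,2)] assms(3) by blast
  next
    case 2
    then show ?thesis
      using wp_unique[of a "- b"] assms by (simp add: wp_minus deriv_wp_minus)
  qed
qed

text \<open>A zero of \<open>wp'\<close> is a point where z and - z share value and derivative,
  hence a half-period.\<close>

lemma wp'_eq_0_iff:
  assumes "z \<notin> \<Lambda>"
  shows "wp' z = 0 \<longleftrightarrow> 2 * z \<in> \<Lambda>"
proof
  assume "wp' z = 0"
  then show "2 * z \<in> \<Lambda>"
    using wp_unique[of z "- z"] assms by (simp add: wp_minus deriv_wp_minus)
next
  assume "2 * z \<in> \<Lambda>"
  then have "wp' (- z + 2 * z) = wp' (- z)" by (rule deriv_wp_periodic)
  then show "wp' z = 0" using deriv_wp_minus[OF assms] by simp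
qed

text \<open>Along \<open>t + (c - t) = c\<close> the abscissa of the third intersection point of the chord is
  constant: its derivative vanishes by the differential equation. Its value is found by
  letting \<open>t\<close> tend to \<open>0\<close>.\<close>
lemma wp_add:
  assumes z: "z \<notin> \<Lambda>" and w: "w \<notin> \<Lambda>" and zw: "z + w \<notin> \<Lambda>" and neq: "wp \<Lambda> z \<noteq> wp \<Lambda> w"
  shows "wp \<Lambda> (z + w) = ((wp' z - wp' w) / (wp \<Lambda> z - wp \<Lambda> w))\<^sup>2 / 4 - wp \<Lambda> z - wp \<Lambda> w"
proof -
  define c where "c = z + w"
  \<comment> \<open>Excludes the poles and, by \<open>wp_eq_imp\<close>, the zeros of the
    denominator: of the two ways to have equal abscissas, t - (c - t) \<in> \<Lambda> is removed
    here and t + (c - t) = c \<in> \<Lambda> is ruled out beforehand.\<close>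
  define S where "S = {t. t \<notin> \<Lambda> \<and> c - t \<notin> \<Lambda> \<and> 2 * t - c \<notin> \<Lambda>}"
  define \<Phi> where "\<Phi> = (\<lambda>t. ((wp' t - wp' (c - t)) / (wp \<Lambda> t - wp \<Lambda> (c - t)))\<^sup>2 / 4
     - wp \<Lambda> t - wp \<Lambda> (c - t))"
  have c: "c \<notin> \<Lambda>" using zw by (simp add: c_def)
  have neqS: "wp \<Lambda> t \<noteq> wp \<Lambda> (c - t)" if "t \<in> S" for t
    using wp_eq_imp[of t "c - t"] that c by (auto simp: S_def algebra_simps)
  have openU: "open {t. c - t \<notin> \<Lambda> \<and> 2 * t - c \<notin> \<Lambda>}"
  proof -
    have "open ((\<lambda>t. c - t) -` (- \<Lambda>) \<inter> (\<lambda>t. 2 * t - c) -` (- \<Lambda>))"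
      by (intro open_Int open_vimage open_compl continuous_intros)
    then show ?thesis by (simp add: vimage_def Collect_conj_eq)
  qed
  have S_eq: "S = - \<Lambda> \<inter> {t. c - t \<notin> \<Lambda> \<and> 2 * t - c \<notin> \<Lambda>}" by (auto simp: S_def)
  have "open S" unfolding S_eq by (intro open_Int open_compl openU)
  have "connected S"
  proof -
    have "t \<in> (\<lambda>v. c - v) ` \<Lambda>" if "c - t \<in> \<Lambda>" for t
      by (rule image_eqI[of _ _ "c - t"]) (use that in auto)
    moreover have "t \<in> (\<lambda>v. (c + v) / 2) ` \<Lambda>" if "2 * t - c \<in> \<Lambda>" for t
      by (rule image_eqI[of _ _ "2 * t - c"]) (use that in auto)
    ultimately have "- S \<subseteq> \<Lambda> \<union> (\<lambda>v. c - v) ` \<Lambda> \<union> (\<lambda>v. (c + v) / 2) ` \<Lambda>"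
      by (auto simp: S_def)
    then have "countable (- S)"
      by (rule countable_subset) (simp add: countable_lattice)
    then have "connected (- (- S))" by (rule connected_Compl_countable)
    then show ?thesis by simp
  qed
  have zero: "(\<Phi> has_field_derivative 0) (at t)" if t: "t \<in> S" for t
  proof -
    define x1 y1 x2 y2 where "x1 = wp \<Lambda> t" and "y1 = wp' t" and "x2 = wp \<Lambda> (c - t)" and "y2 = wp' (c - t)"
    have in_S: "t \<notin> \<Lambda>" "c - t \<notin> \<Lambda>" using t by (auto simp: S_def)
    have x12: "x1 \<noteq> x2" using neqS[OF t] by (simp add: x1_def x2_def)
    have d: "(wp \<Lambda> has_field_derivative y1) (at t)"
      "(wp' has_field_derivative 6 * x1\<^sup>2 - g2 / 2) (at t)"
      "((\<lambda>t. wp \<Lambda> (c - t)) has_field_derivative - y2) (at t)"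
      "((\<lambda>t. wp' (c - t)) has_field_derivative - (6 * x2\<^sup>2 - g2 / 2)) (at t)"
    proof -
      have "((\<lambda>t. wp \<Lambda> (c - t)) has_field_derivative wp' (c - t) * - 1) (at t)"
        by (rule DERIV_chain2[where g = "\<lambda>t. c - t" and x = t, OF wp_has_deriv[OF in_S(2)]])
           (auto intro!: derivative_eq_intros)
      moreover have "((\<lambda>t. wp' (c - t)) has_field_derivative deriv wp' (c - t) * - 1) (at t)"
        by (rule DERIV_chain2[where g = "\<lambda>t. c - t" and x = t, OF wp'_has_deriv[OF in_S(2)]])
           (auto intro!: derivative_eq_intros)
      ultimately show "(wp \<Lambda> has_field_derivative y1) (at t)"
        "(wp' has_field_derivative 6 * x1\<^sup>2 - g2 / 2) (at t)"
        "((\<lambda>t. wp \<Lambda> (c - t)) has_field_derivative - y2) (at t)"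
        "((\<lambda>t. wp' (c - t)) has_field_derivative - (6 * x2\<^sup>2 - g2 / 2)) (at t)"
        using wp_has_deriv[OF in_S(1)] wp'_has_deriv[OF in_S(1)] wp_ode2[OF in_S(1)] wp_ode2[OF in_S(2)]
        by (simp_all add: x1_def y1_def x2_def y2_def)
    qed
    have ode: "y1\<^sup>2 = 4 * x1 ^ 3 - g2 * x1 - g3" "y2\<^sup>2 = 4 * x2 ^ 3 - g2 * x2 - g3"
      using wp_ode in_S by (auto simp: x1_def x2_def y1_def y2_def)
    define l where "l = (y1 - y2) / (x1 - x2)"
    \<comment> \<open>The derivative of the slope along the motion. The curve equation reduces it to
      2 (x1 - x2), and then (l^2 / 4)' = l (x1 - x2) = y1 - y2 cancels the derivative of - x1 -
      x2.\<close>
    define l' where "l' = (((6 * x1\<^sup>2 - g2 / 2) + (6 * x2\<^sup>2 - g2 / 2)) * (x1 - x2) - (y1 - y2) * (y1 + y2)) / (x1 - x2)\<^sup>2"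
    have "((\<lambda>t. (wp' t - wp' (c - t)) / (wp \<Lambda> t - wp \<Lambda> (c - t))) has_field_derivative l') (at t)"
      by (rule DERIV_cong[OF DERIV_divide[OF DERIV_diff[OF d(2,4)] DERIV_diff[OF d(1,3)]]])
         (use x12 in \<open>auto simp: l'_def x1_def x2_def y1_def y2_def power2_eq_square\<close>)
    then have "((\<lambda>t. ((wp' t - wp' (c - t)) / (wp \<Lambda> t - wp \<Lambda> (c - t)))\<^sup>2) has_field_derivative 2 * l * l') (at t)"
      using DERIV_power[where n = 2] by (force simp: l_def x1_def x2_def y1_def y2_def algebra_simps)
    then have "(\<Phi> has_field_derivative 2 * l * l' / 4 - y1 - (- y2)) (at t)"
      unfolding \<Phi>_def by (intro DERIV_diff d DERIV_cdivide)
    moreover have "l' = 2 * (x1 - x2)"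
    proof -
      have "(y1 - y2) * (y1 + y2) = y1\<^sup>2 - y2\<^sup>2" by (simp add: algebra_simps power2_eq_square)
      then have "((6 * x1\<^sup>2 - g2 / 2) + (6 * x2\<^sup>2 - g2 / 2)) * (x1 - x2) - (y1 - y2) * (y1 + y2)
          = 2 * (x1 - x2) * (x1 - x2)\<^sup>2"
        unfolding ode by (simp add: algebra_simps power2_eq_square power3_eq_cube)
      then show ?thesis using x12 by (simp add: l'_def)
    qed
    moreover have "l * (x1 - x2) = y1 - y2" using x12 by (simp add: l_def)
    moreover have "2 * a * (2 * b) / 4 = a * b" for a b :: complex by simp
    ultimately have "2 * l * (2 * (x1 - x2)) / 4 - y1 - (- y2) = 0" by (simp only:) simp
    moreover note \<open>(\<Phi> has_field_derivative 2 * l * l' / 4 - y1 - (- y2)) (at t)\<close> \<open>l' = 2 * (x1 - x2)\<close>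
    ultimately show ?thesis by simp
  qed
  obtain k where k: "\<And>t. t \<in> S \<Longrightarrow> \<Phi> t = k"
    using DERIV_zero_connected_constant[OF \<open>connected S\<close> \<open>open S\<close> finite.emptyI, of \<Phi>]
      zero \<open>open S\<close> DERIV_isCont by (metis Diff_empty continuous_at_imp_continuous_on)
  have ev: "\<forall>\<^sub>F t in at 0. t \<in> S \<and> t \<noteq> 0"
  proof -
    have "\<forall>\<^sub>F t in at 0. t \<in> {t. c - t \<notin> \<Lambda> \<and> 2 * t - c \<notin> \<Lambda>} - {0}"
      using openU by (rule eventually_at_in_open) (use c in simp)
    then show ?thesis using eventually_not_lattice[of 0]
      by eventually_elim (auto simp: S_def)
  qed
  have contc: "isCont (\<lambda>t. f (c - t)) 0" if "isCont f c" for f :: "complex \<Rightarrow> complex"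
    by (rule isCont_o2[of 0 "\<lambda>t. c - t"]) (use that in auto)
  have lim2: "(\<lambda>t. wp \<Lambda> (c - t)) \<midarrow>0\<rightarrow> wp \<Lambda> c" "(\<lambda>t. wp' (c - t)) \<midarrow>0\<rightarrow> wp' c"
    using contc[OF DERIV_isCont[OF wp_has_deriv[OF c]]] contc[OF DERIV_isCont[OF wp'_has_deriv[OF c]]]
    by (simp_all add: isCont_def)
  define u where "u = (\<lambda>t. t\<^sup>2 * wp \<Lambda> t)"
  define v where "v = (\<lambda>t. t ^ 3 * wp' t)"
  \<comment> \<open>\<open>\<Phi>\<close> with numerator and denominator divided by x1^2, written
    through 1 / x1 = t^2 / u and y1 / x1^2 = t v / u^2. Both tend to 0, so the limit 2 x2 - x2 at
    the pole can be read off.\<close>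
  define \<Psi> where "\<Psi> = (\<lambda>t. (2 * wp \<Lambda> (c - t) + (- g2 / 4 * (t\<^sup>2 / u t) - g3 / 4 * (t\<^sup>2 / u t)\<^sup>2
     - t * v t / (u t)\<^sup>2 * wp' (c - t) / 2 + (wp' (c - t))\<^sup>2 / 4 * (t\<^sup>2 / u t)\<^sup>2
     - (wp \<Lambda> (c - t))\<^sup>2 * (t\<^sup>2 / u t))) / (1 - wp \<Lambda> (c - t) * (t\<^sup>2 / u t))\<^sup>2 - wp \<Lambda> (c - t))"
  have "\<Psi> \<midarrow>0\<rightarrow> (2 * wp \<Lambda> c + (- g2 / 4 * (0\<^sup>2 / 1) - g3 / 4 * (0\<^sup>2 / 1)\<^sup>2
     - 0 * - 2 / 1\<^sup>2 * wp' c / 2 + (wp' c)\<^sup>2 / 4 * (0\<^sup>2 / 1)\<^sup>2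
     - (wp \<Lambda> c)\<^sup>2 * (0\<^sup>2 / 1))) / (1 - wp \<Lambda> c * (0\<^sup>2 / 1))\<^sup>2 - wp \<Lambda> c"
    unfolding \<Psi>_def
    by (intro tendsto_intros lim2 wp_lim[folded u_def] wp'_lim[folded v_def]) auto
  then have lim\<Psi>: "\<Psi> \<midarrow>0\<rightarrow> wp \<Lambda> c" by simp
  have "\<forall>\<^sub>F t in at 0. u t \<noteq> 0"
    using wp_lim[folded u_def] by (rule tendsto_imp_eventually_ne) simp
  with ev have "\<forall>\<^sub>F t in at 0. \<Psi> t = k"
  proof eventually_elim
    case (elim t)
    define x1 y1 x2 y2 where "x1 = wp \<Lambda> t" and "y1 = wp' t" and "x2 = wp \<Lambda> (c - t)" and "y2 = wp' (c - t)"
    have "x1 \<noteq> x2" using neqS elim by (simp add: x1_def x2_def)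
    have "t \<noteq> 0" and x1: "x1 \<noteq> 0" using elim by (auto simp: u_def x1_def)
    have ode: "y1\<^sup>2 = 4 * x1 ^ 3 - g2 * x1 - g3"
      using wp_ode elim by (auto simp: x1_def y1_def S_def)
    have tu: "t\<^sup>2 / u t = 1 / x1" "t * v t / (u t)\<^sup>2 = y1 / x1\<^sup>2"
      using \<open>t \<noteq> 0\<close> x1 by (simp_all add: u_def v_def x1_def y1_def field_simps eval_nat_numeral)
    have "\<Psi> t = (2 * x2 + (- g2 / 4 * (1 / x1) - g3 / 4 * (1 / x1)\<^sup>2 - y1 / x1\<^sup>2 * y2 / 2
        + y2\<^sup>2 / 4 * (1 / x1)\<^sup>2 - x2\<^sup>2 * (1 / x1))) / (1 - x2 * (1 / x1))\<^sup>2 - x2"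
      unfolding \<Psi>_def tu by (simp add: x2_def y2_def)
    also have "2 * x2 + (- g2 / 4 * (1 / x1) - g3 / 4 * (1 / x1)\<^sup>2 - y1 / x1\<^sup>2 * y2 / 2
        + y2\<^sup>2 / 4 * (1 / x1)\<^sup>2 - x2\<^sup>2 * (1 / x1)) =
        (2 * x2 * x1\<^sup>2 - g2 / 4 * x1 - g3 / 4 - y1 * y2 / 2 + y2\<^sup>2 / 4 - x2\<^sup>2 * x1) / x1\<^sup>2"
      using x1 by (simp add: field_simps power2_eq_square)
    \<comment> \<open>Replacing y1^2 by the cubic cancels the x1^3 of x1 (x1 - x2)^2, the only term
      that would outgrow x1^2.\<close>
    also have "2 * x2 * x1\<^sup>2 - g2 / 4 * x1 - g3 / 4 - y1 * y2 / 2 + y2\<^sup>2 / 4 - x2\<^sup>2 * x1 =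
        (y1 - y2)\<^sup>2 / 4 - x1 * (x1 - x2)\<^sup>2"
    proof -
      have e: "(y1 - y2)\<^sup>2 = 4 * x1 ^ 3 - g2 * x1 - g3 - 2 * y1 * y2 + y2\<^sup>2"
        unfolding power2_diff ode by simp
      show ?thesis
        unfolding e by (simp add: add_divide_distrib diff_divide_distrib algebra_simps power2_eq_square power3_eq_cube)
    qed
    also have "(1 - x2 * (1 / x1))\<^sup>2 = (x1 - x2)\<^sup>2 / x1\<^sup>2"
      using x1 by (simp add: field_simps power2_eq_square)
    also have "((y1 - y2)\<^sup>2 / 4 - x1 * (x1 - x2)\<^sup>2) / x1\<^sup>2 / ((x1 - x2)\<^sup>2 / x1\<^sup>2) - x2 = \<Phi> t"
    proof -
      have "((y1 - y2)\<^sup>2 / 4 - x1 * (x1 - x2)\<^sup>2) / x1\<^sup>2 / ((x1 - x2)\<^sup>2 / x1\<^sup>2) =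
          ((y1 - y2)\<^sup>2 / 4 - x1 * (x1 - x2)\<^sup>2) / (x1 - x2)\<^sup>2"
        using x1 by simp
      also have "\<dots> = ((y1 - y2) / (x1 - x2))\<^sup>2 / 4 - x1"
      proof -
        have "(A / 4 - x1 * B) / B = A / B / 4 - x1" if "B \<noteq> 0" for A B :: complex
          using that by (simp add: field_simps)
        then show ?thesis using \<open>x1 \<noteq> x2\<close> by (simp add: power_divide)
      qed
      finally show ?thesis by (simp add: \<Phi>_def x1_def x2_def y1_def y2_def)
    qed
    finally show ?case using k elim by simp
  qed
  then have "(\<lambda>_::complex. k) \<midarrow>0\<rightarrow> wp \<Lambda> c" by (rule Lim_transform_eventually[OF lim\<Psi>])
  then have "k = wp \<Lambda> c" using LIM_const_eq by blast
  moreover have "z \<in> S"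
  proof -
    have "z - w \<notin> \<Lambda>"
    proof
      assume "z - w \<in> \<Lambda>"
      then have "wp \<Lambda> (w + (z - w)) = wp \<Lambda> w" by (rule wp_periodic)
      then show False using neq by simp
    qed
    then show ?thesis using z w by (simp add: S_def c_def)
  qed
  ultimately have "\<Phi> z = wp \<Lambda> c" using k by simp
  then show ?thesis by (simp add: \<Phi>_def c_def)
qed

text \<open>The addition formula is differentiated in z with w fixed; the curve equation identifies
  the derivative of the slope as 2 (x1 - x3), which gives the ordinate on the chord.\<close>

lemma wp'_add:
  assumes z: "z \<notin> \<Lambda>" and w: "w \<notin> \<Lambda>" and zw: "z + w \<notin> \<Lambda>" and neq: "wp \<Lambda> z \<noteq> wp \<Lambda> w"
  shows "wp' (z + w) = - (wp' z + (wp' z - wp' w) / (wp \<Lambda> z - wp \<Lambda> w) * (wp \<Lambda> (z + w) - wp \<Lambda> z))"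
proof -
  define x1 y1 x2 y2 where "x1 = wp \<Lambda> z" and "y1 = wp' z" and "x2 = wp \<Lambda> w" and "y2 = wp' w"
  have x12: "x1 \<noteq> x2" using neq by (simp add: x1_def x2_def)
  have ode: "y1\<^sup>2 = 4 * x1 ^ 3 - g2 * x1 - g3" "y2\<^sup>2 = 4 * x2 ^ 3 - g2 * x2 - g3"
    using wp_ode z w by (auto simp: x1_def x2_def y1_def y2_def)
  have d: "(wp \<Lambda> has_field_derivative y1) (at z)" "(wp' has_field_derivative 6 * x1\<^sup>2 - g2 / 2) (at z)"
    using wp_has_deriv[OF z] wp'_has_deriv[OF z] by (auto simp: wp_ode2[OF z] x1_def y1_def)
  define l where "l = (y1 - y2) / (x1 - x2)"
  define l' where "l' = ((6 * x1\<^sup>2 - g2 / 2) * (x1 - x2) - (y1 - y2) * y1) / (x1 - x2)\<^sup>2"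
  have "((\<lambda>t. (wp' t - y2) / (wp \<Lambda> t - x2)) has_field_derivative l') (at z)"
    by (rule DERIV_cong[OF DERIV_divide[OF DERIV_diff[OF d(2) DERIV_const] DERIV_diff[OF d(1) DERIV_const]]])
       (use x12 in \<open>auto simp: l'_def x1_def y1_def power2_eq_square\<close>)
  then have "((\<lambda>t. ((wp' t - y2) / (wp \<Lambda> t - x2))\<^sup>2) has_field_derivative 2 * l * l') (at z)"
    using DERIV_power[where n = 2] by (force simp: l_def x1_def y1_def algebra_simps)
  then have "((\<lambda>t. ((wp' t - y2) / (wp \<Lambda> t - x2))\<^sup>2 / 4 - wp \<Lambda> t - x2) has_field_derivative
      2 * l * l' / 4 - y1 - 0) (at z)"
    by (intro DERIV_diff d DERIV_cdivide DERIV_const)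
  \<comment> \<open>An open neighbourhood of z on which the addition formula holds, as
    differentiating it requires.\<close>
  moreover define U where "U = - \<Lambda> \<inter> (\<lambda>t. t + w) -` (- \<Lambda>) \<inter> (- \<Lambda> \<inter> wp \<Lambda> -` (- {x2}))"
  have "open U"
  proof -
    have "open (- \<Lambda> \<inter> wp \<Lambda> -` (- {x2}))"
      by (rule continuous_open_preimage[OF holomorphic_on_imp_continuous_on[OF wp_holomorphic] open_compl]) auto
    moreover have "open ((\<lambda>t. t + w) -` (- \<Lambda>))"
      by (intro open_vimage open_compl continuous_intros)
    ultimately show ?thesis unfolding U_def by (meson open_Int open_compl)
  qed
  moreover have "z \<in> U" using z zw neq by (simp add: U_def x2_def)
  moreover have "((wp' t - y2) / (wp \<Lambda> t - x2))\<^sup>2 / 4 - wp \<Lambda> t - x2 = wp \<Lambda> (t + w)" if "t \<in> U" for t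
    using wp_add[of t w] w that by (simp add: U_def x2_def y2_def)
  ultimately have "((\<lambda>t. wp \<Lambda> (t + w)) has_field_derivative 2 * l * l' / 4 - y1 - 0) (at z)"
    by (rule has_field_derivative_transform_within_open)
  moreover have "((\<lambda>t. wp \<Lambda> (t + w)) has_field_derivative wp' (z + w)) (at z)"
    using wp_has_deriv[OF zw] by (simp add: DERIV_shift)
  ultimately have eq: "wp' (z + w) = l * l' / 2 - y1" using DERIV_unique by fastforce
  define x3 where "x3 = wp \<Lambda> (z + w)"
  have x3: "x3 = l\<^sup>2 / 4 - x1 - x2"
    using wp_add[OF assms] by (simp add: x3_def l_def x1_def x2_def y1_def y2_def)
  \<comment> \<open>The combination 2 (y1 - y2) y1 - (y1 - y2)^2 = y1^2 - y2^2 is accessible to the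
    curve equation; the leftover (y1 - y2)^2 is absorbed by the slope.\<close>
  have "l' / 2 = x1 - x3"
  proof -
    have "2 * ((6 * x1\<^sup>2 - g2 / 2) * (x1 - x2) - (y1 - y2) * y1) = 4 * (2 * x1 + x2) * (x1 - x2)\<^sup>2 - (y1 - y2)\<^sup>2"
    proof -
      have "2 * (y1 - y2) * y1 - (y1 - y2)\<^sup>2 = y1\<^sup>2 - y2\<^sup>2" by (simp add: algebra_simps power2_eq_square)
      also have "\<dots> = 4 * x1 ^ 3 - g2 * x1 - (4 * x2 ^ 3 - g2 * x2)" unfolding ode by simp
      finally show ?thesis
        by (simp add: add_divide_distrib diff_divide_distrib algebra_simps power2_eq_square power3_eq_cube)
    qed
    then have "2 * l' * (x1 - x2)\<^sup>2 = 4 * (2 * x1 + x2) * (x1 - x2)\<^sup>2 - (y1 - y2)\<^sup>2"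
      using x12 by (simp add: l'_def)
    moreover have "(y1 - y2)\<^sup>2 = l\<^sup>2 * (x1 - x2)\<^sup>2"
      using x12 by (simp add: l_def power_divide)
    ultimately have "(2 * l') * (x1 - x2)\<^sup>2 = (4 * (2 * x1 + x2) - l\<^sup>2) * (x1 - x2)\<^sup>2"
      by (simp add: algebra_simps)
    then have "2 * l' = 4 * (2 * x1 + x2) - l\<^sup>2" using x12 by simp
    then show ?thesis unfolding x3 by (simp add: field_simps)
  qed
  then have "wp' (z + w) = l * (x1 - x3) - y1" using eq by (metis times_divide_eq_right)
  then have "wp' (z + w) = - (y1 + l * (x3 - x1))" by (simp add: algebra_simps)
  then show ?thesis by (simp add: l_def x1_def x2_def x3_def y1_def y2_def)
qed

text \<open>The limit z \<rightarrow> w of the two chord formulas. The chord slope is a quotient of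
  difference quotients and tends to \<open>wp''\<close> / \<open>wp'\<close>, the slope of the
  tangent.\<close>

lemma wp_double:
  assumes w: "w \<notin> \<Lambda>" and nz: "wp' w \<noteq> 0"
  defines "l \<equiv> (12 * (wp \<Lambda> w)\<^sup>2 - g2) / (2 * wp' w)"
  shows "wp \<Lambda> (2 * w) = l\<^sup>2 / 4 - wp \<Lambda> w - wp \<Lambda> w"
    and "wp' (2 * w) = - (wp' w + l * (wp \<Lambda> (2 * w) - wp \<Lambda> w))"
proof -
  have w2: "w + w \<notin> \<Lambda>" using wp'_eq_0_iff[OF w] nz by (metis mult_2)
  define m where "m = (\<lambda>z. (wp' z - wp' w) / (wp \<Lambda> z - wp \<Lambda> w))"
  have lims: "(\<lambda>z. (wp \<Lambda> z - wp \<Lambda> w) / (z - w)) \<midarrow>w\<rightarrow> wp' w"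
    "(\<lambda>z. (wp' z - wp' w) / (z - w)) \<midarrow>w\<rightarrow> 6 * (wp \<Lambda> w)\<^sup>2 - g2 / 2"
    using wp_has_deriv[OF w] wp'_has_deriv[OF w] by (simp_all add: has_field_derivative_iff wp_ode2[OF w])
  have "(\<lambda>z. ((wp' z - wp' w) / (z - w)) / ((wp \<Lambda> z - wp \<Lambda> w) / (z - w))) \<midarrow>w\<rightarrow>
      (6 * (wp \<Lambda> w)\<^sup>2 - g2 / 2) / wp' w"
    using nz by (intro tendsto_divide lims)
  moreover have "(6 * (wp \<Lambda> w)\<^sup>2 - g2 / 2) / wp' w = l"
    using nz by (simp add: l_def field_simps)
  ultimately have lim: "(\<lambda>z. ((wp' z - wp' w) / (z - w)) / ((wp \<Lambda> z - wp \<Lambda> w) / (z - w))) \<midarrow>w\<rightarrow> l"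
    by simp
  have "\<forall>\<^sub>F z in at w. z \<noteq> w" by (simp add: eventually_at_filter)
  then have "\<forall>\<^sub>F z in at w. ((wp' z - wp' w) / (z - w)) / ((wp \<Lambda> z - wp \<Lambda> w) / (z - w)) = m z"
    by eventually_elim (simp add: m_def)
  with lim have m: "m \<midarrow>w\<rightarrow> l" by (rule Lim_transform_eventually)
  have "\<forall>\<^sub>F z in at w. (wp \<Lambda> z - wp \<Lambda> w) / (z - w) \<noteq> 0"
    using lims(1) nz by (rule tendsto_imp_eventually_ne)
  moreover have "\<forall>\<^sub>F z in at w. z \<in> (\<lambda>z. z + w) -` (- \<Lambda>) - {w}"
    by (intro eventually_at_in_open open_vimage open_compl continuous_intros) (use w2 in auto)
  ultimately have ev: "\<forall>\<^sub>F z in at w. z \<notin> \<Lambda> \<and> z + w \<notin> \<Lambda> \<and> wp \<Lambda> z \<noteq> wp \<Lambda> w"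
    using eventually_not_lattice[of w] by eventually_elim auto
  have shift: "(\<lambda>z. f (z + w)) \<midarrow>w\<rightarrow> f (w + w)" if "isCont f (w + w)" for f :: "complex \<Rightarrow> complex"
  proof -
    have "isCont (\<lambda>z. f (z + w)) w"
      by (rule isCont_o2[of w "\<lambda>z. z + w", OF _ that]) (intro continuous_intros)
    then show ?thesis by (simp only: isCont_def)
  qed
  have s1: "(\<lambda>z. wp \<Lambda> (z + w)) \<midarrow>w\<rightarrow> wp \<Lambda> (w + w)"
    by (intro shift DERIV_isCont[OF wp_has_deriv[OF w2]])
  have s2: "(\<lambda>z. wp' (z + w)) \<midarrow>w\<rightarrow> wp' (w + w)"
    by (intro shift DERIV_isCont[OF wp'_has_deriv[OF w2]])
  have c1: "wp \<Lambda> \<midarrow>w\<rightarrow> wp \<Lambda> w" and c2: "wp' \<midarrow>w\<rightarrow> wp' w"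
    using DERIV_isCont[OF wp_has_deriv[OF w]] DERIV_isCont[OF wp'_has_deriv[OF w]]
    by (simp_all add: isCont_def)
  have "(\<lambda>z. (m z)\<^sup>2 / 4 - wp \<Lambda> z - wp \<Lambda> w) \<midarrow>w\<rightarrow> l\<^sup>2 / 4 - wp \<Lambda> w - wp \<Lambda> w"
    by (intro tendsto_intros m c1) auto
  moreover have "\<forall>\<^sub>F z in at w. (m z)\<^sup>2 / 4 - wp \<Lambda> z - wp \<Lambda> w = wp \<Lambda> (z + w)"
    using ev by eventually_elim (use wp_add w in \<open>simp add: m_def\<close>)
  ultimately have "(\<lambda>z. wp \<Lambda> (z + w)) \<midarrow>w\<rightarrow> l\<^sup>2 / 4 - wp \<Lambda> w - wp \<Lambda> w"
    by (rule Lim_transform_eventually)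
  then show "wp \<Lambda> (2 * w) = l\<^sup>2 / 4 - wp \<Lambda> w - wp \<Lambda> w"
    unfolding mult_2 by (rule LIM_unique[OF s1])
  have "(\<lambda>z. - (wp' z + m z * (wp \<Lambda> (z + w) - wp \<Lambda> z))) \<midarrow>w\<rightarrow> - (wp' w + l * (wp \<Lambda> (w + w) - wp \<Lambda> w))"
    by (intro tendsto_intros m c1 c2 s1)
  moreover have "\<forall>\<^sub>F z in at w. - (wp' z + m z * (wp \<Lambda> (z + w) - wp \<Lambda> z)) = wp' (z + w)"
    using ev by eventually_elim (use wp'_add w in \<open>simp add: m_def\<close>)
  ultimately have "(\<lambda>z. wp' (z + w)) \<midarrow>w\<rightarrow> - (wp' w + l * (wp \<Lambda> (w + w) - wp \<Lambda> w))"
    by (rule Lim_transform_eventually)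
  then show "wp' (2 * w) = - (wp' w + l * (wp \<Lambda> (2 * w) - wp \<Lambda> w))"
    unfolding mult_2 by (rule LIM_unique[OF s2])
qed

end

section \<open>Real lattices\<close>

text \<open>Near 0 the difference d satisfies z^2 d'' = q d with q \<rightarrow> 6 (1 + 1) = 12, so
  a zero of finite order n has n (n - 1) = 12, in particular n < 6. Equal invariants, however, give
  d the factor z^6. Hence d vanishes near 0, and then off both lattices by continuation.\<close>

lemma wp_determined:
  assumes L1: "complex_lattice \<Lambda>1" and L2: "complex_lattice \<Lambda>2"
    and g: "lattice_g2 \<Lambda>1 = lattice_g2 \<Lambda>2" "lattice_g3 \<Lambda>1 = lattice_g3 \<Lambda>2"
    and z: "z \<notin> \<Lambda>1" "z \<notin> \<Lambda>2"
  shows "wp \<Lambda>1 z = wp \<Lambda>2 z"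
proof -
  interpret L1: complex_lattice \<Lambda>1 by fact
  interpret L2: complex_lattice \<Lambda>2 by fact
  obtain r1 \<psi>1 where r1: "r1 > 0" and \<psi>1: "\<psi>1 holomorphic_on ball 0 r1"
    and n1: "\<And>z. z \<in> ball 0 r1 \<Longrightarrow> z \<noteq> 0 \<Longrightarrow> z \<notin> \<Lambda>1"
    and e1: "\<And>z. z \<in> ball 0 r1 \<Longrightarrow>
       wp \<Lambda>1 z = 1 / z\<^sup>2 + lattice_g2 \<Lambda>1 / 20 * z\<^sup>2 + lattice_g3 \<Lambda>1 / 28 * z ^ 4 + z ^ 6 * \<psi>1 z"
    by (rule L1.wp_expansion) blast
  obtain r2 \<psi>2 where r2: "r2 > 0" and \<psi>2: "\<psi>2 holomorphic_on ball 0 r2"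
    and n2: "\<And>z. z \<in> ball 0 r2 \<Longrightarrow> z \<noteq> 0 \<Longrightarrow> z \<notin> \<Lambda>2"
    and e2: "\<And>z. z \<in> ball 0 r2 \<Longrightarrow>
       wp \<Lambda>2 z = 1 / z\<^sup>2 + lattice_g2 \<Lambda>2 / 20 * z\<^sup>2 + lattice_g3 \<Lambda>2 / 28 * z ^ 4 + z ^ 6 * \<psi>2 z"
    by (rule L2.wp_expansion) blast
  define r where "r = min r1 r2"
  have r: "r > 0" using r1 r2 by (simp add: r_def)
  define d where "d = (\<lambda>z. z ^ 6 * (\<psi>1 z - \<psi>2 z))"
  have hol: "(\<lambda>z. \<psi>1 z - \<psi>2 z) holomorphic_on ball 0 r"
    by (intro holomorphic_intros holomorphic_on_subset[OF \<psi>1] holomorphic_on_subset[OF \<psi>2])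
       (auto simp: r_def)
  have hd: "d holomorphic_on ball 0 r" unfolding d_def by (intro holomorphic_intros hol)
  have nin: "z \<notin> \<Lambda>1" "z \<notin> \<Lambda>2" if "z \<in> ball 0 r - {0}" for z
    using that n1 n2 by (auto simp: r_def)
  have d_eq: "d z = wp \<Lambda>1 z - wp \<Lambda>2 z" if "z \<in> ball 0 r" for z
    using that e1[of z] e2[of z] g by (simp add: d_def r_def algebra_simps)
  let ?S = "ball 0 r - {0 :: complex}"
  have S: "open ?S" by auto
  have d1: "(d has_field_derivative deriv (wp \<Lambda>1) z - deriv (wp \<Lambda>2) z) (at z)" if z: "z \<in> ?S" for z
  proof (rule has_field_derivative_transform_within_open[OF _ S z])
    show "((\<lambda>z. wp \<Lambda>1 z - wp \<Lambda>2 z) has_field_derivative deriv (wp \<Lambda>1) z - deriv (wp \<Lambda>2) z) (at z)"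
      by (intro DERIV_diff L1.wp_has_deriv L2.wp_has_deriv nin z)
  qed (use d_eq in auto)
  have d2: "deriv (deriv d) z = 6 * (wp \<Lambda>1 z + wp \<Lambda>2 z) * d z" if z: "z \<in> ?S" for z
  proof -
    have "(deriv d has_field_derivative deriv (deriv (wp \<Lambda>1)) z - deriv (deriv (wp \<Lambda>2)) z) (at z)"
    proof (rule has_field_derivative_transform_within_open[OF _ S z])
      show "((\<lambda>z. deriv (wp \<Lambda>1) z - deriv (wp \<Lambda>2) z) has_field_derivative
          deriv (deriv (wp \<Lambda>1)) z - deriv (deriv (wp \<Lambda>2)) z) (at z)"
        by (intro DERIV_diff L1.wp'_has_deriv L2.wp'_has_deriv nin z)
    qed (use d1 DERIV_imp_deriv in metis)
    then have "deriv (deriv d) z = deriv (deriv (wp \<Lambda>1)) z - deriv (deriv (wp \<Lambda>2)) z"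
      by (rule DERIV_imp_deriv)
    moreover have dz: "d z = wp \<Lambda>1 z - wp \<Lambda>2 z" using d_eq z by simp
    ultimately show ?thesis
      unfolding dz L1.wp_ode2[OF nin(1)[OF z]] L2.wp_ode2[OF nin(2)[OF z]] g
      by (simp add: algebra_simps power2_eq_square)
  qed
  have d0: "d s = 0" if s: "s \<in> ball 0 r" for s
  proof (rule ccontr)
    assume "d s \<noteq> 0"
    show False
    proof (rule ode_order_of_zero[OF hd r _ _ _ s \<open>d s \<noteq> 0\<close>])
      show "z\<^sup>2 * deriv (deriv d) z = (6 * (z\<^sup>2 * wp \<Lambda>1 z + z\<^sup>2 * wp \<Lambda>2 z)) * d z"
        if "z \<in> ball 0 r - {0}" for z using d2[OF that] by (simp add: algebra_simps)
      have "(\<lambda>z. 6 * (z\<^sup>2 * wp \<Lambda>1 z + z\<^sup>2 * wp \<Lambda>2 z)) \<midarrow>0\<rightarrow> 6 * (1 + 1)"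
        by (intro tendsto_intros L1.wp_lim L2.wp_lim)
      then show "(\<lambda>z. 6 * (z\<^sup>2 * wp \<Lambda>1 z + z\<^sup>2 * wp \<Lambda>2 z)) \<midarrow>0\<rightarrow> 12" by simp
      show "d 0 = 0" by (simp add: d_def)
      fix n g \<rho>
      assume n: "n > 0" "0 < \<rho>" "ball (0 :: complex) \<rho> \<subseteq> ball 0 r" "g holomorphic_on ball 0 \<rho>"
        "\<And>z. z \<in> ball 0 \<rho> \<Longrightarrow> d z = z ^ n * g z" "g 0 \<noteq> 0" "of_nat n * (of_nat n - 1) = (12::complex)"
      have "(of_nat (n * n) :: complex) = of_nat (n + 12)" using n(7) by (simp add: algebra_simps)
      then have nn: "n * n = n + 12" unfolding of_nat_eq_iff .
      have "n < 6"
      proof (rule ccontr)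
        assume "\<not> n < 6"
        then have "6 * n \<le> n * n" by simp
        then show False using nn \<open>\<not> n < 6\<close> by linarith
      qed
      have cont: "h \<midarrow>0\<rightarrow> h 0" if "h holomorphic_on ball 0 R" "R > 0" for h :: "complex \<Rightarrow> complex" and R
        using that by (metis centre_in_ball continuous_on_eq_continuous_at holomorphic_on_imp_continuous_on open_ball isCont_def)
      \<comment> \<open>After division by z^n a positive power of z remains, which forces the
        cofactor g to vanish at 0.\<close>
      have "(\<lambda>z. z ^ (6 - n) * (\<psi>1 z - \<psi>2 z)) \<midarrow>0\<rightarrow> 0 ^ (6 - n) * (\<psi>1 0 - \<psi>2 0)"
        by (intro tendsto_intros cont[OF hol r])
      moreover have "\<forall>\<^sub>F z in at 0. z \<in> ball 0 \<rho> - {0}"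
        using n(2) by (intro eventually_at_in_open) auto
      then have "\<forall>\<^sub>F z in at 0. z ^ (6 - n) * (\<psi>1 z - \<psi>2 z) = g z"
      proof eventually_elim
        case (elim z)
        have "z ^ n * g z = z ^ 6 * (\<psi>1 z - \<psi>2 z)" using n(5)[of z] elim by (simp add: d_def)
        also have "z ^ 6 = z ^ n * z ^ (6 - n)" using \<open>n < 6\<close> by (simp flip: power_add)
        finally have "z ^ n * g z = z ^ n * (z ^ (6 - n) * (\<psi>1 z - \<psi>2 z))" by (simp only: mult.assoc)
        then show ?case using elim by simp
      qed
      ultimately have "g \<midarrow>0\<rightarrow> 0 ^ (6 - n) * (\<psi>1 0 - \<psi>2 0)" by (rule Lim_transform_eventually)
      then have "g 0 = 0 ^ (6 - n) * (\<psi>1 0 - \<psi>2 0)"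
        using LIM_unique[OF cont[OF n(4,2)]] by blast
      then show False using n(6) \<open>n < 6\<close> by simp
    qed
  qed
  define \<xi> :: complex where "\<xi> = of_real (r / 2)"
  have \<xi>: "\<xi> \<in> ?S" using r by (simp add: \<xi>_def)
  have "wp \<Lambda>1 z - wp \<Lambda>2 z = 0"
  proof (rule analytic_continuation[of "\<lambda>z. wp \<Lambda>1 z - wp \<Lambda>2 z" "- (\<Lambda>1 \<union> \<Lambda>2)" ?S \<xi>])
    show "(\<lambda>z. wp \<Lambda>1 z - wp \<Lambda>2 z) holomorphic_on - (\<Lambda>1 \<union> \<Lambda>2)"
      by (intro holomorphic_intros holomorphic_on_subset[OF L1.wp_holomorphic]
          holomorphic_on_subset[OF L2.wp_holomorphic]) auto
    show "open (- (\<Lambda>1 \<union> \<Lambda>2))"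
      using L1.closed_lattice L2.closed_lattice by (intro open_Compl closed_Un)
    show "connected (- (\<Lambda>1 \<union> \<Lambda>2))"
      by (intro connected_Compl_countable countable_Un L1.countable_lattice L2.countable_lattice)
    show "?S \<subseteq> - (\<Lambda>1 \<union> \<Lambda>2)" using nin by blast
    then show "\<xi> \<in> - (\<Lambda>1 \<union> \<Lambda>2)" using \<xi> by blast
    show "\<xi> islimpt ?S" using interior_limit_point[of \<xi> ?S] \<xi> S by (simp add: interior_open)
    show "wp \<Lambda>1 z - wp \<Lambda>2 z = 0" if "z \<in> ?S" for z using that d_eq[of z] d0[of z] by simp
    show "z \<in> - (\<Lambda>1 \<union> \<Lambda>2)" using z by simp
  qed
  then show ?thesis by simp
qed

context complex_lattice
begin

lemma cnj_lattice: "complex_lattice (cnj ` \<Lambda>)"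
proof -
  obtain w1 w2 where w: "w1 \<noteq> 0" "Im (w2 / w1) \<noteq> 0"
      "\<Lambda> = {of_int m * w1 + of_int n * w2 | m n. True}"
    using lattice unfolding is_lattice_def by blast
  have "cnj ` \<Lambda> = {of_int m * cnj w1 + of_int n * cnj w2 | m n. True}"
  proof (intro subset_antisym subsetI)
    fix v assume "v \<in> {of_int m * cnj w1 + of_int n * cnj w2 | m n. True}"
    then obtain m n where "v = cnj (of_int m * w1 + of_int n * w2)" by auto
    then show "v \<in> cnj ` \<Lambda>" unfolding w(3) by blast
  next
    fix v assume "v \<in> cnj ` \<Lambda>"
    then obtain m n where "v = cnj (of_int m * w1 + of_int n * w2)" unfolding w(3) by blast
    then have "v = of_int m * cnj w1 + of_int n * cnj w2" by simp
    then show "v \<in> {of_int m * cnj w1 + of_int n * cnj w2 | m n. True}" by blast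
  qed
  moreover have "Im (cnj w2 / cnj w1) \<noteq> 0"
    using w(2) by (metis cnj.sel(2) complex_cnj_divide neg_equal_0_iff_equal)
  ultimately have "is_lattice (cnj ` \<Lambda>)"
    using w(1) unfolding is_lattice_def by (metis complex_cnj_zero_iff)
  then show ?thesis by unfold_locales
qed

lemma infsum_cnj_lattice:
  assumes "\<And>w. f (cnj w) = cnj (g w)"
  shows "(\<Sum>\<^sub>\<infinity>w\<in>cnj ` \<Lambda> - {0}. f w) = cnj (\<Sum>\<^sub>\<infinity>w\<in>\<Lambda> - {0}. g w)"
proof -
  have "bij_betw cnj (\<Lambda> - {0}) (cnj ` \<Lambda> - {0})"
    by (rule bij_betwI[of _ _ _ cnj]) auto
  then have "(\<Sum>\<^sub>\<infinity>w\<in>cnj ` \<Lambda> - {0}. f w) = (\<Sum>\<^sub>\<infinity>w\<in>\<Lambda> - {0}. f (cnj w))"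
    by (rule infsum_reindex_bij_betw[symmetric])
  then show ?thesis by (simp add: assms)
qed

text \<open>With real invariants \<Lambda> and its conjugate have the same \<open>wp\<close>
  wherever both are regular, while at a real argument the function of the conjugate lattice takes
  the conjugate value.\<close>

lemma wp_of_real:
  assumes "g2 \<in> \<real>" "g3 \<in> \<real>" and t: "complex_of_real t \<notin> \<Lambda>"
  shows "wp \<Lambda> (of_real t) \<in> \<real>"
proof -
  have "lattice_g2 (cnj ` \<Lambda>) = cnj g2" "lattice_g3 (cnj ` \<Lambda>) = cnj g3"
    unfolding lattice_g2_def lattice_g3_def complex_cnj_mult
    by (subst infsum_cnj_lattice; simp)+
  moreover have "cnj g2 = g2" "cnj g3 = g3" using assms by (auto simp: Reals_cnj_iff)
  moreover have "complex_of_real t \<notin> cnj ` \<Lambda>"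
    using t by (metis complex_cnj_cnj complex_cnj_complex_of_real imageE)
  ultimately have "wp (cnj ` \<Lambda>) (of_real t) = wp \<Lambda> (of_real t)"
    using t by (intro wp_determined cnj_lattice complex_lattice_axioms) auto
  moreover have "wp (cnj ` \<Lambda>) (of_real t) = cnj (wp \<Lambda> (of_real t))"
  proof -
    have "(\<Sum>\<^sub>\<infinity>w\<in>cnj ` \<Lambda> - {0}. 1 / (of_real t - w)\<^sup>2 - 1 / w\<^sup>2) =
        cnj (\<Sum>\<^sub>\<infinity>w\<in>\<Lambda> - {0}. 1 / (of_real t - w)\<^sup>2 - 1 / w\<^sup>2)"
      by (rule infsum_cnj_lattice) simp
    then show ?thesis by (simp add: wp_def)
  qed
  ultimately show ?thesis by (simp add: Reals_cnj_iff)
qed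

end

lemma ec_neg_neg: "ec_neg (ec_neg Q) = Q"
  by (cases Q) auto

lemma ec_add_eq_Infinity_iff: "ec_add a Q R = Infinity \<longleftrightarrow> R = ec_neg Q"
  by (cases Q; cases R) (auto simp: Let_def)

locale real_lattice = complex_lattice +
  fixes \<gamma>2 \<gamma>3 \<omega> :: real
  assumes g2_real: "lattice_g2 \<Lambda> = complex_of_real \<gamma>2" and g3_real: "lattice_g3 \<Lambda> = complex_of_real \<gamma>3"
    and \<omega>_pos: "\<omega> > 0" and \<omega>_mem: "complex_of_real \<omega> \<in> \<Lambda>"
    and \<omega>_least: "\<And>x. x > 0 \<Longrightarrow> complex_of_real x \<in> \<Lambda> \<Longrightarrow> \<omega> \<le> x"
begin

text \<open>Division with remainder by \<omega>: the remainder is a real lattice element in [0,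
  \<omega>), and minimality makes it 0.\<close>

lemma real_mem_iff: "complex_of_real x \<in> \<Lambda> \<longleftrightarrow> (\<exists>k::int. x = of_int k * \<omega>)"
proof
  assume x: "complex_of_real x \<in> \<Lambda>"
  define k where "k = \<lfloor>x / \<omega>\<rfloor>"
  define y where "y = x - of_int k * \<omega>"
  have "complex_of_real y \<in> \<Lambda>"
    using diff_mem[OF x of_int_mult_mem[OF \<omega>_mem, of k]] by (simp add: y_def)
  moreover have "y = \<omega> * frac (x / \<omega>)"
    using \<omega>_pos by (simp add: y_def k_def frac_def field_simps)
  then have "0 \<le> y" "y < \<omega>" using \<omega>_pos frac_ge_0[of "x / \<omega>"] frac_lt_1[of "x / \<omega>"] by auto
  ultimately have "y = 0" using \<omega>_least[of y] by force
  then show "\<exists>k::int. x = of_int k * \<omega>" by (auto simp: y_def)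
next
  assume "\<exists>k::int. x = of_int k * \<omega>"
  then show "complex_of_real x \<in> \<Lambda>" using of_int_mult_mem[OF \<omega>_mem] by auto
qed

lemma not_mem_interior: "0 < t \<Longrightarrow> t < \<omega> \<Longrightarrow> complex_of_real t \<notin> \<Lambda>"
  using \<omega>_least[of t] by auto

definition f :: "real \<Rightarrow> real" where "f t = Re (wp \<Lambda> (of_real t))"
definition f' :: "real \<Rightarrow> real" where "f' t = Re (wp' (of_real t))"

lemma wp_eq_f:
  assumes "complex_of_real t \<notin> \<Lambda>"
  shows "wp \<Lambda> (of_real t) = of_real (f t)"
  using wp_of_real[OF _ _ assms] by (simp add: g2_real g3_real f_def)

text \<open>The imaginary part of \<open>wp\<close> is 0 on an open set of reals around t, so its
  derivative is 0 as well.\<close>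

lemma f_has_deriv:
  assumes t: "complex_of_real t \<notin> \<Lambda>"
  shows "(f has_real_derivative f' t) (at t)" and "wp' (of_real t) = of_real (f' t)"
proof -
  have v: "((\<lambda>s. wp \<Lambda> (of_real s)) has_vector_derivative wp' (of_real t)) (at t)"
    using wp_has_deriv[OF t] by (rule has_vector_derivative_real_field)
  then show "(f has_real_derivative f' t) (at t)"
    unfolding f_def f'_def has_real_derivative_iff_has_vector_derivative
    by (rule bounded_linear.has_vector_derivative[OF bounded_linear_Re])
  have "((\<lambda>s. Im (wp \<Lambda> (of_real s))) has_vector_derivative Im (wp' (of_real t))) (at t)"
    using v by (rule bounded_linear.has_vector_derivative[OF bounded_linear_Im])
  moreover have "((\<lambda>s. Im (wp \<Lambda> (of_real s))) has_vector_derivative 0) (at t)"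
  proof (rule has_vector_derivative_transform_within_open[OF has_vector_derivative_const])
    show "open (complex_of_real -` (- \<Lambda>))" by (intro open_vimage open_compl continuous_intros)
    show "t \<in> complex_of_real -` (- \<Lambda>)" using t by simp
    show "0 = Im (wp \<Lambda> (of_real s))" if "s \<in> complex_of_real -` (- \<Lambda>)" for s
      using that by (simp add: wp_eq_f)
  qed
  ultimately have "Im (wp' (of_real t)) = 0" by (rule vector_derivative_unique_at)
  then show "wp' (of_real t) = of_real (f' t)" by (simp add: f'_def complex_eq_iff)
qed

lemma f'_isCont:
  assumes t: "complex_of_real t \<notin> \<Lambda>"
  shows "isCont f' t"
proof -
  have "isCont wp' (complex_of_real t)" by (rule DERIV_isCont[OF wp'_has_deriv[OF t]])
  then have "isCont (\<lambda>s. wp' (complex_of_real s)) t"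
    by (rule isCont_o2[of t complex_of_real, rotated]) (intro continuous_of_real continuous_ident)
  then show ?thesis unfolding f'_def by (rule isCont_Re)
qed

lemma f_ode:
  assumes "complex_of_real t \<notin> \<Lambda>"
  shows "(f' t)\<^sup>2 = 4 * f t ^ 3 - \<gamma>2 * f t - \<gamma>3"
proof -
  have "complex_of_real ((f' t)\<^sup>2) = of_real (4 * f t ^ 3 - \<gamma>2 * f t - \<gamma>3)"
    using wp_ode[OF assms] by (simp add: wp_eq_f f_has_deriv(2) assms g2_real g3_real)
  then show ?thesis by (simp only: of_real_eq_iff)
qed

lemma has_parameter_Affine:
  "has_parameter \<Lambda> t (Affine x y) \<longleftrightarrow> complex_of_real t \<notin> \<Lambda> \<and> x = f t \<and> y = f' t"
proof (cases "complex_of_real t \<in> \<Lambda>")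
  case False
  then show ?thesis by (simp add: wp_eq_f f_has_deriv(2))
qed simp

section \<open>The measure of an interval\<close>

lemma has_parameter_shift:
  assumes "v \<in> \<Lambda>" "complex_of_real s = of_real t + v"
  shows "has_parameter \<Lambda> s Q \<longleftrightarrow> has_parameter \<Lambda> t Q"
  by (cases Q) (simp_all add: assms add_mem_iff wp_periodic deriv_wp_periodic)

lemma has_parameter_inj:
  assumes "has_parameter \<Lambda> s Q" "has_parameter \<Lambda> t Q"
  shows "complex_of_real (s - t) \<in> \<Lambda>"
proof (cases Q)
  case Infinity
  then show ?thesis using assms diff_mem by simp
next
  case (Affine x y)
  then show ?thesis using assms wp_unique[of "of_real s" "of_real t"] by auto
qed

lemma f_inj:
  assumes "0 < s" "s < \<omega>" "0 < t" "t < \<omega>" "f s = f t" "f' s = f' t"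
  shows "s = t"
proof -
  have "complex_of_real (s - t) \<in> \<Lambda>"
    using assms not_mem_interior by (intro has_parameter_inj[of _ "Affine (f s) (f' s)"]) (simp_all add: has_parameter_Affine del: has_parameter.simps)
  then obtain k :: int where k: "s - t = of_int k * \<omega>" using real_mem_iff by blast
  have "\<bar>s - t\<bar> < \<omega>" using assms(1-4) by linarith
  then have "\<bar>of_int k\<bar> * \<omega> < 1 * \<omega>" using \<omega>_pos by (simp add: k abs_mult)
  then have "\<bar>real_of_int k\<bar> < 1" using \<omega>_pos by (simp only: mult_less_cancel_right_pos)
  then have "k = 0" by linarith
  then show ?thesis using k by simp
qed

lemma f'_eq_0_imp:
  assumes "0 < t" "t < \<omega>" "f' t = 0"
  shows "t = \<omega> / 2"
proof -
  have "complex_of_real (2 * t) \<in> \<Lambda>"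
    using wp'_eq_0_iff[of "of_real t"] not_mem_interior[of t] assms by (simp add: f_has_deriv(2))
  then obtain k :: int where k: "2 * t = of_int k * \<omega>" using real_mem_iff by blast
  have "0 < real_of_int k * \<omega>" "real_of_int k * \<omega> < 2 * \<omega>" using assms k by linarith+
  then have "0 < real_of_int k" "real_of_int k < 2" using \<omega>_pos by (simp_all add: zero_less_mult_iff)
  then have "k = 1" by linarith
  then show ?thesis using k by simp
qed

text \<open>The sign \<open>\<sigma>\<close> selects one of the branches \<open>y > 0\<close> and \<open>y < 0\<close>, on which \<open>x\<close> is an
  injective function of the parameter with \<open>|dx/dt| = |y|\<close>.\<close>
lemma branch_integral:
  fixes \<sigma> a b :: real
  assumes "\<sigma> \<noteq> 0"
  defines "D \<equiv> {t \<in> {a..b}. 0 < t \<and> t < \<omega> \<and> 0 < \<sigma> * f' t}"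
  shows "(LINT x : f ` D | lborel. 1 / sqrt (4 * x ^ 3 - \<gamma>2 * x - \<gamma>3)) = measure lebesgue D"
    and "D \<in> lmeasurable"
proof -
  define h where "h = (\<lambda>x. 1 / sqrt (4 * x ^ 3 - \<gamma>2 * x - \<gamma>3))"
  have nin: "complex_of_real t \<notin> \<Lambda>" if "t \<in> D" for t
    using that not_mem_interior by (simp add: D_def)
  define e where "e = (\<lambda>n. 1 / real (Suc n))"
  define C where "C = (\<lambda>n. {t \<in> {max a (e n)..min b (\<omega> - e n)}. e n \<le> \<sigma> * f' t})"
  have e_pos: "e n > 0" for n by (simp add: e_def)
  have nin_C: "complex_of_real t \<notin> \<Lambda>" if "t \<in> {max a (e n)..min b (\<omega> - e n)}" for t n
    using that e_pos[of n] by (intro not_mem_interior) auto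
  have compact: "compact (C n)" for n
  proof -
    have "continuous_on {max a (e n)..min b (\<omega> - e n)} (\<lambda>t. \<sigma> * f' t)"
      by (intro continuous_at_imp_continuous_on ballI continuous_intros f'_isCont nin_C)
    then have "closed ({max a (e n)..min b (\<omega> - e n)} \<inter> (\<lambda>t. \<sigma> * f' t) -` {e n..})"
      by (intro continuous_closed_preimage) auto
    moreover have "{max a (e n)..min b (\<omega> - e n)} \<inter> (\<lambda>t. \<sigma> * f' t) -` {e n..} = C n"
      by (auto simp: C_def)
    ultimately have "closed (C n)" by simp
    moreover have "bounded (C n)"
      by (rule bounded_subset[of "{max a (e n)..min b (\<omega> - e n)}"]) (auto simp: C_def)
    ultimately show ?thesis by (simp add: compact_eq_bounded_closed)
  qed
  have D_eq: "D = (\<Union>n. C n)"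
  proof (intro subset_antisym subsetI)
    fix t assume t: "t \<in> D"
    then have "0 < min (min t (\<omega> - t)) (\<sigma> * f' t)" by (simp add: D_def)
    then obtain n where "e n < min (min t (\<omega> - t)) (\<sigma> * f' t)"
      unfolding e_def using nat_approx_posE by blast
    then have "t \<in> C n" using t by (auto simp: C_def D_def)
    then show "t \<in> (\<Union>n. C n)" by blast
  next
    fix t assume "t \<in> (\<Union>n. C n)"
    then obtain n where "t \<in> C n" by blast
    then show "t \<in> D" using e_pos[of n] by (auto simp: C_def D_def)
  qed
  have contf: "continuous_on (C n) f" for n
    using nin unfolding D_eq by (intro continuous_at_imp_continuous_on ballI DERIV_isCont[OF f_has_deriv(1)]) blast
  have "C n \<in> sets borel" for n using compact by (intro borel_closed compact_imp_closed)
  then have "D \<in> sets borel" unfolding D_eq by (intro sets.countable_UN) auto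
  have "f ` C n \<in> sets borel" for n
    using compact contf by (intro borel_closed compact_imp_closed compact_continuous_image)
  then have "(\<Union>n. f ` C n) \<in> sets borel" by (intro sets.countable_UN) auto
  then have fD: "f ` D \<in> sets borel" unfolding D_eq by (simp add: image_UN)
  have "bounded D" by (rule bounded_subset[of "{a..b}"]) (auto simp: D_def)
  then show lD: "D \<in> lmeasurable" using \<open>D \<in> sets borel\<close>
    by (intro bounded_set_imp_lmeasurable) (simp_all add: sets_completionI_sets)
  have inj: "inj_on f D"
  proof (rule inj_onI)
    fix s t assume st: "s \<in> D" "t \<in> D" "f s = f t"
    have D: "0 < u \<and> u < \<omega> \<and> 0 < \<sigma> * f' u" if "u \<in> D" for u using that by (simp add: D_def)
    have "(f' s)\<^sup>2 = (f' t)\<^sup>2" using f_ode nin st by simp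
    then have "f' s = f' t \<or> f' s = - f' t" by (simp only: power2_eq_iff)
    moreover have "f' s \<noteq> - f' t"
    proof
      assume "f' s = - f' t"
      then have "\<sigma> * f' s = - (\<sigma> * f' t)" by simp
      then show False using D[OF st(1)] D[OF st(2)] by linarith
    qed
    ultimately have "f' s = f' t" by blast
    then show "s = t" using D[OF st(1)] D[OF st(2)] st(3) f_inj by blast
  qed
  \<comment> \<open>The Jacobian |dx/dt| = |y| cancels the density 1 / |y|, so the pulled-back
    integrand is the constant 1.\<close>
  have one: "\<bar>f' t\<bar> * h (f t) = 1" if t: "t \<in> D" for t
  proof -
    have "sqrt ((f' t)\<^sup>2) = \<bar>f' t\<bar>" by simp
    moreover have "f' t \<noteq> 0" using t by (auto simp: D_def)
    ultimately show ?thesis unfolding h_def f_ode[OF nin[OF t], symmetric] by simp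
  qed
  have "(\<lambda>t. 1 :: real) integrable_on D"
    using lD by (simp add: lmeasurable_iff_integrable_on)
  then have "(\<lambda>t. \<bar>f' t\<bar> * h (f t)) integrable_on D"
    by (rule integrable_eq) (simp add: one)
  then have "(\<lambda>t. \<bar>f' t\<bar> * h (f t)) absolutely_integrable_on D"
    by (rule nonnegative_absolutely_integrable_1) (simp add: one)
  moreover have "integral D (\<lambda>t. \<bar>f' t\<bar> * h (f t)) = measure lebesgue D"
    using lmeasure_integral[OF lD] by (subst integral_cong[of D _ "\<lambda>_. 1"]) (auto simp: one)
  ultimately have hD: "h absolutely_integrable_on f ` D \<and> integral (f ` D) h = measure lebesgue D"
    using has_absolute_integral_change_of_variables_1'[of D f f' h "measure lebesgue D"]
      lD inj f_has_deriv(1) nin by (auto intro: DERIV_subset fmeasurableD)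
  \<comment> \<open>The change of variables is stated for Lebesgue measure; since the image is Borel
    and the integrand Borel measurable, passing to the completion leaves the integral
    unchanged.\<close>
  have "(LINT x : f ` D | lborel. h x) = (LINT x : f ` D | lebesgue. h x)"
    unfolding set_lebesgue_integral_def
    by (rule integral_completion[symmetric]) (use fD in \<open>simp add: h_def; measurable\<close>)
  also have "\<dots> = integral (f ` D) h"
    by (rule set_lebesgue_integral_eq_integral) (use hD in blast)
  finally show "(LINT x : f ` D | lborel. 1 / sqrt (4 * x ^ 3 - \<gamma>2 * x - \<gamma>3)) = measure lebesgue D"
    using hD by (simp add: h_def)
qed

text \<open>The parameter sets of the two branches are disjoint and fill [a, b] up to the poles 0
  and \<omega> and the zero \<omega> / 2 of \<open>f'\<close>, so the two integrals add up to b -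
  a.\<close>

lemma curve_measure_interval:
  assumes "0 \<le> a" "a \<le> b" "b \<le> \<omega>"
  shows "curve_measure \<Lambda> \<gamma>2 \<gamma>3 \<omega> {a..b} = (b - a) / \<omega>"
proof -
  define D where "D = (\<lambda>\<sigma>. {t \<in> {a..b}. 0 < t \<and> t < \<omega> \<and> 0 < \<sigma> * f' t})"
  have inter: "complex_of_real t \<notin> \<Lambda> \<longleftrightarrow> 0 < t \<and> t < \<omega>" if "t \<in> {a..b}" for t
    using that assms not_mem_interior[of t] \<omega>_mem by (cases "t = 0 \<or> t = \<omega>") auto
  have image: "{x. \<exists>y. 0 < \<sigma> * y \<and> (\<exists>t\<in>{a..b}. has_parameter \<Lambda> t (Affine x y))} = f ` D \<sigma>" for \<sigma>
  proof (intro subset_antisym subsetI)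
    fix x assume "x \<in> {x. \<exists>y. 0 < \<sigma> * y \<and> (\<exists>t\<in>{a..b}. has_parameter \<Lambda> t (Affine x y))}"
    then obtain y t where "0 < \<sigma> * y" "t \<in> {a..b}" "has_parameter \<Lambda> t (Affine x y)" by blast
    then have "t \<in> D \<sigma>" "x = f t"
      using inter[of t] unfolding has_parameter_Affine D_def by auto
    then show "x \<in> f ` D \<sigma>" by blast
  next
    fix x assume "x \<in> f ` D \<sigma>"
    then obtain t where t: "t \<in> D \<sigma>" "x = f t" by blast
    then have "0 < \<sigma> * f' t" "t \<in> {a..b}" "has_parameter \<Lambda> t (Affine x (f' t))"
      using inter[of t] unfolding has_parameter_Affine D_def by auto
    then show "x \<in> {x. \<exists>y. 0 < \<sigma> * y \<and> (\<exists>t\<in>{a..b}. has_parameter \<Lambda> t (Affine x y))}" by blast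
  qed
  have pos: "{x. \<exists>y>0. \<exists>t\<in>{a..b}. has_parameter \<Lambda> t (Affine x y)} = f ` D 1"
    using image[of 1] by (simp del: has_parameter.simps)
  have neg: "{x. \<exists>y<0. \<exists>t\<in>{a..b}. has_parameter \<Lambda> t (Affine x y)} = f ` D (- 1)"
    using image[of "- 1"] by (simp del: has_parameter.simps)
  have lD: "D 1 \<in> lmeasurable" "D (- 1) \<in> lmeasurable"
    unfolding D_def by (rule branch_integral(2); simp)+
  have "measure lebesgue (D 1) + measure lebesgue (D (- 1)) = measure lebesgue (D 1 \<union> D (- 1))"
  proof -
    have "D (- 1) - D 1 = D (- 1)" by (auto simp: D_def)
    then show ?thesis using measure_Un2[OF lD] by simp
  qed
  also have "\<dots> = measure lebesgue {a..b}"
  proof (rule measure_negligible_symdiff)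
    have "({a..b} - (D 1 \<union> D (- 1))) \<union> ((D 1 \<union> D (- 1)) - {a..b}) \<subseteq> {0, \<omega> / 2, \<omega>}"
    proof
      fix t assume "t \<in> ({a..b} - (D 1 \<union> D (- 1))) \<union> ((D 1 \<union> D (- 1)) - {a..b})"
      then have t: "t \<in> {a..b}" "t \<notin> D 1" "t \<notin> D (- 1)" by (auto simp: D_def)
      show "t \<in> {0, \<omega> / 2, \<omega>}"
      proof (cases "0 < t \<and> t < \<omega>")
        case True
        then have "\<not> 0 < f' t" "\<not> f' t < 0" using t by (simp_all add: D_def)
        then show ?thesis using f'_eq_0_imp True by simp
      next
        case False
        then show ?thesis using t(1) assms by auto
      qed
    qed
    then show "negligible (({a..b} - (D 1 \<union> D (- 1))) \<union> ((D 1 \<union> D (- 1)) - {a..b}))"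
      by (rule negligible_subset[rotated]) (simp add: negligible_finite)
  qed simp
  also have "\<dots> = b - a" using assms by simp
  finally have sum: "measure lebesgue (D 1) + measure lebesgue (D (- 1)) = b - a" .
  have br: "(LINT x : f ` D \<sigma> | lborel. 1 / sqrt (4 * x ^ 3 - \<gamma>2 * x - \<gamma>3)) = measure lebesgue (D \<sigma>)"
    if "\<sigma> \<noteq> 0" for \<sigma>
    unfolding D_def by (rule branch_integral(1)[OF that])
  have "1 \<noteq> (0 :: real)" "- 1 \<noteq> (0 :: real)" by simp_all
  from br[OF this(1)] br[OF this(2)] show ?thesis
    unfolding curve_measure_def pos neg using sum by (simp only:)
qed

section \<open>Multiples of a point\<close>

lemma has_parameter_carrier:
  assumes "has_parameter \<Lambda> t Q"
  shows "Q \<in> ec_carrier \<gamma>2 \<gamma>3"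
proof (cases Q)
  case (Affine x y)
  then show ?thesis using assms f_ode unfolding Affine has_parameter_Affine by (auto simp: ec_carrier_def)
qed (simp add: ec_carrier_def)

lemma has_parameter_neg:
  assumes "has_parameter \<Lambda> t Q"
  shows "has_parameter \<Lambda> (- t) (ec_neg Q)"
  using assms by (cases Q) (auto simp: wp_minus deriv_wp_minus)

text \<open>Each case of the chord-tangent law corresponds to a case of the addition theorem;
  opposite points are exactly those with s + t \<in> \<Lambda>.\<close>

lemma has_parameter_add:
  assumes Q: "has_parameter \<Lambda> s Q" and R: "has_parameter \<Lambda> t R"
  shows "has_parameter \<Lambda> (s + t) (ec_add \<gamma>2 Q R)"
proof (cases Q)
  case Infinity
  then show ?thesis
    using assms has_parameter_shift[of "of_real s" "s + t" t R] by simp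
next
  case (Affine x1 y1)
  note Q_eq = this
  show ?thesis
  proof (cases R)
    case Infinity
    then show ?thesis
      using assms has_parameter_shift[of "of_real t" "s + t" s Q] Q_eq by simp
  next
    case (Affine x2 y2)
    have s: "complex_of_real s \<notin> \<Lambda>" "wp \<Lambda> (of_real s) = of_real x1" "wp' (of_real s) = of_real y1"
      using Q Q_eq by auto
    have t: "complex_of_real t \<notin> \<Lambda>" "wp \<Lambda> (of_real t) = of_real x2" "wp' (of_real t) = of_real y2"
      using R Affine by auto
    have neg: "x2 = x1 \<and> y2 = - y1" if "complex_of_real s + of_real t \<in> \<Lambda>"
    proof -
      have "has_parameter \<Lambda> t (ec_neg Q)"
        using has_parameter_neg[OF Q] has_parameter_shift[OF that, of t "- s" "ec_neg Q"] by simp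
      then show ?thesis using t Q_eq by simp
    qed
    show ?thesis
    proof (cases "Affine x2 y2 = ec_neg (Affine x1 y1)")
      case True
      then have "has_parameter \<Lambda> (- s) R" using has_parameter_neg[OF Q] Q_eq Affine by simp
      then have "complex_of_real (t - - s) \<in> \<Lambda>" using R by (intro has_parameter_inj) auto
      then show ?thesis using True Q_eq Affine by (simp add: add.commute)
    next
      case False
      then have st: "complex_of_real (s + t) \<notin> \<Lambda>" using neg by auto
      define l where "l = (if x1 = x2 then (12 * x1\<^sup>2 - \<gamma>2) / (2 * y1) else (y2 - y1) / (x2 - x1))"
      define x3 where "x3 = l\<^sup>2 / 4 - x1 - x2"
      have add: "ec_add \<gamma>2 Q R = Affine x3 (- (y1 + l * (x3 - x1)))"
        using False unfolding Q_eq Affine ec_add.simps l_def x3_def Let_def by simp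
      have "wp \<Lambda> (of_real s + of_real t) = of_real l ^ 2 / 4 - of_real x1 - of_real x2 \<and>
          wp' (of_real s + of_real t) =
            - (of_real y1 + of_real l * (wp \<Lambda> (of_real s + of_real t) - of_real x1))"
      proof (cases "x1 = x2")
        case True
        \<comment> \<open>Equal abscissas of points that are not opposite: s and t differ by a
          lattice element, and periodicity reduces s + t to 2 s.\<close>
        have "wp' (of_real s) = wp' (of_real t) \<and> complex_of_real s - of_real t \<in> \<Lambda>"
          using wp_eq_imp[OF s(1) t(1)] s t True neg False by auto
        then have y: "y1 = y2" and v: "complex_of_real t - of_real s \<in> \<Lambda>"
          using s t minus_mem[of "complex_of_real s - of_real t"] by auto
        have "y1 \<noteq> 0" using False True y by auto
        then have nz: "wp' (of_real s) \<noteq> 0" using s by simp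
        have eq: "complex_of_real s + of_real t = 2 * of_real s + (of_real t - of_real s)" by simp
        have l: "(12 * (wp \<Lambda> (of_real s))\<^sup>2 - g2) / (2 * wp' (of_real s)) = of_real l"
          unfolding s g2_real l_def using True by simp
        have "wp \<Lambda> (of_real s + of_real t) = wp \<Lambda> (2 * of_real s)"
          "wp' (of_real s + of_real t) = wp' (2 * of_real s)"
          unfolding eq by (rule wp_periodic[OF v], rule deriv_wp_periodic[OF v])
        then show ?thesis
          using wp_double[OF s(1) nz, unfolded l] unfolding s True by simp
      next
        case False
        then have ne: "wp \<Lambda> (of_real s) \<noteq> wp \<Lambda> (of_real t)" using s t by simp
        have l: "(wp' (of_real s) - wp' (of_real t)) / (wp \<Lambda> (of_real s) - wp \<Lambda> (of_real t)) = of_real l"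
        proof -
          have "l = (y1 - y2) / (x1 - x2)" using False by (simp add: l_def field_simps)
          then show ?thesis unfolding s t by simp
        qed
        have st': "complex_of_real s + of_real t \<notin> \<Lambda>" using st by simp
        show ?thesis
          using wp_add[OF s(1) t(1) st' ne, unfolded l] wp'_add[OF s(1) t(1) st' ne, unfolded l]
          unfolding s t by simp
      qed
      then show ?thesis unfolding add using st by (simp add: x3_def)
    qed
  qed
qed

lemma ec_neg_carrier: "Q \<in> ec_carrier \<gamma>2 \<gamma>3 \<Longrightarrow> ec_neg Q \<in> ec_carrier \<gamma>2 \<gamma>3"
  by (cases Q) (auto simp: ec_carrier_def)

text \<open>The inverse is a definite description, so uniqueness must be shown: a sum is
  \<open>Infinity\<close> only if the summands are opposite. Negative values of p(n) call for
  it.\<close>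

lemma inv_ec_group:
  assumes "Q \<in> ec_carrier \<gamma>2 \<gamma>3"
  shows "inv\<^bsub>ec_group \<gamma>2 \<gamma>3\<^esub> Q = ec_neg Q"
proof -
  have "(THE R. R \<in> ec_carrier \<gamma>2 \<gamma>3 \<and> ec_add \<gamma>2 Q R = Infinity \<and> ec_add \<gamma>2 R Q = Infinity) = ec_neg Q"
  proof (rule the_equality)
    show "ec_neg Q \<in> ec_carrier \<gamma>2 \<gamma>3 \<and> ec_add \<gamma>2 Q (ec_neg Q) = Infinity \<and>
        ec_add \<gamma>2 (ec_neg Q) Q = Infinity"
      unfolding ec_add_eq_Infinity_iff ec_neg_neg using ec_neg_carrier[OF assms] by simp
  qed (use ec_add_eq_Infinity_iff in blast)
  then show ?thesis unfolding m_inv_def by (simp add: ec_group_def)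
qed

lemma has_parameter_int_pow:
  assumes "has_parameter \<Lambda> z P"
  shows "has_parameter \<Lambda> (of_int m * z) (P [^]\<^bsub>ec_group \<gamma>2 \<gamma>3\<^esub> m)"
proof -
  have nat: "has_parameter \<Lambda> (real n * z) (P [^]\<^bsub>ec_group \<gamma>2 \<gamma>3\<^esub> n)" for n :: nat
  proof (induction n)
    case (Suc n)
    then have "has_parameter \<Lambda> (real n * z + z) (ec_add \<gamma>2 (P [^]\<^bsub>ec_group \<gamma>2 \<gamma>3\<^esub> n) P)"
      using assms by (rule has_parameter_add)
    then show ?case by (simp add: ec_group_def algebra_simps)
  qed (simp add: ec_group_def)
  show ?thesis
  proof (cases "m < 0")
    case True
    let ?Q = "P [^]\<^bsub>ec_group \<gamma>2 \<gamma>3\<^esub> nat (- m)"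
    have "P [^]\<^bsub>ec_group \<gamma>2 \<gamma>3\<^esub> m = inv\<^bsub>ec_group \<gamma>2 \<gamma>3\<^esub> ?Q"
      using True by (simp only: int_pow_def2 if_True)
    also have "\<dots> = ec_neg ?Q" by (rule inv_ec_group[OF has_parameter_carrier[OF nat]])
    finally have e: "P [^]\<^bsub>ec_group \<gamma>2 \<gamma>3\<^esub> m = ec_neg ?Q" .
    have "- (real (nat (- m)) * z) = of_int m * z" using True by simp
    then show ?thesis using has_parameter_neg[OF nat[of "nat (- m)"]] by (simp only: e)
  next
    case False
    then have e: "P [^]\<^bsub>ec_group \<gamma>2 \<gamma>3\<^esub> m = P [^]\<^bsub>ec_group \<gamma>2 \<gamma>3\<^esub> nat m"
      by (simp only: int_pow_def2 if_False)
    have "real (nat m) = of_int m" using False by simp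
    then show ?thesis using nat[of "nat m"] by (simp only: e)
  qed
qed

text \<open>Since p is monic, p(n) z / \<omega> is a polynomial in n with leading coefficient z /
  \<omega>. Its fractional part, scaled by \<omega>, is the parameter of [p(n)]P in [0,
  \<omega>).\<close>

lemma curve_equidistributed_multiples:
  fixes p :: "int poly"
  assumes z: "0 \<le> z" "z < \<omega>" and P: "has_parameter \<Lambda> z P"
    and p: "lead_coeff p = 1" "degree p > 0"
    and irr: "z / \<omega> \<notin> \<rat>"
  shows "curve_equidistributed \<Lambda> \<gamma>2 \<gamma>3 \<omega> (\<lambda>n. P [^]\<^bsub>ec_group \<gamma>2 \<gamma>3\<^esub> poly p (int n))"
proof -
  define q where "q = smult (z / \<omega>) (map_poly real_of_int p)"
  define s where "s = (\<lambda>n. \<omega> * frac (poly q (real n)))"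
  have nz: "z / \<omega> \<noteq> 0" using irr by auto
  have q_eq: "poly q (real n) = of_int (poly p (int n)) * z / \<omega>" for n
  proof -
    have "poly (map_poly real_of_int p) (real_of_int (int n)) = of_int (poly p (int n))"
      by (rule poly_map_poly_of_int)
    then show ?thesis by (simp add: q_def)
  qed
  have deg: "degree q = degree p" using nz by (simp add: q_def degree_map_poly)
  then have lead: "lead_coeff q = z / \<omega>" using p by (simp add: q_def coeff_map_poly)
  have "s n \<in> {0..<\<omega>}" for n
    using \<omega>_pos frac_ge_0[of "poly q (real n)"] frac_lt_1[of "poly q (real n)"] by (simp add: s_def)
  moreover have "has_parameter \<Lambda> (s n) (P [^]\<^bsub>ec_group \<gamma>2 \<gamma>3\<^esub> poly p (int n))" for n
  proof -
    have "of_int (poly p (int n)) * z = s n + of_int \<lfloor>poly q (real n)\<rfloor> * \<omega>"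
      using \<omega>_pos by (simp add: s_def frac_def q_eq algebra_simps)
    then have "complex_of_real (of_int (poly p (int n)) * z) =
        of_real (s n) + of_int \<lfloor>poly q (real n)\<rfloor> * of_real \<omega>" by simp
    then show ?thesis
      using has_parameter_int_pow[OF P, of "poly p (int n)"]
        has_parameter_shift[OF of_int_mult_mem[OF \<omega>_mem]] by blast
  qed
  moreover have "(\<lambda>N. real (card {n \<in> {1..N}. s n \<in> {a..b}}) / real N)
      \<longlonglongrightarrow> curve_measure \<Lambda> \<gamma>2 \<gamma>3 \<omega> {a..b}" if ab: "0 \<le> a" "a \<le> b" "b \<le> \<omega>" for a b
  proof -
    have "s n \<in> {a..b} \<longleftrightarrow> frac (poly q (real n)) \<in> {a / \<omega>..b / \<omega>}" for n
      using \<omega>_pos by (simp add: s_def field_simps)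
    moreover have "(\<lambda>N. real (card {n \<in> {1..N}. frac (poly q (real n)) \<in> {a / \<omega>..b / \<omega>}}) / real N)
        \<longlonglongrightarrow> b / \<omega> - a / \<omega>"
    proof (rule weyl_polynomial_equidistribution)
      show "degree q > 0" using p by (simp add: deg)
      show "lead_coeff q \<notin> \<rat>" unfolding lead by (rule irr)
    qed (use \<omega>_pos ab in \<open>simp_all add: divide_right_mono\<close>)
    ultimately show ?thesis
      unfolding curve_measure_interval[OF ab] by (simp add: diff_divide_distrib)
  qed
  ultimately show ?thesis unfolding curve_equidistributed_def by blast
qed

text \<open>If \<open>z / \<omega>\<close> has denominator \<open>d\<close>, all parameters lie in \<open>(\<omega> / d) \<int>\<close>, so they miss an interval of
  positive measure.\<close>
lemma not_curve_equidistributed_multiples: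
  fixes p :: "int poly"
  assumes P: "has_parameter \<Lambda> z P" and rat: "z / \<omega> \<in> \<rat>"
  shows "\<not> curve_equidistributed \<Lambda> \<gamma>2 \<gamma>3 \<omega> (\<lambda>n. P [^]\<^bsub>ec_group \<gamma>2 \<gamma>3\<^esub> poly p (int n))"
proof
  assume "curve_equidistributed \<Lambda> \<gamma>2 \<gamma>3 \<omega> (\<lambda>n. P [^]\<^bsub>ec_group \<gamma>2 \<gamma>3\<^esub> poly p (int n))"
  then obtain s where s: "\<And>n. has_parameter \<Lambda> (s n) (P [^]\<^bsub>ec_group \<gamma>2 \<gamma>3\<^esub> poly p (int n))"
    and lim: "\<And>a b. 0 \<le> a \<Longrightarrow> a \<le> b \<Longrightarrow> b \<le> \<omega> \<Longrightarrow>
       (\<lambda>N. real (card {n \<in> {1..N}. s n \<in> {a..b}}) / real N) \<longlonglongrightarrow> curve_measure \<Lambda> \<gamma>2 \<gamma>3 \<omega> {a..b}"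
    unfolding curve_equidistributed_def by blast
  obtain i d :: int where d: "d > 0" and zid: "z / \<omega> = of_int i / of_int d"
    using rat by (rule Rats_cases') 
  define D where "D = real_of_int d"
  have D: "D \<ge> 1" using d by (simp add: D_def)
  have z: "z * D = of_int i * \<omega>" using zid \<omega>_pos d by (simp add: D_def field_simps)
  \<comment> \<open>The middle third of the gap between the neighbouring multiples 0 and \<omega> /
    D.\<close>
  define a b where "a = \<omega> / (3 * D)" and "b = 2 * \<omega> / (3 * D)"
  have ab: "0 \<le> a" "a < b" "b \<le> \<omega>"
    using \<omega>_pos D by (simp_all add: a_def b_def field_simps)
  have missed: "s n \<notin> {a..b}" for n
  proof
    assume sn: "s n \<in> {a..b}"
    \<comment> \<open>The parameters s are those supplied by the assumption; injectivity ties them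
      to p(n) z modulo \<omega>.\<close>
    have "complex_of_real (s n - of_int (poly p (int n)) * z) \<in> \<Lambda>"
      using s has_parameter_int_pow[OF P] by (rule has_parameter_inj)
    then obtain k :: int where "s n - of_int (poly p (int n)) * z = of_int k * \<omega>"
      using real_mem_iff by blast
    then have "s n * D = of_int (poly p (int n)) * (z * D) + of_int k * D * \<omega>"
      by (simp add: algebra_simps)
    also have "\<dots> = of_int (poly p (int n) * i + k * d) * \<omega>"
      unfolding z by (simp add: D_def algebra_simps)
    finally obtain j :: int where m: "s n * D = of_int j * \<omega>" by blast
    have "\<omega> \<le> 3 * (s n * D)" "3 * (s n * D) \<le> 2 * \<omega>"
      using sn D by (simp_all add: a_def b_def field_simps)
    \<comment> \<open>A multiple j \<omega> / D inside the window would mean 1 \<le> 3 j \<le> 2,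
      impossible for an integer j.\<close>
    then have "1 * \<omega> \<le> of_int (3 * j) * \<omega>" "of_int (3 * j) * \<omega> \<le> 2 * \<omega>"
      unfolding m by simp_all
    then have "1 \<le> real_of_int (3 * j)" "real_of_int (3 * j) \<le> 2"
      using \<omega>_pos by (simp_all only: mult_le_cancel_right_pos)
    then have "1 \<le> 3 * j" "3 * j \<le> 2"
      by (simp_all only: of_int_1_le_iff of_int_le_numeral_iff)
    then show False by presburger
  qed
  have empty: "{n \<in> {1..N}. s n \<in> {a..b}} = {}" for N using missed by blast
  have "(\<lambda>_::nat. 0 :: real) \<longlonglongrightarrow> (b - a) / \<omega>"
    using lim[of a b] ab unfolding empty by (simp add: curve_measure_interval)
  then have "0 = (b - a) / \<omega>" by (simp only: LIMSEQ_const_iff)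
  then show False using ab \<omega>_pos by simp
qed

end

theorem corollary6:
  fixes g2 g3 \<omega> z :: real and \<Lambda> :: "complex set"
    and P :: ec_point and p :: "int poly"
  assumes "g2 ^ 3 - 27 * g3\<^sup>2 \<noteq> 0"
    and "is_lattice \<Lambda>"
    and "lattice_g2 \<Lambda> = complex_of_real g2"
    and "lattice_g3 \<Lambda> = complex_of_real g3"
    and "\<omega> > 0" and "complex_of_real \<omega> \<in> \<Lambda>"
    and "\<And>x. x > 0 \<Longrightarrow> complex_of_real x \<in> \<Lambda> \<Longrightarrow> \<omega> \<le> x"
    and "lead_coeff p = 1" and "degree p > 0"
    and "0 \<le> z" and "z < \<omega>"
    and "P \<in> carrier (ec_group g2 g3)" and "has_parameter \<Lambda> z P"
  shows "curve_equidistributed \<Lambda> g2 g3 \<omega>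
           (\<lambda>n. P [^]\<^bsub>ec_group g2 g3\<^esub> poly p (int n))
         \<longleftrightarrow> z \<notin> {\<omega> * q | q. q \<in> \<rat>}"
proof -
  interpret real_lattice \<Lambda> g2 g3 \<omega>
    by unfold_locales (use assms in auto)
  have "z \<in> {\<omega> * q | q. q \<in> \<rat>} \<longleftrightarrow> z / \<omega> \<in> \<rat>"
  proof
    assume "z / \<omega> \<in> \<rat>"
    moreover have "z = \<omega> * (z / \<omega>)" using assms(5) by simp
    ultimately show "z \<in> {\<omega> * q | q. q \<in> \<rat>}" by blast
  qed (use assms(5) in auto)
  then show ?thesis
    using curve_equidistributed_multiples[OF assms(10,11,13,8,9)]
      not_curve_equidistributed_multiples[OF assms(13)] by blast
qed

end
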